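(* Let $p(\cdot), q(\cdot)\in \mathcal{P}(\mathbb{R})$. Consider the following statements. (i) The conditions $p_-\leq 2$, $q_+\leq (p_-)'$ and $1\in L^{r(\cdot)}(\mathbb{R})\cap L^{s(\cdot)}(\mathbb{R})$ hold, where $1$ is the constant function and $r(\cdot), s(\cdot)$ are the defect exponents defined by $$\frac{1}{r(\cdot)}=\frac{1}{p_-}-\frac{1}{p(\cdot)} \quad \text{and} \quad \frac{1}{s(\cdot)}=\frac{1}{q(\cdot)}-\frac{1}{(p_-)'}.$$ (ii) The Fourier transform $\mathscr{F} : L^{p(\cdot)}(\mathbb{R})\to L^{q(\cdot)}(\mathbb{R})$ is bounded. (iii) The conditions $$p_{\infty,r}^-=p_{\infty,l}^- = p_-\leq 2, \quad q_{\infty,r}^+=q_{\infty,l}^+ =q_+ \quad \text{and} \quad (p_-)'=q_+$$ hold. Then the implications (i) $\Rightarrow$ (ii) $\Rightarrow$ (iii) hold.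
   Context: $\mathcal{P}(\mathbb{R})$ is the set of Lebesgue measurable functions (exponents) $p(\cdot):\mathbb{R}\to[1,+\infty]$. For such $p(\cdot)$, $p_-:=\operatorname{ess\,inf}_{x\in\mathbb{R}}p(x)$ and $p_+:=\operatorname{ess\,sup}_{x\in\mathbb{R}}p(x)$. For $a\in[1,+\infty]$, $a'$ denotes the conjugate exponent, $\frac1a+\frac1{a'}=1$, with the convention $1/\infty=0$ (so e.g. $r(x)=+\infty$ where $1/r(x)=0$). With $\Omega_\infty:=\{x: p(x)=+\infty\}$, the modular is $\rho_{p(\cdot)}(f):=\int_{\mathbb{R}\setminus\Omega_\infty}|f(x)|^{p(x)}dx+\|f\|_{L^\infty(\Omega_\infty)}$. $L^{p(\cdot)}(\mathbb{R})$ is the Banach space of measurable (complex-valued) functions $f$ with $\rho_{p(\cdot)}(f/\lambda)<\infty$ for some $\lambda>0$, with the Luxemburg norm $\|f\|_{L^{p(\cdot)}(\mathbb{R})}=\inf\{\lambda>0:\rho_{p(\cdot)}(f/\lambda)\le1\}$. The essential limits at $\pm\infty$ are $p_{\infty,r}^-:=\lim_{M\to+\infty}\operatorname{ess\,inf}_{x\ge M}p(x)$, $p_{\infty,l}^-:=\lim_{M\to-\infty}\operatorname{ess\,inf}_{x\le M}p(x)$, $q_{\infty,r}^+:=\lim_{M\to+\infty}\operatorname{ess\,sup}_{x\ge M}q(x)$, $q_{\infty,l}^+:=\lim_{M\to-\infty}\operatorname{ess\,sup}_{x\le M}q(x)$. The Fourier transform is $\mathscr{F}f=\hat f$, where $\hat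 f(\xi)=\int_{\mathbb{R}}f(x)e^{-2\pi i x\xi}dx$ for Schwartz $f$, extended to tempered distributions by $\langle\hat g,f\rangle=\langle g,\hat f\rangle$ for Schwartz $f$; every element of $L^{p(\cdot)}(\mathbb{R})$ defines a tempered distribution. "$\mathscr{F}:L^{p(\cdot)}(\mathbb{R})\to L^{q(\cdot)}(\mathbb{R})$ is bounded" means that there is $C>0$ such that for every $f\in L^{p(\cdot)}(\mathbb{R})$ the distribution $\hat f$ is (represented by) a function in $L^{q(\cdot)}(\mathbb{R})$ and $\|\hat f\|_{L^{q(\cdot)}(\mathbb{R})}\le C\|f\|_{L^{p(\cdot)}(\mathbb{R})}$. *)

theory Defs
  imports "HOL-Probability.Essential_Supremum"
begin

section \<open>Variable exponents\<close>

text \<open>Exponents with values in $[1,\infty]$ are \<^typ>\<open>ennreal\<close>-valued, so that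
  \<^term>\<open>inverse\<close> realises the convention $1/\infty = 0$, $1/0 = \infty$.\<close>

definition exponents :: "(real \<Rightarrow> ennreal) set" where
  "exponents = {p. p \<in> borel_measurable lebesgue \<and> (\<forall>x. 1 \<le> p x)}"

definition essinf :: "'a measure \<Rightarrow> ('a \<Rightarrow> ennreal) \<Rightarrow> ennreal" where
  "essinf M f = Liminf (ae_filter M) f"

lemma essinf_eq_AE: "essinf M f = Sup {z. AE x in M. z \<le> f x}"
  unfolding essinf_def Liminf_def
proof (rule antisym; intro SUP_least Sup_least; clarsimp)
  fix P assume P: "AE x in M. P x"
  show "(INF x\<in>Collect P. f x) \<le> Sup {z. AE x in M. z \<le> f x}"
    by (rule Sup_upper) (use P in \<open>auto elim!: eventually_mono intro: INF_lower\<close>)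
next
  fix z assume "AE x in M. z \<le> f x"
  then show "z \<le> (SUP P\<in>{P. AE x in M. P x}. INF x\<in>Collect P. f x)"
    by (intro SUP_upper2[where i = "\<lambda>x. z \<le> f x"]) (auto intro: INF_greatest)
qed

definition conj_exponent :: "ennreal \<Rightarrow> ennreal" where
  "conj_exponent a = inverse (1 - inverse a)"

lemma conj_exponent:
  assumes "1 \<le> a"
  shows "inverse a + inverse (conj_exponent a) = 1"
proof -
  have "inverse a \<le> 1"
    using assms le_zero_eq
    by (cases a) (auto simp: inverse_ennreal ennreal_le_1 ennreal_1[symmetric] inverse_le_1_iff
        simp del: ennreal_1)
  moreover have "inverse (inverse x) = x" for x :: ennreal
    by (cases x; cases "x = 0") (auto simp: inverse_ennreal)
  ultimately show ?thesis
    unfolding conj_exponent_def by (simp add: add_diff_inverse_ennreal)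
qed

text \<open>\<open>1/r = 1/a - 1/b\<close>. Subtraction on \<^typ>\<open>ennreal\<close> is truncated; wherever the theorem
  uses this, \<open>a \<le> b\<close> holds almost everywhere, and the exceptional null set affects neither
  the modular nor the norm.\<close>

definition defect_exponent :: "ennreal \<Rightarrow> ennreal \<Rightarrow> ennreal" where
  "defect_exponent a b = inverse (inverse a - inverse b)"

text \<open>The essential bounds of the tails are monotone in \<open>M\<close>, so the following limits exist.\<close>

definition ess_inf_at_right :: "(real \<Rightarrow> ennreal) \<Rightarrow> ennreal" where
  "ess_inf_at_right p = Lim at_top (\<lambda>M. essinf (lebesgue_on {M..}) p)"

definition ess_inf_at_left :: "(real \<Rightarrow> ennreal) \<Rightarrow> ennreal" where
  "ess_inf_at_left p = Lim at_bot (\<lambda>M. essinf (lebesgue_on {..M}) p)"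

definition ess_sup_at_right :: "(real \<Rightarrow> ennreal) \<Rightarrow> ennreal" where
  "ess_sup_at_right q = Lim at_top (\<lambda>M. esssup (lebesgue_on {M..}) q)"

definition ess_sup_at_left :: "(real \<Rightarrow> ennreal) \<Rightarrow> ennreal" where
  "ess_sup_at_left q = Lim at_bot (\<lambda>M. esssup (lebesgue_on {..M}) q)"


section \<open>Variable Lebesgue spaces\<close>

text \<open>The essential supremum of an \<^typ>\<open>ennreal\<close>-valued function over a null set is \<open>0\<close>.\<close>

definition modular :: "(real \<Rightarrow> ennreal) \<Rightarrow> (real \<Rightarrow> complex) \<Rightarrow> ennreal" where
  "modular p f =
     (\<integral>\<^sup>+ x\<in>{x. p x \<noteq> \<infinity>}. ennreal (cmod (f x) powr enn2real (p x)) \<partial>lebesgue)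
     + esssup (lebesgue_on {x. p x = \<infinity>}) (\<lambda>x. ennreal (cmod (f x)))"

definition var_Lebesgue :: "(real \<Rightarrow> ennreal) \<Rightarrow> (real \<Rightarrow> complex) set" where
  "var_Lebesgue p = {f \<in> borel_measurable lebesgue.
     \<exists>lam::real. 0 < lam \<and> modular p (\<lambda>x. f x / of_real lam) < \<infinity>}"

definition var_norm :: "(real \<Rightarrow> ennreal) \<Rightarrow> (real \<Rightarrow> complex) \<Rightarrow> real" where
  "var_norm p f = Inf {lam::real. 0 < lam \<and> modular p (\<lambda>x. f x / of_real lam) \<le> 1}"


section \<open>The Fourier transform of tempered distributions\<close>

definition nth_deriv :: "nat \<Rightarrow> (real \<Rightarrow> complex) \<Rightarrow> real \<Rightarrow> complex" where
  "nth_deriv n f = ((\<lambda>g x. vector_derivative g (at x)) ^^ n) f"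

definition schwartz :: "(real \<Rightarrow> complex) set" where
  "schwartz = {f. \<forall>n. (\<forall>x. nth_deriv n f differentiable (at x)) \<and>
                      (\<forall>m. bounded (range (\<lambda>x. of_real (x ^ m) * nth_deriv n f x)))}"

definition fourier :: "(real \<Rightarrow> complex) \<Rightarrow> real \<Rightarrow> complex" where
  "fourier f \<xi> = (LINT x|lebesgue. f x * exp (- (2 * of_real pi * \<i> * of_real x * of_real \<xi>)))"

text \<open>Distributions act on functions through their values on \<^term>\<open>schwartz\<close> only. For \<open>g\<close> in a
  variable Lebesgue space (hence in $L^1 + L^\infty$) and \<open>\<phi>\<close> a Schwartz function, the product
  \<open>g \<phi>\<close> is integrable, so the integral below is never the default value of the
  Bochner integral.\<close>

definition distr_of_fun :: "(real \<Rightarrow> complex) \<Rightarrow> (real \<Rightarrow> complex) \<Rightarrow> complex" where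
  "distr_of_fun g \<phi> = (LINT x|lebesgue. g x * \<phi> x)"

definition fourier_distr :: "((real \<Rightarrow> complex) \<Rightarrow> complex) \<Rightarrow> (real \<Rightarrow> complex) \<Rightarrow> complex" where
  "fourier_distr T \<phi> = T (fourier \<phi>)"

definition represented_by :: "((real \<Rightarrow> complex) \<Rightarrow> complex) \<Rightarrow> (real \<Rightarrow> complex) \<Rightarrow> bool" where
  "represented_by T h \<longleftrightarrow> (\<forall>\<phi>\<in>schwartz. T \<phi> = distr_of_fun h \<phi>)"

definition fourier_bounded :: "(real \<Rightarrow> ennreal) \<Rightarrow> (real \<Rightarrow> ennreal) \<Rightarrow> bool" where
  "fourier_bounded p q \<longleftrightarrow>
     (\<exists>C>0. \<forall>f\<in>var_Lebesgue p. \<exists>h\<in>var_Lebesgue q.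
        represented_by (fourier_distr (distr_of_fun f)) h \<and> var_norm q h \<le> C * var_norm p f)"

end

theory Submission
  imports
    Defs
    "HOL-Computational_Algebra.Polynomial"
    "HOL-Probability.Levy"
    "HOL-Probability.Sinc_Integral"
    "HOL-Real_Asymp.Real_Asymp"
begin

text \<open>For the first implication, Hoelder's inequality in the form of Young's inequality for the
  modulars gives $L^{p(\cdot)} \subseteq L^{p_-}$ and $L^{(p_-)'} \subseteq L^{q(\cdot)}$, and
  between the constant exponents the Hausdorff--Young inequality applies. As no sharp constant is
  needed, it is obtained from the trivial bound $L^1 \to L^\infty$ and Plancherel's inequality
  (proved by testing against Gaussians) by Marcinkiewicz interpolation.

  For the second implication, take $f = 1_S e^{2\pi i \eta x}$ with $S$ in an interval of length
  $2R$: then $|\hat f| \ge |S|/2$ for $|\xi - \eta| \le 1/(6R)$, while $\eta$ and the position of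
  $S$ are free. A long interval far out, with $\eta$ where $q$ is almost maximal, gives
  $1/p_\infty^- + 1/q_+ \ge 1$ as $R \to \infty$; a short set where $p$ is almost minimal, with
  $\eta$ far out, gives $1/p_- + 1/q_\infty^+ \le 1$ as $R \to 0$. Since
  $p_- \le p_\infty^-$ and $q_\infty^+ \le q_+$, all these are equalities. Finally the chirps
  $e^{-\pi(1+it)x^2}$ have constant modulus in $t$ but transforms of height $t^{-1/2}$ on an
  interval of length $t$, which excludes $q_+ < 2$, that is $p_- > 2$.\<close>

section \<open>Gaussians and the Fourier integral\<close>

text \<open>Variable exponents destroy translation invariance, but the modular sees only the modulus
  of a function; this is why modulation and the position of \<open>S\<close> remain free parameters.
  The scaling behind the second implication: an indicator of length R has norm about R^(1/p), and
  its transform has height about R on a window of length about 1/R, so R^(1 - 1/p - 1/q) stays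
  bounded. For large R the support is long and the window short, so p must be bounded below on
  arbitrarily long intervals, while q has to be large only on a fixed share of some short window.
  For small R the roles are exchanged. Hence each inequality pairs a tail exponent of one side with
  a global one of the other. Two obstacles shape the rest. Boundedness speaks of distributions, so
  it is first turned into a statement about Fourier integrals of integrable functions, by testing
  against modulated Gaussians. And the Luxemburg norm is an infimum, so estimates are stated for
  every admissible bound, with the transform chosen before the bound.\<close>

lemma integrable_gauss:
  assumes "0 < c"
  shows "integrable lborel (\<lambda>x::real. exp (- (c * x\<^sup>2)))"
proof -
  have "integrable lborel (\<lambda>x. sqrt (2 * pi) * std_normal_density x)"
    using integrable_std_normal_moment[of 0] by simp
  then have "integrable lborel (\<lambda>x::real. exp (- x\<^sup>2 / 2))"
    by (simp add: std_normal_density_def)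
  then have "integrable lborel (\<lambda>x::real. exp (- (0 + sqrt (2 * c) * x)\<^sup>2 / 2))"
    using assms by (subst lborel_integrable_real_affine_iff) auto
  then show ?thesis
    using assms by (simp add: power_mult_distrib)
qed

text \<open>The characteristic function of the standard normal distribution, rescaled by the factor
  1 / sqrt (2 * c).\<close>

lemma integral_gauss_iexp:
  assumes "0 < c"
  shows "(LINT x|lborel. of_real (exp (- (c * x\<^sup>2))) * iexp (t * x)) =
    complex_of_real (sqrt (pi / c) * exp (- (t\<^sup>2 / (4 * c))))"
proof -
  have 1: "(LINT x|lborel. of_real (exp (- x\<^sup>2 / 2)) * iexp (s * x)) =
      complex_of_real (sqrt (2 * pi) * exp (- (s\<^sup>2) / 2))" for s
  proof -
    have "complex_of_real (exp (- (s\<^sup>2) / 2)) = (LINT x|lborel. std_normal_density x *\<^sub>R iexp (s * x))"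
      unfolding char_std_normal_distribution[THEN fun_cong, symmetric] char_def
      by (subst integral_density) auto
    also have "\<dots> = (LINT x|lborel. of_real (1 / sqrt (2 * pi)) * (of_real (exp (- x\<^sup>2 / 2)) * iexp (s * x)))"
      by (intro Bochner_Integration.integral_cong)
        (auto simp: std_normal_density_def scaleR_conv_of_real)
    also have "\<dots> = of_real (1 / sqrt (2 * pi)) * (LINT x|lborel. of_real (exp (- x\<^sup>2 / 2)) * iexp (s * x))"
      by (rule integral_mult_right_zero)
    finally show ?thesis by (simp add: field_simps)
  qed
  let ?r = "1 / sqrt (2 * c)"
  have r: "?r > 0" using assms by simp
  have "c * (0 + ?r * x)\<^sup>2 = x\<^sup>2 / 2" "t * (0 + ?r * x) = (t * ?r) * x" for x
    using assms by (auto simp: power_mult_distrib power_divide)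
  then have "(LINT x|lborel. of_real (exp (- (c * x\<^sup>2))) * iexp (t * x)) =
     ?r *\<^sub>R (LINT x|lborel. of_real (exp (- x\<^sup>2 / 2)) * iexp ((t * ?r) * x))"
    using r by (subst lborel_integral_real_affine[of ?r _ 0]) (simp_all only: abs_of_pos, simp_all)
  also have "\<dots> = complex_of_real (?r * sqrt (2 * pi) * exp (- ((t * ?r)\<^sup>2) / 2))"
    unfolding 1 by (simp add: scaleR_conv_of_real)
  also have "?r * sqrt (2 * pi) * exp (- ((t * ?r)\<^sup>2) / 2) = sqrt (pi / c) * exp (- (t\<^sup>2 / (4 * c)))"
    using assms by (simp add: power_divide power_mult_distrib real_sqrt_divide real_sqrt_mult field_simps)
  finally show ?thesis .
qed

lemma integral_gauss:
  assumes "0 < c"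
  shows "(LINT x|lborel. exp (- (c * x\<^sup>2))) = sqrt (pi / c)"
proof -
  have "complex_of_real (LINT x|lborel. exp (- (c * x\<^sup>2))) = of_real (sqrt (pi / c))"
    using integral_gauss_iexp[OF assms, of 0] integral_complex_of_real by simp
  then show ?thesis by (simp only: of_real_eq_iff)
qed

text \<open>The projections land in the completed sigma-algebra, which is larger than the Borel one;
  composing with the identity makes explicit formulas in the two coordinates measurable on products
  of completed measures.\<close>

lemma measurable_fst_lebesgue [measurable]: "fst \<in> borel_measurable (lebesgue \<Otimes>\<^sub>M M)"
  and measurable_snd_lebesgue [measurable]: "snd \<in> borel_measurable (M \<Otimes>\<^sub>M lebesgue)"
  using measurable_compose[OF measurable_fst, of "\<lambda>x. x" lebesgue borel]
    measurable_compose[OF measurable_snd, of "\<lambda>x. x" lebesgue borel]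
  by (auto simp: measurable_completion)

lemma measurable_id_lebesgue [measurable]: "(\<lambda>x. x) \<in> borel_measurable lebesgue"
  by (rule measurable_completion) simp

text \<open>The functions involved are only Lebesgue measurable, so Fubini is applied to products of
  the completed measures themselves. A countable cover for \<open>lborel\<close> serves for its
  completion.\<close>

interpretation lebesgue: sigma_finite_measure "lebesgue :: real measure"
proof
  obtain A :: "real set set" where A: "countable A" "A \<subseteq> sets lborel" "\<Union>A = space lborel"
    "\<forall>a\<in>A. emeasure lborel a \<noteq> \<infinity>"
    using sigma_finite_measure.sigma_finite_countable[OF sigma_finite_lborel] by auto
  then show "\<exists>A. countable A \<and> A \<subseteq> sets lebesgue \<and> \<Union>A = space lebesgue \<and>
     (\<forall>a\<in>A. emeasure lebesgue (a::real set) \<noteq> \<infinity>)"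
    by (intro exI[of _ A]) (auto)
qed

interpretation lebesgue_pair: pair_sigma_finite "lebesgue :: real measure" "lebesgue :: real measure" ..

section \<open>The Fourier integral of integrable functions\<close>

lemma norm_fourier_kernel:
  "cmod (exp (- (2 * of_real pi * \<i> * of_real x * of_real \<xi>))) = 1"
  by (simp add: norm_exp_eq_Re)

lemma fourier_kernel_iexp:
  "exp (- (2 * of_real pi * \<i> * of_real x * of_real \<xi>)) = iexp (- (2 * pi * \<xi>) * x)"
  by (rule arg_cong[where f = exp]) (simp add: algebra_simps)

lemma integrable_fourier_kernel:
  assumes "integrable lebesgue f"
  shows "integrable lebesgue (\<lambda>x. f x * exp (- (2 * of_real pi * \<i> * of_real x * of_real \<xi>)))"
proof (rule Bochner_Integration.integrable_bound[OF assms])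
  have [measurable]: "f \<in> borel_measurable lebesgue" using assms by auto
  show "(\<lambda>x. f x * exp (- (2 * of_real pi * \<i> * of_real x * of_real \<xi>))) \<in> borel_measurable lebesgue"
    by measurable
qed (simp add: norm_mult norm_fourier_kernel)

lemma measurable_fourier [measurable]:
  assumes [measurable]: "f \<in> borel_measurable lebesgue"
  shows "fourier f \<in> borel_measurable lebesgue"
  unfolding fourier_def[abs_def] by measurable

lemma fourier_add:
  assumes "integrable lebesgue f" "integrable lebesgue g"
  shows "fourier (\<lambda>x. f x + g x) \<xi> = fourier f \<xi> + fourier g \<xi>"
  unfolding fourier_def distrib_right
  using assms by (intro Bochner_Integration.integral_add integrable_fourier_kernel)

lemma fourier_diff:
  assumes "integrable lebesgue f" "integrable lebesgue g"
  shows "fourier (\<lambda>x. f x - g x) \<xi> = fourier f \<xi> - fourier g \<xi>"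
  unfolding fourier_def left_diff_distrib
  using assms by (intro Bochner_Integration.integral_diff integrable_fourier_kernel)

lemma fourier_cmult: "fourier (\<lambda>x. c * f x) \<xi> = c * fourier f \<xi>"
  unfolding fourier_def mult.assoc by (rule integral_mult_right_zero)

lemma norm_fourier_le: "cmod (fourier f \<xi>) \<le> (LINT x|lebesgue. cmod (f x))"
proof -
  have "cmod (fourier f \<xi>) \<le> (LINT x|lebesgue. cmod (f x * exp (- (2 * of_real pi * \<i> * of_real x * of_real \<xi>))))"
    unfolding fourier_def by (rule integral_norm_bound)
  then show ?thesis by (simp add: norm_mult norm_fourier_kernel)
qed

text \<open>Measurability suffices: for a non-integrable \<open>f\<close> the right-hand side is
  infinite.\<close>

lemma ennreal_norm_fourier_le:
  assumes "f \<in> borel_measurable lebesgue"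
  shows "ennreal (cmod (fourier f \<xi>)) \<le> (\<integral>\<^sup>+x. ennreal (cmod (f x)) \<partial>lebesgue)"
proof (cases "integrable lebesgue f")
  case True
  then show ?thesis using norm_fourier_le[of f \<xi>]
    by (subst nn_integral_eq_integral) auto
next
  case False
  then have "(\<integral>\<^sup>+x. ennreal (cmod (f x)) \<partial>lebesgue) = \<infinity>"
    using assms by (simp add: integrable_iff_bounded top.not_eq_extremum[symmetric])
  then show ?thesis by simp
qed

text \<open>Fubini, as the kernel is unimodular and symmetric in its two arguments. The formula
  yields Plancherel's inequality and shows that the Fourier integral of an integrable function
  represents its distributional transform.\<close>

lemma multiplication_formula:
  assumes "integrable lebesgue f" "integrable lebesgue g"
  shows "(LINT x|lebesgue. f x * fourier g x) = (LINT x|lebesgue. fourier f x * g x)"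
proof -
  let ?e = "\<lambda>x y::real. exp (- (2 * of_real pi * \<i> * of_real x * of_real y))"
  have [measurable]: "f \<in> borel_measurable lebesgue" "g \<in> borel_measurable lebesgue"
    using assms by auto
  have int: "integrable (lebesgue \<Otimes>\<^sub>M lebesgue) (\<lambda>(x, y). f x * (g y * ?e y x))"
  proof (rule lebesgue_pair.Fubini_integrable)
    have "(LINT y|lebesgue. norm (f x * (g y * ?e y x))) = cmod (f x) * (LINT y|lebesgue. cmod (g y))" for x
      by (simp add: norm_mult norm_fourier_kernel)
    then show "integrable lebesgue (\<lambda>x. LINT y|lebesgue. norm (case (x, y) of (x, y) \<Rightarrow> f x * (g y * ?e y x)))"
      using assms by simp
    show "AE x in lebesgue. integrable lebesgue (\<lambda>y. case (x, y) of (x, y) \<Rightarrow> f x * (g y * ?e y x))"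
      using integrable_fourier_kernel[OF assms(2)] by simp
  qed measurable
  have "(LINT x|lebesgue. f x * fourier g x) = (LINT x|lebesgue. LINT y|lebesgue. f x * (g y * ?e y x))"
    unfolding fourier_def by simp
  also have "\<dots> = (LINT y|lebesgue. LINT x|lebesgue. f x * (g y * ?e y x))"
    using lebesgue_pair.Fubini_integral[OF int] by simp
  also have "\<dots> = (LINT y|lebesgue. fourier f y * g y)"
    unfolding fourier_def
    by (subst integral_mult_left_zero[symmetric], intro Bochner_Integration.integral_cong refl)
      (simp add: algebra_simps)
  finally show ?thesis .
qed


section \<open>Plancherel inequality\<close>

lemma borel_measurable_cnj [measurable (raw)]:
  "f \<in> borel_measurable M \<Longrightarrow> (\<lambda>x. cnj (f x)) \<in> borel_measurable M"
  by (rule measurable_compose[OF _ borel_measurable_continuous_onI[OF continuous_on_cnj]]) auto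

text \<open>The integrand is the Fourier transform of the weight exp (- c x^2), translated by
  \<open>x\<close>; it is a probability density because the weight is 1 at the origin.\<close>

lemma nn_integral_gauss_kernel:
  assumes "0 < c"
  shows "(\<integral>\<^sup>+y. ennreal (sqrt (pi / c) * exp (- (pi\<^sup>2 / c * (y - x)\<^sup>2))) \<partial>lebesgue) = 1"
proof -
  have c: "0 < pi\<^sup>2 / c" using assms by simp
  have "(\<integral>\<^sup>+y. ennreal (exp (- (pi\<^sup>2 / c * (y - x)\<^sup>2))) \<partial>lborel) =
     (\<integral>\<^sup>+y. ennreal (exp (- (pi\<^sup>2 / c * y\<^sup>2))) \<partial>lborel)"
    by (subst nn_integral_real_affine[of _ 1 x]) auto
  also have "\<dots> = ennreal (sqrt (pi / (pi\<^sup>2 / c)))"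
    using integrable_gauss[OF c] integral_gauss[OF c] by (subst nn_integral_eq_integral) auto
  finally have "(\<integral>\<^sup>+y. ennreal (sqrt (pi / c)) * ennreal (exp (- (pi\<^sup>2 / c * (y - x)\<^sup>2))) \<partial>lborel) =
     ennreal (sqrt (pi / c)) * ennreal (sqrt (pi / (pi\<^sup>2 / c)))"
    by (subst nn_integral_cmult) auto
  also have "\<dots> = ennreal (sqrt (pi / c * (pi / (pi\<^sup>2 / c))))"
    using assms by (subst ennreal_mult[symmetric]) (auto simp: real_sqrt_mult[symmetric] simp del: real_sqrt_eq_iff)
  also have "pi / c * (pi / (pi\<^sup>2 / c)) = 1"
    using assms by (simp add: field_simps power2_eq_square)
  finally show ?thesis
    using assms by (simp add: nn_integral_completion ennreal_mult)
qed

lemma integrable_lebesgue_gauss: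
  assumes "0 < c"
  shows "integrable lebesgue (\<lambda>x::real. exp (- (c * x\<^sup>2)))"
  using integrable_gauss[OF assms] by (subst integrable_completion) auto

lemma fourier_gauss_modulated:
  assumes "0 < c"
  shows "fourier (\<lambda>\<xi>. of_real (exp (- (c * \<xi>\<^sup>2))) * iexp (2 * pi * x * \<xi>)) y =
    of_real (sqrt (pi / c) * exp (- (pi\<^sup>2 / c * (y - x)\<^sup>2)))"
proof -
  have "fourier (\<lambda>\<xi>. of_real (exp (- (c * \<xi>\<^sup>2))) * iexp (2 * pi * x * \<xi>)) y =
    (LINT \<xi>|lborel. of_real (exp (- (c * \<xi>\<^sup>2))) * iexp ((2 * pi * (x - y)) * \<xi>))"
    unfolding fourier_def fourier_kernel_iexp
    by (subst integral_completion)
      (auto simp: mult.assoc exp_add[symmetric] algebra_simps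
        intro!: Bochner_Integration.integral_cong)
  also have "\<dots> = of_real (sqrt (pi / c) * exp (- ((2 * pi * (x - y))\<^sup>2 / (4 * c))))"
    by (rule integral_gauss_iexp[OF assms])
  also have "(2 * pi * (x - y))\<^sup>2 / (4 * c) = pi\<^sup>2 / c * (y - x)\<^sup>2"
    using assms by (simp add: field_simps power2_eq_square)
  finally show ?thesis .
qed

text \<open>The Gaussian weight makes all integrals converge. The weighted integral becomes the
  double integral of f(x) cnj (f(y)) k(x, y) up to conjugation, with a symmetric kernel k of total
  mass 1 in each variable. Then |f(x) f(y)| <= (|f(x)|^2 + |f(y)|^2) / 2 separates the variables, as
  in Schur's test.\<close>

lemma plancherel_gauss_le:
  assumes f: "integrable lebesgue f" and c: "0 < c"
  shows "(\<integral>\<^sup>+\<xi>. ennreal ((cmod (fourier f \<xi>))\<^sup>2 * exp (- (c * \<xi>\<^sup>2))) \<partial>lebesgue)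
    \<le> (\<integral>\<^sup>+x. ennreal ((cmod (f x))\<^sup>2) \<partial>lebesgue)"
proof -
  have [measurable]: "f \<in> borel_measurable lebesgue" using f by auto
  let ?G = "\<lambda>\<xi>::real. exp (- (c * \<xi>\<^sup>2))"
  define k where "k = (\<lambda>x y::real. sqrt (pi / c) * exp (- (pi\<^sup>2 / c * (y - x)\<^sup>2)))"
  have k0: "0 \<le> k x y" for x y using c by (simp add: k_def)
  have k_measurable [measurable]: "(\<lambda>(x, y). k x y) \<in> borel_measurable (lebesgue \<Otimes>\<^sub>M lebesgue)"
    unfolding k_def by measurable
  have k1: "(\<integral>\<^sup>+y. ennreal (k x y) \<partial>lebesgue) = 1" for x
    unfolding k_def by (rule nn_integral_gauss_kernel[OF c])
  have ksym: "k x y = k y x" for x y by (simp add: k_def power2_commute)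
  \<comment> \<open>Chosen so that \<open>fourier f \<xi> * g \<xi>\<close> is the weighted square
    of the modulus.\<close>
  define g where "g = (\<lambda>\<xi>. cnj (fourier f \<xi>) * of_real (?G \<xi>))"
  have [measurable]: "g \<in> borel_measurable lebesgue" unfolding g_def by measurable
  let ?A = "LINT x|lebesgue. cmod (f x)"
  have intb: "integrable lebesgue h" if "h \<in> borel_measurable lebesgue" "\<And>\<xi>. norm (h \<xi>) \<le> B * ?G \<xi>"
    for h :: "real \<Rightarrow> 'b::{banach,second_countable_topology}" and B
    using integrable_mult_right[OF integrable_lebesgue_gauss[OF c], of B] that
    by (intro Bochner_Integration.integrable_bound[of lebesgue "\<lambda>\<xi>. B * ?G \<xi>" h])
      (auto intro: order_trans[OF that(2) abs_ge_self])
  have g_int: "integrable lebesgue g"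
    by (rule intb[of _ ?A]) (auto simp: g_def norm_mult intro!: mult_right_mono norm_fourier_le)
  \<comment> \<open>The transform of \<open>g\<close> is the conjugate of the convolution of
    \<open>f\<close> with the Gaussian kernel: the multiplication formula moves the transform from
    \<open>f\<close> onto the modulated weight.\<close>
  have fg: "cnj (fourier g x) = (LINT y|lebesgue. f y * of_real (k x y))" for x
  proof -
    let ?m = "\<lambda>\<xi>. complex_of_real (?G \<xi>) * iexp (2 * pi * x * \<xi>)"
    have m_int: "integrable lebesgue ?m"
      by (rule intb[of _ 1]) (auto simp: norm_mult)
    have "cnj (fourier g x) = (LINT \<xi>|lebesgue. fourier f \<xi> * ?m \<xi>)"
      unfolding fourier_def[of g] fourier_kernel_iexp Bochner_Integration.integral_cnj[symmetric]
      by (intro Bochner_Integration.integral_cong refl)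
        (simp add: g_def exp_cnj mult_ac)
    also have "\<dots> = (LINT y|lebesgue. f y * fourier ?m y)"
      by (rule multiplication_formula[OF f m_int, symmetric])
    also have "\<dots> = (LINT y|lebesgue. f y * of_real (k x y))"
      unfolding fourier_gauss_modulated[OF c] k_def ..
    finally show ?thesis .
  qed
  have "integrable lebesgue (\<lambda>\<xi>. (cmod (fourier f \<xi>))\<^sup>2 * ?G \<xi>)"
    by (rule intb[of _ "?A\<^sup>2"]) (auto intro!: mult_right_mono power_mono norm_fourier_le)
  then have "(\<integral>\<^sup>+\<xi>. ennreal ((cmod (fourier f \<xi>))\<^sup>2 * ?G \<xi>) \<partial>lebesgue) =
      ennreal (LINT \<xi>|lebesgue. (cmod (fourier f \<xi>))\<^sup>2 * ?G \<xi>)"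
    by (subst nn_integral_eq_integral) auto
  also have "(LINT \<xi>|lebesgue. (cmod (fourier f \<xi>))\<^sup>2 * ?G \<xi>) =
      cmod (LINT \<xi>|lebesgue. fourier f \<xi> * g \<xi>)"
  proof -
    have "(LINT \<xi>|lebesgue. fourier f \<xi> * g \<xi>) =
        (LINT \<xi>|lebesgue. complex_of_real ((cmod (fourier f \<xi>))\<^sup>2 * ?G \<xi>))"
      by (intro Bochner_Integration.integral_cong refl)
        (simp add: g_def mult.assoc[symmetric] complex_norm_square[symmetric])
    also have "\<dots> = of_real (LINT \<xi>|lebesgue. (cmod (fourier f \<xi>))\<^sup>2 * ?G \<xi>)"
      by (rule integral_complex_of_real)
    finally show ?thesis
      by (simp add: integral_nonneg_AE)
  qed
  also have "(LINT \<xi>|lebesgue. fourier f \<xi> * g \<xi>) = (LINT x|lebesgue. f x * fourier g x)"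
    by (rule multiplication_formula[OF f g_int, symmetric])
  also have "ennreal (cmod (LINT x|lebesgue. f x * fourier g x)) \<le>
      (\<integral>\<^sup>+x. ennreal (cmod (f x * fourier g x)) \<partial>lebesgue)"
    by (rule integral_norm_bound_ennreal)
      (auto intro!: Bochner_Integration.integrable_bound[OF integrable_mult_left[OF integrable_norm[OF f], of "LINT x|lebesgue. cmod (g x)"]]
        simp: norm_mult intro!: mult_left_mono norm_fourier_le AE_I2)
  also have "\<dots> \<le> (\<integral>\<^sup>+x. \<integral>\<^sup>+y. ennreal (((cmod (f x))\<^sup>2 / 2 + (cmod (f y))\<^sup>2 / 2) * k x y) \<partial>lebesgue \<partial>lebesgue)"
  proof (rule nn_integral_mono)
    fix x
    have "ennreal (cmod (fourier g x)) = ennreal (cmod (LINT y|lebesgue. f y * of_real (k x y)))"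
      using fg[of x] by (metis complex_mod_cnj)
    also have "\<dots> \<le> (\<integral>\<^sup>+y. ennreal (cmod (f y * of_real (k x y))) \<partial>lebesgue)"
    proof (rule integral_norm_bound_ennreal)
      show "integrable lebesgue (\<lambda>y. f y * of_real (k x y))"
      proof (rule Bochner_Integration.integrable_bound[OF integrable_mult_left[OF integrable_norm[OF f], of "sqrt (pi / c)"]])
        show "(\<lambda>y. f y * complex_of_real (k x y)) \<in> borel_measurable lebesgue" by measurable
        show "AE y in lebesgue. norm (f y * complex_of_real (k x y)) \<le> norm (cmod (f y) * sqrt (pi / c))"
          using k0 c by (auto simp: norm_mult k_def mult_le_cancel_left1 intro!: mult_left_mono)
      qed
    qed
    finally have "ennreal (cmod (f x)) * ennreal (cmod (fourier g x)) \<le>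
        ennreal (cmod (f x)) * (\<integral>\<^sup>+y. ennreal (cmod (f y * of_real (k x y))) \<partial>lebesgue)"
      by (rule mult_left_mono) simp
    also have "\<dots> = (\<integral>\<^sup>+y. ennreal (cmod (f x)) * ennreal (cmod (f y * of_real (k x y))) \<partial>lebesgue)"
      by (subst nn_integral_cmult) auto
    also have "\<dots> \<le> (\<integral>\<^sup>+y. ennreal (((cmod (f x))\<^sup>2 / 2 + (cmod (f y))\<^sup>2 / 2) * k x y) \<partial>lebesgue)"
    proof (rule nn_integral_mono)
      fix y
      have "cmod (f x) * cmod (f y) \<le> (cmod (f x))\<^sup>2 / 2 + (cmod (f y))\<^sup>2 / 2"
        using sum_squares_bound[of "cmod (f x)" "cmod (f y)"] by simp
      from mult_right_mono[OF this k0[of x y]] show "ennreal (cmod (f x)) * ennreal (cmod (f y * of_real (k x y))) \<le>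
        ennreal (((cmod (f x))\<^sup>2 / 2 + (cmod (f y))\<^sup>2 / 2) * k x y)"
        using k0 by (simp add: norm_mult ennreal_mult'[symmetric] mult.assoc)
    qed
    finally show "ennreal (cmod (f x * fourier g x)) \<le>
      (\<integral>\<^sup>+y. ennreal (((cmod (f x))\<^sup>2 / 2 + (cmod (f y))\<^sup>2 / 2) * k x y) \<partial>lebesgue)"
      by (simp add: norm_mult ennreal_mult')
  qed
  also have "\<dots> = (\<integral>\<^sup>+x. (\<integral>\<^sup>+y. ennreal ((cmod (f x))\<^sup>2 / 2) * ennreal (k x y) \<partial>lebesgue) +
      (\<integral>\<^sup>+y. ennreal ((cmod (f y))\<^sup>2 / 2) * ennreal (k x y) \<partial>lebesgue) \<partial>lebesgue)"
    using k0 by (subst nn_integral_add[symmetric]) (auto simp: distrib_right ennreal_mult[symmetric])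
  also have "\<dots> = (\<integral>\<^sup>+x. (\<integral>\<^sup>+y. ennreal ((cmod (f x))\<^sup>2 / 2) * ennreal (k x y) \<partial>lebesgue) \<partial>lebesgue) +
      (\<integral>\<^sup>+x. (\<integral>\<^sup>+y. ennreal ((cmod (f y))\<^sup>2 / 2) * ennreal (k x y) \<partial>lebesgue) \<partial>lebesgue)"
    by (rule nn_integral_add) measurable
  also have "(\<integral>\<^sup>+x. (\<integral>\<^sup>+y. ennreal ((cmod (f y))\<^sup>2 / 2) * ennreal (k x y) \<partial>lebesgue) \<partial>lebesgue) =
     (\<integral>\<^sup>+y. (\<integral>\<^sup>+x. ennreal ((cmod (f y))\<^sup>2 / 2) * ennreal (k y x) \<partial>lebesgue) \<partial>lebesgue)"
    by (subst lebesgue_pair.Fubini') (auto simp: ksym)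
  also have "(\<integral>\<^sup>+x. (\<integral>\<^sup>+y. ennreal ((cmod (f x))\<^sup>2 / 2) * ennreal (k x y) \<partial>lebesgue) \<partial>lebesgue) =
      (\<integral>\<^sup>+x. ennreal ((cmod (f x))\<^sup>2 / 2) \<partial>lebesgue)"
    by (subst nn_integral_cmult) (auto simp: k1)
  also have "\<dots> + \<dots> = (\<integral>\<^sup>+x. ennreal ((cmod (f x))\<^sup>2) \<partial>lebesgue)"
    by (subst nn_integral_add[symmetric]) (auto simp: ennreal_plus[symmetric] simp del: ennreal_plus)
  finally show ?thesis .
qed

text \<open>The weights with c = 1 / (n + 1) tend to 1 pointwise, and the bound does not depend on
  c, so Fatou's lemma applies. The right-hand side may be infinite.\<close>

lemma plancherel_le:
  assumes f: "integrable lebesgue f"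
  shows "(\<integral>\<^sup>+\<xi>. ennreal ((cmod (fourier f \<xi>))\<^sup>2) \<partial>lebesgue) \<le> (\<integral>\<^sup>+x. ennreal ((cmod (f x))\<^sup>2) \<partial>lebesgue)"
proof -
  have [measurable]: "f \<in> borel_measurable lebesgue" using f by auto
  let ?g = "\<lambda>n \<xi>. ennreal ((cmod (fourier f \<xi>))\<^sup>2 * exp (- (inverse (real (Suc n)) * \<xi>\<^sup>2)))"
  have lim: "(\<lambda>n. ?g n \<xi>) \<longlonglongrightarrow> ennreal ((cmod (fourier f \<xi>))\<^sup>2)" for \<xi>
  proof -
    have "(\<lambda>n. (cmod (fourier f \<xi>))\<^sup>2 * exp (- (inverse (real (Suc n)) * \<xi>\<^sup>2))) \<longlonglongrightarrow>
        (cmod (fourier f \<xi>))\<^sup>2 * exp (- (0 * \<xi>\<^sup>2))"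
      by (intro tendsto_intros LIMSEQ_inverse_real_of_nat)
    then show ?thesis by (intro tendsto_ennrealI) simp
  qed
  have "(\<integral>\<^sup>+\<xi>. ennreal ((cmod (fourier f \<xi>))\<^sup>2) \<partial>lebesgue) = (\<integral>\<^sup>+\<xi>. liminf (\<lambda>n. ?g n \<xi>) \<partial>lebesgue)"
    by (intro nn_integral_cong lim_imp_Liminf[symmetric] lim) simp
  also have "\<dots> \<le> liminf (\<lambda>n. \<integral>\<^sup>+\<xi>. ?g n \<xi> \<partial>lebesgue)"
    by (rule nn_integral_liminf) measurable
  also have "\<dots> \<le> limsup (\<lambda>n. \<integral>\<^sup>+\<xi>. ?g n \<xi> \<partial>lebesgue)"
    by (rule Liminf_le_Limsup) simp
  also have "\<dots> \<le> (\<integral>\<^sup>+x. ennreal ((cmod (f x))\<^sup>2) \<partial>lebesgue)"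
    by (intro Limsup_bounded always_eventually allI plancherel_gauss_le[OF f]) simp
  finally show ?thesis .
qed


section \<open>Marcinkiewicz interpolation\<close>

lemma sets_lebesgue_Collect: "Measurable.pred lebesgue P \<Longrightarrow> {x. P x} \<in> sets lebesgue"
  by (simp add: pred_def)

lemma nn_integral_powr_from_0:
  assumes "-1 < r" "0 \<le> T"
  shows "(\<integral>\<^sup>+s. ennreal (s powr r) * indicator {0<..T} s \<partial>lebesgue) = ennreal (T powr (r + 1) / (r + 1))"
proof -
  have "((\<lambda>s. s powr r) has_integral (T powr (r + 1) / (r + 1))) {0..T}"
    by (rule has_integral_powr_from_0[OF assms])
  then have "(\<integral>\<^sup>+s. ennreal (s powr r) * indicator {0..T} s \<partial>lebesgue) = ennreal (T powr (r + 1) / (r + 1))"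
    by (subst nn_integral_completion, intro nn_integral_has_integral_lebesgue') auto
  moreover have "(\<integral>\<^sup>+s. ennreal (s powr r) * indicator {0<..T} s \<partial>lebesgue) =
      (\<integral>\<^sup>+s. ennreal (s powr r) * indicator {0..T} s \<partial>lebesgue)"
    by (intro nn_integral_cong) (auto simp: indicator_def)
  ultimately show ?thesis by simp
qed

text \<open>The function is cut at the level for which its large part has a transform bounded by
  \<open>s / 2\<close>, so that only the \<open>L\<^sup>2\<close> part contributes to the level set.\<close>

lemma fourier_weak_type:
  assumes f: "integrable lebesgue f" and a: "1 < a"
    and fa: "(\<integral>\<^sup>+x. ennreal (cmod (f x) powr a) \<partial>lebesgue) \<le> 1" and s: "0 < s"
  shows "emeasure lebesgue {\<xi>. s \<le> cmod (fourier f \<xi>)} \<le> ennreal (4 / s\<^sup>2) *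
    (\<integral>\<^sup>+x. ennreal ((cmod (f x))\<^sup>2) * indicator {x. cmod (f x) \<le> (s / 2) powr (- 1 / (a - 1))} x \<partial>lebesgue)"
proof -
  have [measurable]: "f \<in> borel_measurable lebesgue" using f by auto
  \<comment> \<open>The solution of l^(1 - a) = s / 2: above this level |f| <= (s / 2) |f|^a, and
    the normalisation of \<open>f\<close> bounds the transform of the large part \<open>f1\<close>
    by s / 2. What remains of the level \<open>s\<close> must come from \<open>f2\<close>, whence
    the factor 4 / s^2 in Markov's inequality.\<close>
  define l where "l = (s / 2) powr (- 1 / (a - 1))"
  have e1: "- ((1 - a) / (a - 1)) = 1" using a by (simp add: field_simps)
  have l: "0 < l" "l powr (1 - a) = s / 2"
    using s a e1 by (auto simp: l_def powr_powr)
  define f1 where "f1 x = (if cmod (f x) \<le> l then 0 else f x)" for x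
  define f2 where "f2 x = (if cmod (f x) \<le> l then f x else 0)" for x
  have [measurable]: "f1 \<in> borel_measurable lebesgue" "f2 \<in> borel_measurable lebesgue"
    unfolding f1_def[abs_def] f2_def[abs_def] by measurable
  have int: "integrable lebesgue f1" "integrable lebesgue f2"
    by (auto intro!: Bochner_Integration.integrable_bound[OF f] simp: f1_def f2_def)
  have "fourier f \<xi> = fourier f1 \<xi> + fourier f2 \<xi>" for \<xi>
    unfolding fourier_add[OF int, symmetric]
    by (rule arg_cong[where f = "\<lambda>g. fourier g \<xi>"]) (auto simp: f1_def f2_def)
  moreover have f1s: "cmod (fourier f1 \<xi>) \<le> s / 2" for \<xi>
  proof -
    have "ennreal (cmod (fourier f1 \<xi>)) \<le> (\<integral>\<^sup>+x. ennreal (cmod (f1 x)) \<partial>lebesgue)"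
      by (rule ennreal_norm_fourier_le) simp
    also have "\<dots> \<le> (\<integral>\<^sup>+x. ennreal (s / 2) * ennreal (cmod (f x) powr a) \<partial>lebesgue)"
    proof (rule nn_integral_mono)
      fix x
      show "ennreal (cmod (f1 x)) \<le> ennreal (s / 2) * ennreal (cmod (f x) powr a)"
      proof (cases "cmod (f x) \<le> l")
        case False
        then have "cmod (f x) powr (1 - a) \<le> l powr (1 - a)"
          using l a by (intro powr_mono2') auto
        then have "cmod (f x) powr (1 - a) * cmod (f x) powr a \<le> s / 2 * cmod (f x) powr a"
          by (intro mult_right_mono) (auto simp: l)
        also have "cmod (f x) powr (1 - a) * cmod (f x) powr a = cmod (f x)"
          using False l by (subst powr_add[symmetric]) auto
        finally show ?thesis using False s by (simp add: f1_def ennreal_mult[symmetric])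
      qed (simp add: f1_def)
    qed
    also have "\<dots> = ennreal (s / 2) * (\<integral>\<^sup>+x. ennreal (cmod (f x) powr a) \<partial>lebesgue)"
      by (rule nn_integral_cmult) simp
    also have "\<dots> \<le> ennreal (s / 2) * 1"
      by (intro mult_left_mono fa) simp
    finally show ?thesis using s by simp
  qed
  ultimately have "{\<xi>. s \<le> cmod (fourier f \<xi>)} \<subseteq> {\<xi>\<in>UNIV. 1 \<le> ennreal (4 / s\<^sup>2) * ennreal ((cmod (fourier f2 \<xi>))\<^sup>2)}"
  proof safe
    fix \<xi> assume *: "s \<le> cmod (fourier f \<xi>)" and eq: "\<And>\<xi>. fourier f \<xi> = fourier f1 \<xi> + fourier f2 \<xi>"
    have "cmod (fourier f \<xi>) \<le> cmod (fourier f1 \<xi>) + cmod (fourier f2 \<xi>)"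
      unfolding eq by (rule norm_triangle_ineq)
    with * f1s[of \<xi>] have "s / 2 \<le> cmod (fourier f2 \<xi>)" by simp
    then have "(s / 2)\<^sup>2 \<le> (cmod (fourier f2 \<xi>))\<^sup>2"
      using s by (intro power_mono) auto
    then have "1 \<le> 4 / s\<^sup>2 * (cmod (fourier f2 \<xi>))\<^sup>2"
      using s by (simp add: field_simps power2_eq_square)
    then show "1 \<le> ennreal (4 / s\<^sup>2) * ennreal ((cmod (fourier f2 \<xi>))\<^sup>2)"
      using s by (simp add: ennreal_mult[symmetric])
  qed simp
  then have "emeasure lebesgue {\<xi>. s \<le> cmod (fourier f \<xi>)} \<le>
      emeasure lebesgue {\<xi>\<in>UNIV. 1 \<le> ennreal (4 / s\<^sup>2) * ennreal ((cmod (fourier f2 \<xi>))\<^sup>2)}"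
    by (rule emeasure_mono) (simp, intro sets_lebesgue_Collect, measurable)
  also have "\<dots> \<le> ennreal (4 / s\<^sup>2) * (\<integral>\<^sup>+\<xi>. ennreal ((cmod (fourier f2 \<xi>))\<^sup>2) * indicator UNIV \<xi> \<partial>lebesgue)"
    using nn_integral_Markov_inequality[OF _ sets.top, of "\<lambda>\<xi>. ennreal ((cmod (fourier f2 \<xi>))\<^sup>2)" lebesgue "ennreal (4 / s\<^sup>2)"]
    by simp
  also have "\<dots> \<le> ennreal (4 / s\<^sup>2) * (\<integral>\<^sup>+x. ennreal ((cmod (f2 x))\<^sup>2) \<partial>lebesgue)"
    using plancherel_le[OF int(2)] by (intro mult_left_mono) auto
  also have "(\<integral>\<^sup>+x. ennreal ((cmod (f2 x))\<^sup>2) \<partial>lebesgue) =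
      (\<integral>\<^sup>+x. ennreal ((cmod (f x))\<^sup>2) * indicator {x. cmod (f x) \<le> l} x \<partial>lebesgue)"
    by (intro nn_integral_cong) (auto simp: f2_def)
  finally show ?thesis unfolding l_def .
qed

text \<open>The layer-cake formula turns the left side into the integral of b s^(b - 1) times the
  measure of the level sets; the weak-type bound is inserted and Tonelli integrates over
  \<open>s\<close> first. In the constant, b comes from the layer cake, 4 from the weak-type bound,
  and 2^(b - 2) / (b - 2) from the integral of s^(b - 3) near 0, which converges because a < 2 means
  b > 2.\<close>

lemma hausdorff_young_normalised:
  assumes f: "integrable lebesgue f" and a: "1 < a" "a < 2" and b: "b = a / (a - 1)"
    and fa: "(\<integral>\<^sup>+x. ennreal (cmod (f x) powr a) \<partial>lebesgue) \<le> 1"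
  shows "(\<integral>\<^sup>+\<xi>. ennreal (cmod (fourier f \<xi>) powr b) \<partial>lebesgue) \<le> ennreal (4 * b * 2 powr (b - 2) / (b - 2))"
proof -
  have [measurable]: "f \<in> borel_measurable lebesgue" using f by auto
  have b2: "2 < b" using a by (simp add: b field_simps)
  have e1: "- ((1 - a) / (a - 1)) = 1" using a by (simp add: field_simps)
  \<comment> \<open>The exponent identity that makes the interpolation close: |f|^2 from the
    \<open>L\<^sup>2\<close> part and the power from the cut-off combine to exactly |f|^a.\<close>
  have ab: "(1 - a) * (b - 2) + 2 = a"
    using a by (simp add: b field_simps)
  define l where "l s = (s / 2) powr (- 1 / (a - 1))" for s :: real
  have [measurable]: "l \<in> borel_measurable borel" unfolding l_def[abs_def] by measurable
  have l_meas [measurable]: "l \<in> borel_measurable lebesgue"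
    by (rule measurable_completion) simp
  have inner: "(\<integral>\<^sup>+s. (ennreal ((cmod (f x))\<^sup>2) * indicator {x. cmod (f x) \<le> l s} x) *
      (ennreal (4 * b * s powr (b - 3)) * indicator {0<..} s) \<partial>lebesgue)
      \<le> ennreal (4 * b * 2 powr (b - 2) / (b - 2)) * ennreal (cmod (f x) powr a)" (is "?L x \<le> _") for x
  proof (cases "f x = 0")
    case False
    \<comment> \<open>The cut-off condition \<open>cmod (f x) \<le> l s\<close>, solved for
      \<open>s\<close>.\<close>
    let ?T = "2 * cmod (f x) powr (1 - a)"
    have sT: "s \<le> ?T" if "0 < s" "cmod (f x) \<le> l s" for s
    proof -
      have "l s powr (1 - a) \<le> cmod (f x) powr (1 - a)"
        using that a False by (intro powr_mono2') auto
      moreover have "l s powr (1 - a) = s / 2"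
        using that a e1 by (auto simp: l_def powr_powr)
      ultimately show ?thesis by simp
    qed
    have "?L x \<le> (\<integral>\<^sup>+s. ennreal ((cmod (f x))\<^sup>2 * (4 * b)) * (ennreal (s powr (b - 3)) * indicator {0<..?T} s) \<partial>lebesgue)"
      using sT b2 by (intro nn_integral_mono) (auto simp: indicator_def ennreal_mult[symmetric] mult_ac)
    also have "\<dots> = ennreal ((cmod (f x))\<^sup>2 * (4 * b)) * (\<integral>\<^sup>+s. (ennreal (s powr (b - 3)) * indicator {0<..?T} s) \<partial>lebesgue)"
      by (rule nn_integral_cmult) measurable
    also have "\<dots> = ennreal ((cmod (f x))\<^sup>2 * (4 * b) * (?T powr (b - 2) / (b - 2)))"
      using b2 by (subst nn_integral_powr_from_0) (auto simp: ennreal_mult[symmetric])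
    also have "(cmod (f x))\<^sup>2 * (4 * b) * (?T powr (b - 2) / (b - 2)) =
        4 * b * 2 powr (b - 2) / (b - 2) * (cmod (f x) powr ((1 - a) * (b - 2)) * cmod (f x) powr 2)"
      using False by (simp add: powr_mult powr_powr)
    also have "cmod (f x) powr ((1 - a) * (b - 2)) * cmod (f x) powr 2 = cmod (f x) powr a"
      by (subst powr_add[symmetric]) (simp add: ab)
    finally show ?thesis using b2 by (simp add: ennreal_mult[symmetric])
  qed simp
  \<comment> \<open>The layer-cake integrand: its integral over \<open>s\<close> is the b-th power
    of the modulus of the transform at \<xi>.\<close>
  define H where "H = (\<lambda>\<xi> s. if 0 < s \<and> s \<le> cmod (fourier f \<xi>) then ennreal (b * s powr (b - 1)) else 0)"
  have [measurable]: "(\<lambda>(\<xi>, s). H \<xi> s) \<in> borel_measurable (lebesgue \<Otimes>\<^sub>M lebesgue)"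
    unfolding H_def by measurable
  define J where "J = (\<lambda>s x. (ennreal ((cmod (f x))\<^sup>2) * indicator {x. cmod (f x) \<le> l s} x) *
      (ennreal (4 * b * s powr (b - 3)) * indicator {0<..} s))"
  \<comment> \<open>The indicator of a set that itself depends on \<open>s\<close> becomes a
    conditional on the pair, whose joint measurability can be derived.\<close>
  have J_eq: "J s x = (if cmod (f x) \<le> l s \<and> 0 < s then ennreal ((cmod (f x))\<^sup>2) * ennreal (4 * b * s powr (b - 3)) else 0)" for s x
    by (auto simp: J_def)
  have [measurable]: "(\<lambda>(s, x). J s x) \<in> borel_measurable (lebesgue \<Otimes>\<^sub>M lebesgue)"
    unfolding J_eq by measurable
  have "(\<integral>\<^sup>+\<xi>. ennreal (cmod (fourier f \<xi>) powr b) \<partial>lebesgue) = (\<integral>\<^sup>+\<xi>. \<integral>\<^sup>+s. H \<xi> s \<partial>lebesgue \<partial>lebesgue)"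
  proof (rule nn_integral_cong)
    fix \<xi>
    have "(\<integral>\<^sup>+s. H \<xi> s \<partial>lebesgue) =
       (\<integral>\<^sup>+s. ennreal b * (ennreal (s powr (b - 1)) * indicator {0<..cmod (fourier f \<xi>)} s) \<partial>lebesgue)"
      using b2 by (intro nn_integral_cong) (auto simp: H_def ennreal_mult)
    also have "\<dots> = ennreal (cmod (fourier f \<xi>) powr b)"
      using b2 by (subst nn_integral_cmult)
        (auto simp: nn_integral_powr_from_0 ennreal_mult[symmetric])
    finally show "ennreal (cmod (fourier f \<xi>) powr b) = (\<integral>\<^sup>+s. H \<xi> s \<partial>lebesgue)" ..
  qed
  also have "\<dots> = (\<integral>\<^sup>+s. \<integral>\<^sup>+\<xi>. H \<xi> s \<partial>lebesgue \<partial>lebesgue)"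
    by (rule lebesgue_pair.Fubini'[symmetric]) measurable
  also have "\<dots> \<le> (\<integral>\<^sup>+s. \<integral>\<^sup>+x. J s x \<partial>lebesgue \<partial>lebesgue)"
  proof (rule nn_integral_mono)
    fix s :: real
    show "(\<integral>\<^sup>+\<xi>. H \<xi> s \<partial>lebesgue) \<le> (\<integral>\<^sup>+x. J s x \<partial>lebesgue)"
    proof (cases "0 < s")
      case True
      have "(\<integral>\<^sup>+\<xi>. H \<xi> s \<partial>lebesgue) =
          (\<integral>\<^sup>+\<xi>. ennreal (b * s powr (b - 1)) * indicator {\<xi>. s \<le> cmod (fourier f \<xi>)} \<xi> \<partial>lebesgue)"
        using True by (intro nn_integral_cong) (auto simp: H_def)
      also have "\<dots> = ennreal (b * s powr (b - 1)) * emeasure lebesgue {\<xi>. s \<le> cmod (fourier f \<xi>)}"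
        by (intro nn_integral_cmult_indicator sets_lebesgue_Collect) measurable
      also have "\<dots> \<le> ennreal (b * s powr (b - 1)) * (ennreal (4 / s\<^sup>2) *
          (\<integral>\<^sup>+x. ennreal ((cmod (f x))\<^sup>2) * indicator {x. cmod (f x) \<le> l s} x \<partial>lebesgue))"
        unfolding l_def by (intro mult_left_mono fourier_weak_type f a fa True) simp
      also have "\<dots> = ennreal (b * s powr (b - 1) * (4 / s\<^sup>2)) *
          (\<integral>\<^sup>+x. ennreal ((cmod (f x))\<^sup>2) * indicator {x. cmod (f x) \<le> l s} x \<partial>lebesgue)"
        by (subst mult.assoc[symmetric], subst ennreal_mult[symmetric]) (use b2 in auto)
      also have "b * s powr (b - 1) * (4 / s\<^sup>2) = 4 * b * s powr (b - 3)"
      proof -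
        have "s powr (b - 1) = s powr (b - 3) * s powr 2"
          by (simp add: powr_add[symmetric])
        then show ?thesis using True by simp
      qed
      also have "ennreal (4 * b * s powr (b - 3)) *
          (\<integral>\<^sup>+x. ennreal ((cmod (f x))\<^sup>2) * indicator {x. cmod (f x) \<le> l s} x \<partial>lebesgue) =
          (\<integral>\<^sup>+x. J s x \<partial>lebesgue)"
        using True by (subst nn_integral_cmult[symmetric]) (auto simp: J_def mult_ac)
      finally show ?thesis .
    qed (simp add: H_def)
  qed
  also have "\<dots> = (\<integral>\<^sup>+x. \<integral>\<^sup>+s. J s x \<partial>lebesgue \<partial>lebesgue)"
    by (rule lebesgue_pair.Fubini'[symmetric]) measurable
  also have "\<dots> \<le> (\<integral>\<^sup>+x. ennreal (4 * b * 2 powr (b - 2) / (b - 2)) * ennreal (cmod (f x) powr a) \<partial>lebesgue)"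
    unfolding J_def by (intro nn_integral_mono inner)
  also have "\<dots> = ennreal (4 * b * 2 powr (b - 2) / (b - 2)) * (\<integral>\<^sup>+x. ennreal (cmod (f x) powr a) \<partial>lebesgue)"
    by (rule nn_integral_cmult) simp
  also have "\<dots> \<le> ennreal (4 * b * 2 powr (b - 2) / (b - 2)) * 1"
    by (intro mult_left_mono fa) simp
  finally show ?thesis by simp
qed

text \<open>Rescaling removes the normalisation. \<open>N\<close> is any positive upper bound for
  the norm, so no division by a vanishing norm arises. The case a = 2 stands apart because the
  interpolation constant blows up there; Plancherel's inequality supplies K = 1.\<close>

lemma hausdorff_young_integrable:
  assumes a: "1 < a" "a \<le> 2" and b: "b = a / (a - 1)"
  obtains K where "0 < K"
    "\<And>f N. integrable lebesgue f \<Longrightarrow> 0 < N \<Longrightarrow>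
      (\<integral>\<^sup>+x. ennreal (cmod (f x) powr a) \<partial>lebesgue) \<le> ennreal (N powr a) \<Longrightarrow>
      (\<integral>\<^sup>+\<xi>. ennreal (cmod (fourier f \<xi>) powr b) \<partial>lebesgue) \<le> ennreal ((K * N) powr b)"
proof (cases "a = 2")
  case True
  then have "b = 2" by (simp add: b)
  show ?thesis
    using plancherel_le by (intro that[of 1]) (auto simp: True \<open>b = 2\<close> intro: order_trans)
next
  case False
  then have a2: "a < 2" using a by simp
  have b2: "2 < b" using a2 a by (simp add: b field_simps)
  define K where "K = (4 * b * 2 powr (b - 2) / (b - 2)) powr (1 / b)"
  have "0 < 4 * b * 2 powr (b - 2) / (b - 2)" using b2 by (intro divide_pos_pos mult_pos_pos) auto
  then have K: "0 < K" "4 * b * 2 powr (b - 2) / (b - 2) = K powr b"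
    using b2 by (auto simp: K_def powr_powr)
  show ?thesis
  proof (rule that[OF K(1)])
    fix f :: "real \<Rightarrow> complex" and N assume f: "integrable lebesgue f" and N: "(0::real) < N"
      and le: "(\<integral>\<^sup>+x. ennreal (cmod (f x) powr a) \<partial>lebesgue) \<le> ennreal (N powr a)"
    have [measurable]: "f \<in> borel_measurable lebesgue" using f by auto
    have scale: "(\<integral>\<^sup>+x. ennreal (cmod (of_real (1 / N) * g x) powr c) \<partial>lebesgue) =
       ennreal ((1 / N) powr c) * (\<integral>\<^sup>+x. ennreal (cmod (g x) powr c) \<partial>lebesgue)"
      if [measurable]: "g \<in> borel_measurable lebesgue" for g :: "real \<Rightarrow> complex" and c
      using N by (subst nn_integral_cmult[symmetric])
        (auto simp: norm_mult norm_divide powr_mult powr_divide ennreal_mult[symmetric])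
    have "(\<integral>\<^sup>+\<xi>. ennreal (cmod (fourier (\<lambda>x. of_real (1 / N) * f x) \<xi>) powr b) \<partial>lebesgue) \<le> ennreal (K powr b)"
      unfolding K(2)[symmetric]
    proof (rule hausdorff_young_normalised[OF _ a(1) a2 b])
      show "integrable lebesgue (\<lambda>x. complex_of_real (1 / N) * f x)"
        using f by (rule integrable_mult_right)
      have "(\<integral>\<^sup>+x. ennreal (cmod (of_real (1 / N) * f x) powr a) \<partial>lebesgue) \<le> ennreal ((1 / N) powr a) * ennreal (N powr a)"
        unfolding scale[OF \<open>f \<in> borel_measurable lebesgue\<close>] by (intro mult_left_mono le) simp
      also have "\<dots> = 1"
        using N by (simp add: ennreal_mult[symmetric] powr_divide)
      finally show "(\<integral>\<^sup>+x. ennreal (cmod (of_real (1 / N) * f x) powr a) \<partial>lebesgue) \<le> 1" .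
    qed
    then have "ennreal ((1 / N) powr b) * (\<integral>\<^sup>+\<xi>. ennreal (cmod (fourier f \<xi>) powr b) \<partial>lebesgue) \<le> ennreal (K powr b)"
      unfolding fourier_cmult by (subst (asm) scale) auto
    then have "ennreal (N powr b) * (ennreal ((1 / N) powr b) * (\<integral>\<^sup>+\<xi>. ennreal (cmod (fourier f \<xi>) powr b) \<partial>lebesgue))
       \<le> ennreal (N powr b) * ennreal (K powr b)"
      by (rule mult_left_mono) simp
    then show "(\<integral>\<^sup>+\<xi>. ennreal (cmod (fourier f \<xi>) powr b) \<partial>lebesgue) \<le> ennreal ((K * N) powr b)"
      using N K by (simp add: ennreal_mult[symmetric] mult.assoc[symmetric] powr_divide powr_mult mult.commute)
  qed
qed


section \<open>Schwartz functions and uniqueness\<close>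

lemma integrable_inverse_1_plus_square_lebesgue: "integrable lebesgue (\<lambda>x::real. inverse (1 + x\<^sup>2))"
proof -
  have "integrable lborel (\<lambda>x::real. inverse (1 + x\<^sup>2))"
    using integrable_inverse_1_plus_square by (simp add: set_integrable_def)
  then show ?thesis by (subst integrable_completion) auto
qed

lemma schwartz_continuous:
  assumes "\<phi> \<in> schwartz"
  shows "continuous_on UNIV \<phi>"
proof -
  have "\<phi> differentiable (at x)" for x
    using assms unfolding schwartz_def nth_deriv_def by (auto dest: spec[of _ 0])
  then show ?thesis
    by (intro continuous_at_imp_continuous_on ballI differentiable_imp_continuous_within)
qed

lemma schwartz_measurable:
  assumes "\<phi> \<in> schwartz"
  shows "\<phi> \<in> borel_measurable borel" "\<phi> \<in> borel_measurable lebesgue"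
  using borel_measurable_continuous_onI[OF schwartz_continuous[OF assms]]
  by (auto intro: measurable_completion)

lemma schwartz_decay:
  assumes "\<phi> \<in> schwartz"
  obtains B where "0 < B" "\<And>x. cmod (\<phi> x) \<le> B" "\<And>x. cmod (\<phi> x) \<le> B * inverse (1 + x\<^sup>2)"
proof -
  have "bounded (range (\<lambda>x. of_real (x ^ m) * \<phi> x))" for m
    using assms unfolding schwartz_def nth_deriv_def by (auto dest: spec[of _ 0])
  from this[of 0] this[of 2] obtain B0 B2 where
    B: "0 < B0" "0 < B2" "\<And>x. cmod (\<phi> x) \<le> B0" "\<And>x. cmod (of_real (x\<^sup>2) * \<phi> x) \<le> B2"
    by (auto simp: bounded_pos)
  show ?thesis
  proof
    show "0 < B0 + B2" using B by simp
    show "cmod (\<phi> x) \<le> B0 + B2" for x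
      using B(3)[of x] B(2) by simp
    have p: "0 < 1 + x\<^sup>2" for x :: real
      by (simp add: add_pos_nonneg)
    show "cmod (\<phi> x) \<le> (B0 + B2) * inverse (1 + x\<^sup>2)" for x
      using B(3,4)[of x] p[of x] by (simp add: norm_mult norm_power divide_simps algebra_simps)
  qed
qed

lemma schwartz_integrable:
  assumes "\<phi> \<in> schwartz"
  shows "integrable lebesgue \<phi>"
proof -
  obtain B where B: "0 < B" "\<And>x. cmod (\<phi> x) \<le> B * inverse (1 + x\<^sup>2)"
    using schwartz_decay[OF assms] by metis
  show ?thesis
    by (rule Bochner_Integration.integrable_bound[OF integrable_mult_right[OF integrable_inverse_1_plus_square_lebesgue, of B]])
      (use B in \<open>auto intro!: schwartz_measurable assms order_trans[OF B(2) abs_ge_self]\<close>)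
qed

text \<open>Each multiplication by x in Horner form costs one factor exp |x|. Exponential growth of
  any rate is later absorbed by the Gaussian.\<close>

lemma poly_exp_bound:
  fixes P :: "complex poly"
  shows "\<exists>B>0. \<exists>k::nat. \<forall>x::real. cmod (poly P (of_real x)) \<le> B * exp (real k * \<bar>x\<bar>)"
proof (induction P)
  case 0
  show ?case by (intro exI[of _ 1]) auto
next
  case (pCons a P)
  then obtain B k where B: "0 < B" "\<And>x. cmod (poly P (of_real x)) \<le> B * exp (real k * \<bar>x\<bar>)" by blast
  show ?case
  proof (intro exI[of _ "cmod a + B"] exI[of _ "Suc k"] conjI allI)
    fix x :: real
    have 1: "\<bar>x\<bar> \<le> exp \<bar>x\<bar>" "1 \<le> exp (real (Suc k) * \<bar>x\<bar>)"
      using exp_ge_add_one_self[of "\<bar>x\<bar>"] by (auto simp del: exp_ge_add_one_self)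
    have "cmod (poly (pCons a P) (of_real x)) \<le> cmod a + \<bar>x\<bar> * cmod (poly P (of_real x))"
      using norm_triangle_ineq[of a "of_real x * poly P (of_real x)"] by (simp add: norm_mult)
    also have "\<dots> \<le> cmod a * exp (real (Suc k) * \<bar>x\<bar>) + exp \<bar>x\<bar> * (B * exp (real k * \<bar>x\<bar>))"
      using 1 B by (intro add_mono mult_mono) (auto simp: mult_le_cancel_left1)
    also have "\<dots> = (cmod a + B) * exp (real (Suc k) * \<bar>x\<bar>)"
      by (simp add: algebra_simps exp_add)
    finally show "cmod (poly (pCons a P) (of_real x)) \<le> (cmod a + B) * exp (real (Suc k) * \<bar>x\<bar>)" .
  qed (use B in \<open>simp add: add_nonneg_pos\<close>)
qed

lemma bounded_poly_gauss:
  fixes P :: "complex poly"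
  shows "bounded (range (\<lambda>x::real. poly P (of_real x) * exp (- of_real (x\<^sup>2) + \<i> * of_real (t * x))))"
proof -
  obtain B k where B: "0 < B" "\<And>x. cmod (poly P (of_real x)) \<le> B * exp (real k * \<bar>x\<bar>)"
    using poly_exp_bound by blast
  show ?thesis
  proof (rule boundedI, clarify)
    fix x :: real
    have "cmod (poly P (of_real x) * exp (- of_real (x\<^sup>2) + \<i> * of_real (t * x))) \<le> B * exp (real k * \<bar>x\<bar>) * exp (- x\<^sup>2)"
      using B by (simp add: norm_mult norm_exp_eq_Re)
    also have "\<dots> = B * exp (real k * \<bar>x\<bar> - x\<^sup>2)"
      by (simp add: exp_diff exp_minus field_simps)
    also have "\<dots> \<le> B * exp ((real k)\<^sup>2 / 4)"
    proof -
      have "0 \<le> (real k / 2 - \<bar>x\<bar>)\<^sup>2" by simp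
      then have "real k * \<bar>x\<bar> - x\<^sup>2 \<le> (real k)\<^sup>2 / 4"
        by (simp add: power2_diff power_divide)
      then show ?thesis using B by simp
    qed
    finally show "cmod (poly P (of_real x) * exp (- of_real (x\<^sup>2) + \<i> * of_real (t * x))) \<le> B * exp ((real k)\<^sup>2 / 4)" .
  qed
qed

text \<open>Polynomials times exp (- x^2 + i t x) form a family \<open>F P\<close> closed under
  differentiation and under multiplication by powers of x, and each member is bounded. These are the
  only test functions that the identification of distributional transforms uses.\<close>

lemma schwartz_gauss:
  "(\<lambda>x. of_real (exp (- x\<^sup>2)) * iexp (t * x)) \<in> schwartz"
proof -
  define F where "F P x = poly P (of_real x) * exp (- of_real (x\<^sup>2) + \<i> * of_real (t * x))"
    for P :: "complex poly" and x :: real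
  have deriv: "(F P has_vector_derivative F (pderiv P + P * [:\<i> * of_real t, -2:]) x) (at x)" for P x
  proof -
    have "((\<lambda>z. poly P z * exp (- z\<^sup>2 + \<i> * of_real t * z)) has_field_derivative
        poly (pderiv P + P * [:\<i> * of_real t, -2:]) (of_real x) *
        exp (- (of_real x)\<^sup>2 + \<i> * of_real t * of_real x)) (at (of_real x))"
      by (auto intro!: derivative_eq_intros simp: algebra_simps)
    from has_vector_derivative_real_field[OF this] show ?thesis
      by (simp add: F_def[abs_def] mult.assoc)
  qed
  have ex: "\<exists>Q. nth_deriv n (F P) = F Q" for n P
  proof (induction n)
    case (Suc n)
    then obtain Q where "nth_deriv n (F P) = F Q" by blast
    then have "nth_deriv (Suc n) (F P) = F (pderiv Q + Q * [:\<i> * of_real t, -2:])"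
      using vector_derivative_at[OF deriv] by (auto simp: nth_deriv_def)
    then show ?case by blast
  qed (auto simp: nth_deriv_def)
  have "F 1 \<in> schwartz"
    unfolding schwartz_def mem_Collect_eq
  proof (intro allI conjI)
    fix n x
    obtain Q where Q: "nth_deriv n (F 1) = F Q" using ex by blast
    show "nth_deriv n (F 1) differentiable (at x)"
      unfolding Q using deriv[of Q x] by (rule differentiableI_vector)
    fix m
    have *: "(\<lambda>x. of_real (x ^ m) * F Q x) = F (monom 1 m * Q)"
      by (auto simp: F_def poly_monom)
    show "bounded (range (\<lambda>x. of_real (x ^ m) * nth_deriv n (F 1) x))"
      unfolding Q * unfolding F_def by (rule bounded_poly_gauss)
  qed
  moreover have "F 1 = (\<lambda>x. of_real (exp (- x\<^sup>2)) * iexp (t * x))"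
    by (rule ext) (simp add: F_def exp_of_real[symmetric] mult_exp_exp)
  ultimately show ?thesis by simp
qed

text \<open>Levy's uniqueness theorem for probability measures, applied to the normalised positive
  and negative parts of a Borel version of \<open>u\<close>. Taking t = 0 shows that the two parts
  have the same mass \<open>m\<close>.\<close>

lemma real_fourier_uniqueness:
  fixes u :: "real \<Rightarrow> real"
  assumes u: "integrable lebesgue u"
    and z: "\<And>t. (LINT x|lebesgue. of_real (u x) * iexp (t * x)) = 0"
  shows "AE x in lebesgue. u x = 0"
proof -
  have [measurable]: "u \<in> borel_measurable lebesgue" using u by auto
  then obtain v where [measurable]: "v \<in> borel_measurable lborel" and v: "AE x in lborel. u x = v x"
    using completion_ex_borel_measurable_real by blast
  have v': "AE x in lebesgue. u x = v x" using v by (rule AE_completion)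
  have v_int: "integrable lborel v"
    using u v' by (subst integrable_completion[symmetric]) (auto simp: integrable_cong_AE_imp measurable_completion intro: integrable_cong_AE_imp[OF u])
  have vz: "(LINT x|lborel. of_real (v x) * iexp (t * x)) = 0" for t
  proof -
    have "(LINT x|lborel. of_real (v x) * iexp (t * x)) = (LINT x|lebesgue. of_real (v x) * iexp (t * x))"
      by (subst integral_completion) auto
    also have "\<dots> = (LINT x|lebesgue. of_real (u x) * iexp (t * x))"
      using v' by (intro integral_cong_AE) (auto intro: measurable_completion)
    finally show ?thesis using z by simp
  qed
  define P where "P x = max 0 (v x)" for x
  define N where "N x = max 0 (- v x)" for x
  have [measurable]: "P \<in> borel_measurable borel" "N \<in> borel_measurable borel"
    unfolding P_def[abs_def] N_def[abs_def] by measurable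
  have PN: "v x = P x - N x" "0 \<le> P x" "0 \<le> N x" for x by (auto simp: P_def N_def)
  have P_int: "integrable lborel P" "integrable lborel N"
    using v_int by (auto intro!: Bochner_Integration.integrable_bound[OF v_int] simp: P_def N_def)
  have iexp_int: "integrable lborel (\<lambda>x. complex_of_real (w x) * iexp (t * x))" if "integrable lborel w" for w t
    using that by (intro Bochner_Integration.integrable_bound[OF that]) (auto simp: norm_mult)
  have eq: "(LINT x|lborel. of_real (P x) * iexp (t * x)) = (LINT x|lborel. of_real (N x) * iexp (t * x))" for t
    using vz[of t] iexp_int[OF P_int(1), of t] iexp_int[OF P_int(2), of t]
    by (simp add: PN(1) left_diff_distrib)
  define m where "m = (LINT x|lborel. P x)"
  have "complex_of_real m = of_real (LINT x|lborel. N x)"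
    using eq[of 0] by (simp add: m_def)
  then have mN: "(LINT x|lborel. N x) = m" by (simp only: of_real_eq_iff)
  have "AE x in lborel. P x = N x"
  \<comment> \<open>Without mass there is nothing to normalise, but then both parts vanish almost
    everywhere.\<close>
  proof (cases "m = 0")
    case True
    have "AE x in lborel. P x = 0" "AE x in lborel. N x = 0"
      using True mN P_int PN integral_nonneg_eq_0_iff_AE[of lborel P] integral_nonneg_eq_0_iff_AE[of lborel N]
      by (auto simp: m_def)
    then show ?thesis by auto
  next
    case False
    then have m: "0 < m" using PN(2) by (auto simp: m_def less_le integral_nonneg_AE)
    let ?D = "\<lambda>w. density lborel (\<lambda>x. ennreal (w x / m))"
    have rd: "real_distribution (?D w)"
      and ch: "char (?D w) t = (LINT x|lborel. of_real (w x) * iexp (t * x)) / of_real m"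
      if w: "integrable lborel w" "\<And>x. 0 \<le> w x" "(LINT x|lborel. w x) = m" for w t
    proof -
      have [measurable]: "w \<in> borel_measurable borel" using w(1) by auto
      have "emeasure (?D w) UNIV = ennreal (LINT x|lborel. w x / m)"
        using w m by (subst nn_integral_eq_integral[symmetric]) (auto simp: emeasure_density)
      then have "prob_space (?D w)" using w(3) m by (intro prob_spaceI) auto
      then show "real_distribution (?D w)"
        by (simp add: real_distribution_def real_distribution_axioms_def)
      have "char (?D w) t = (LINT x|lborel. (w x / m) *\<^sub>R iexp (t * x))"
        unfolding char_def using w m by (subst integral_density) auto
      also have "\<dots> = (LINT x|lborel. of_real (w x) * iexp (t * x) / of_real m)"
        by (intro Bochner_Integration.integral_cong) (auto simp: scaleR_conv_of_real)
      finally show "char (?D w) t = (LINT x|lborel. of_real (w x) * iexp (t * x)) / of_real m"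
        by simp
    qed
    have "?D P = ?D N"
    proof (intro Levy_uniqueness rd ext)
      show "char (?D P) t = char (?D N) t" for t
        using ch[OF P_int(1) PN(2) m_def[symmetric]] ch[OF P_int(2) PN(3) mN] eq by simp
    qed (use P_int PN mN in \<open>simp_all add: m_def\<close>)
    then have "AE x in lborel. ennreal (P x / m) = ennreal (N x / m)"
      by (intro sigma_finite_measure.density_unique sigma_finite_lborel) auto
    then show ?thesis
      by eventually_elim (use m PN in auto)
  qed
  then have "AE x in lebesgue. P x = N x" by (rule AE_completion)
  with v' show ?thesis by eventually_elim (simp add: PN)
qed

text \<open>The conjugate of \<open>G\<close> satisfies the same hypothesis, with t replaced by - t;
  hence the real and the imaginary part do too.\<close>

lemma fourier_uniqueness:
  assumes G: "integrable lebesgue G"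
    and z: "\<And>t. (LINT x|lebesgue. G x * iexp (t * x)) = 0"
  shows "AE x in lebesgue. G x = 0"
proof -
  have int: "integrable lebesgue (\<lambda>x. G x * iexp (t * x))" for t
    using G by (intro Bochner_Integration.integrable_bound[OF G]) (auto simp: norm_mult)
  have c: "(LINT x|lebesgue. cnj (G x) * iexp (t * x)) = 0" for t
  proof -
    have "(LINT x|lebesgue. cnj (G x) * iexp (t * x)) = (LINT x|lebesgue. cnj (G x * iexp (- t * x)))"
      by (intro Bochner_Integration.integral_cong) (auto simp: exp_cnj)
    also have "\<dots> = 0" unfolding Bochner_Integration.integral_cnj z by simp
    finally show ?thesis .
  qed
  have intc: "integrable lebesgue (\<lambda>x. cnj (G x) * iexp (t * x))" for t
    using G by (intro Bochner_Integration.integrable_bound[OF G]) (auto simp: norm_mult)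
  have "AE x in lebesgue. Re (G x) = 0"
  proof (rule real_fourier_uniqueness)
    fix t
    have "(LINT x|lebesgue. of_real (Re (G x)) * iexp (t * x)) =
      (LINT x|lebesgue. (G x * iexp (t * x) + cnj (G x) * iexp (t * x)) / 2)"
      by (intro Bochner_Integration.integral_cong) (auto simp: distrib_right[symmetric] complex_add_cnj)
    also have "\<dots> = 0" using int intc z c by simp
    finally show "(LINT x|lebesgue. of_real (Re (G x)) * iexp (t * x)) = 0" .
  qed (use G in simp)
  moreover have "AE x in lebesgue. Im (G x) = 0"
  proof (rule real_fourier_uniqueness)
    fix t
    have "(LINT x|lebesgue. of_real (Im (G x)) * iexp (t * x)) =
      (LINT x|lebesgue. (G x * iexp (t * x) - cnj (G x) * iexp (t * x)) / (2 * \<i>))"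
    proof (intro Bochner_Integration.integral_cong refl)
      fix x
      have *: "G x * e - cnj (G x) * e = of_real (Im (G x)) * e * (2 * \<i>)" for e
        by (simp add: left_diff_distrib[symmetric] complex_diff_cnj)
      show "of_real (Im (G x)) * iexp (t * x) =
          (G x * iexp (t * x) - cnj (G x) * iexp (t * x)) / (2 * \<i>)"
        unfolding * by (subst nonzero_mult_div_cancel_right) auto
    qed
    also have "\<dots> = 0" using int intc z c by simp
    finally show "(LINT x|lebesgue. of_real (Im (G x)) * iexp (t * x)) = 0" .
  qed (use G in simp)
  ultimately show ?thesis by eventually_elim (simp add: complex_eq_iff)
qed


section \<open>The Hausdorff--Young inequality\<close>

text \<open>Young's inequality without the factors 1 / a and 1 / b, which permits a proof without
  convexity: according to which of y and x^(a - 1) is larger, the product is at most one of the two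
  terms.\<close>

lemma Young_powr:
  fixes x y a b :: real
  assumes "0 \<le> x" "0 \<le> y" "1 < a" "b = a / (a - 1)"
  shows "x * y \<le> x powr a + y powr b"
proof (cases "y \<le> x powr (a - 1)")
  case True
  then have "x * y \<le> x * x powr (a - 1)" using assms by (intro mult_left_mono)
  also have "\<dots> = x powr a" using assms powr_mult_base[of x "a - 1"] by simp
  finally show ?thesis by (simp add: add_increasing2)
next
  case False
  then have "x powr (a - 1) \<le> y" by simp
  then have "(x powr (a - 1)) powr (1 / (a - 1)) \<le> y powr (1 / (a - 1))"
    using assms by (intro powr_mono2) auto
  then have "x \<le> y powr (1 / (a - 1))"
    using assms by (simp add: powr_powr)
  then have "x * y \<le> y powr (1 / (a - 1)) * y" using assms by (intro mult_right_mono)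
  also have "\<dots> = y powr (1 + 1 / (a - 1))"
    using assms powr_mult_base[of y "1 / (a - 1)"] by (simp add: mult.commute)
  also have "1 + 1 / (a - 1) = b" using assms by (simp add: field_simps)
  finally show ?thesis by (simp add: add_increasing)
qed

lemma schwartz_powr_finite:
  assumes "\<phi> \<in> schwartz" "1 \<le> a"
  obtains A where "0 < A" "(\<integral>\<^sup>+x. ennreal (cmod (\<phi> x) powr a) \<partial>lebesgue) \<le> ennreal A"
proof -
  obtain B where B: "0 < B" "\<And>x. cmod (\<phi> x) \<le> B"
    using schwartz_decay[OF assms(1)] by metis
  note [measurable] = schwartz_measurable(2)[OF assms(1)]
  let ?I = "LINT x|lebesgue. cmod (\<phi> x)"
  have "cmod (\<phi> x) powr a \<le> B powr (a - 1) * cmod (\<phi> x)" for x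
  proof -
    have "cmod (\<phi> x) powr a = cmod (\<phi> x) powr (a - 1) * cmod (\<phi> x)"
      using powr_mult_base[of "cmod (\<phi> x)" "a - 1"] by (simp add: mult.commute)
    also have "\<dots> \<le> B powr (a - 1) * cmod (\<phi> x)"
      using assms B by (intro mult_right_mono powr_mono2) auto
    finally show ?thesis .
  qed
  then have "(\<integral>\<^sup>+x. ennreal (cmod (\<phi> x) powr a) \<partial>lebesgue) \<le>
      (\<integral>\<^sup>+x. ennreal (B powr (a - 1)) * ennreal (cmod (\<phi> x)) \<partial>lebesgue)"
    by (intro nn_integral_mono) (simp add: ennreal_mult[symmetric])
  also have "\<dots> = ennreal (B powr (a - 1) * ?I)"
    using schwartz_integrable[OF assms(1)]
    by (subst nn_integral_cmult) (auto simp: nn_integral_eq_integral ennreal_mult)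
  also have "\<dots> \<le> ennreal (B powr (a - 1) * ?I + 1)" by (rule ennreal_leI) simp
  finally show ?thesis by (rule that[rotated]) (simp add: add_nonneg_pos)
qed

lemma hausdorff_young_1:
  assumes "f \<in> borel_measurable lebesgue" "(\<integral>\<^sup>+x. ennreal (cmod (f x)) \<partial>lebesgue) < \<infinity>"
  shows "represented_by (fourier_distr (distr_of_fun f)) (fourier f)"
  unfolding represented_by_def fourier_distr_def distr_of_fun_def
  using integrableI_bounded[OF assms] by (blast intro: multiplication_formula schwartz_integrable)

text \<open>For a > 1 the Fourier integral of \<open>f\<close> may fail to exist, so
  \<open>h\<close> is built as an almost everywhere limit of the transforms of truncations. One
  \<open>h\<close> serves every bound \<open>N\<close>, as is needed when \<open>N\<close> later
  runs through the bounds that approach a norm.\<close>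

lemma hausdorff_young:
  assumes a: "1 < a" "a \<le> 2" and b: "b = a / (a - 1)"
  obtains K where "0 < K"
    "\<And>f :: real \<Rightarrow> complex. f \<in> borel_measurable lebesgue \<Longrightarrow> (\<integral>\<^sup>+x. ennreal (cmod (f x) powr a) \<partial>lebesgue) < \<infinity> \<Longrightarrow>
      \<exists>h\<in>borel_measurable lebesgue. represented_by (fourier_distr (distr_of_fun f)) h \<and>
        (\<forall>N>0. (\<integral>\<^sup>+x. ennreal (cmod (f x) powr a) \<partial>lebesgue) \<le> ennreal (N powr a) \<longrightarrow>
          (\<integral>\<^sup>+\<xi>. ennreal (cmod (h \<xi>) powr b) \<partial>lebesgue) \<le> ennreal ((K * N) powr b))"
proof -
  obtain K where K: "0 < K" and HY: "\<And>f N. integrable lebesgue f \<Longrightarrow> 0 < N \<Longrightarrow>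
      (\<integral>\<^sup>+x. ennreal (cmod (f x) powr a) \<partial>lebesgue) \<le> ennreal (N powr a) \<Longrightarrow>
      (\<integral>\<^sup>+\<xi>. ennreal (cmod (fourier f \<xi>) powr b) \<partial>lebesgue) \<le> ennreal ((K * N) powr b)"
    using hausdorff_young_integrable[OF a b] by metis
  have b2: "2 \<le> b" using a by (simp add: b field_simps)
  show ?thesis
  proof (rule that[OF K])
    fix f :: "real \<Rightarrow> complex" assume f [measurable]: "f \<in> borel_measurable lebesgue"
      and fin: "(\<integral>\<^sup>+x. ennreal (cmod (f x) powr a) \<partial>lebesgue) < \<infinity>"
    \<comment> \<open>Cut off in height and in support, hence integrable; each value is either 0 or
      that of \<open>f\<close>.\<close>
    define t where "t n x = (if cmod (f x) \<le> real n \<and> \<bar>x\<bar> \<le> real n then f x else 0)" for n x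
    have t_meas [measurable]: "t n \<in> borel_measurable lebesgue" for n
      unfolding t_def[abs_def] by measurable
    have t_int: "integrable lebesgue (t n)" for n
    proof (rule Bochner_Integration.integrable_bound)
      show "integrable lebesgue (\<lambda>x. real n * indicator {- real n..real n} x :: real)"
        by (intro integrable_mult_right integrable_real_indicator) auto
      show "AE x in lebesgue. norm (t n x) \<le> norm (real n * indicator {- real n..real n} x)"
        by (rule AE_I2) (auto simp: t_def indicator_def abs_le_iff)
    qed simp
    have t_lim: "\<forall>\<^sub>F n in sequentially. t n x = f x" for x
      using eventually_ge_at_top[of "nat \<lceil>max (cmod (f x)) \<bar>x\<bar>\<rceil>"]
      by eventually_elim (auto simp: t_def nat_le_iff ceiling_le_iff)
    have tail: "(\<lambda>n. \<integral>\<^sup>+x. ennreal (cmod (f x - t n x) powr a) \<partial>lebesgue) \<longlonglongrightarrow> (\<integral>\<^sup>+x. 0 \<partial>(lebesgue :: real measure))"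
    proof (rule nn_integral_dominated_convergence[OF _ _ _ _ fin])
      show "AE x in lebesgue. (\<lambda>n. ennreal (cmod (f x - t n x) powr a)) \<longlonglongrightarrow> 0"
      proof (intro AE_I2 tendsto_eventually)
        show "\<forall>\<^sub>F n in sequentially. ennreal (cmod (f x - t n x) powr a) = 0" for x
          using t_lim[of x] by eventually_elim simp
      qed
      show "AE x in lebesgue. ennreal (cmod (f x - t n x) powr a) \<le> ennreal (cmod (f x) powr a)" for n
        by (rule AE_I2) (auto simp: t_def)
    qed measurable
    \<comment> \<open>The rate 1/4 leaves room for a weight 2^k: the weighted errors still decay
      like (1/2)^k. This is used twice below, for convergence and for the pairing with test
      functions.\<close>
    have "\<exists>n\<ge>k. (\<integral>\<^sup>+x. ennreal (cmod (f x - t n x) powr a) \<partial>lebesgue) \<le> ennreal (((1/4) ^ k) powr a)" for k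
    proof -
      have "\<forall>\<^sub>F n in sequentially. (\<integral>\<^sup>+x. ennreal (cmod (f x - t n x) powr a) \<partial>lebesgue) < ennreal (((1/4) ^ k) powr a)"
        using order_tendstoD(2)[OF tail] by simp
      then have "\<forall>\<^sub>F n in sequentially. k \<le> n \<and> (\<integral>\<^sup>+x. ennreal (cmod (f x - t n x) powr a) \<partial>lebesgue) < ennreal (((1/4) ^ k) powr a)"
        using eventually_ge_at_top[of k] by eventually_elim auto
      then show ?thesis
        by (auto dest!: eventually_happens intro: less_imp_le)
    qed
    then obtain r where r: "\<And>k. k \<le> r k"
      "\<And>k. (\<integral>\<^sup>+x. ennreal (cmod (f x - t (r k) x) powr a) \<partial>lebesgue) \<le> ennreal (((1/4) ^ k) powr a)"
      by metis
    define g where "g k = t (r k)" for k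
    have g_meas [measurable]: "g k \<in> borel_measurable lebesgue" and g_int: "integrable lebesgue (g k)" for k
      unfolding g_def by (auto intro: t_int)
    have r_lim: "filterlim r sequentially sequentially"
      by (rule filterlim_at_top_mono[OF filterlim_ident]) (use r in auto)
    have g_lim: "(\<lambda>k. g k x) \<longlonglongrightarrow> f x" for x
      unfolding g_def by (intro tendsto_eventually eventually_compose_filterlim[OF t_lim r_lim])
    have g_le: "cmod (g k x) \<le> cmod (f x)" for k x by (simp add: g_def t_def)
    \<comment> \<open>Both truncations take only the values 0 and f(x). Where they differ, one of
      them is 0 and its distance to \<open>f\<close> is the full |f(x)|, so the pointwise bound has
      constant 1. The factor 2 moves inside the power because 2 <= 2^a.\<close>
    have g_diff: "(\<integral>\<^sup>+x. ennreal (cmod (g m x - g k x) powr a) \<partial>lebesgue) \<le> ennreal ((2 * (1/4) ^ k) powr a)"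
      if "k \<le> m" for k m
    proof -
      have "(\<integral>\<^sup>+x. ennreal (cmod (g m x - g k x) powr a) \<partial>lebesgue) \<le>
        (\<integral>\<^sup>+x. ennreal (cmod (f x - g k x) powr a) + ennreal (cmod (f x - g m x) powr a) \<partial>lebesgue)"
        by (rule nn_integral_mono) (auto simp: g_def t_def)
      also have "\<dots> = (\<integral>\<^sup>+x. ennreal (cmod (f x - g k x) powr a) \<partial>lebesgue) + (\<integral>\<^sup>+x. ennreal (cmod (f x - g m x) powr a) \<partial>lebesgue)"
        by (rule nn_integral_add) auto
      also have "\<dots> \<le> ennreal (((1/4) ^ k) powr a) + ennreal (((1/4) ^ m) powr a)"
        unfolding g_def by (intro add_mono r)
      also have "\<dots> \<le> ennreal (((1/4) ^ k) powr a) + ennreal (((1/4) ^ k) powr a)"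
        using that a by (intro add_mono order_refl ennreal_leI powr_mono2 power_decreasing) auto
      also have "\<dots> = ennreal (2 * ((1/4) ^ k) powr a)"
        by (simp add: ennreal_plus[symmetric] del: ennreal_plus)
      also have "\<dots> \<le> ennreal ((2 * (1/4) ^ k) powr a)"
      proof (rule ennreal_leI)
        have "(2::real) powr 1 \<le> 2 powr a" using a by (intro powr_mono) auto
        then show "2 * ((1/4) ^ k) powr a \<le> (2 * (1/4) ^ k) powr a"
          by (subst powr_mult) (auto intro!: mult_right_mono)
      qed
      finally show ?thesis .
    qed
    define G where "G k = fourier (g k)" for k
    have [measurable]: "G k \<in> borel_measurable lebesgue" for k unfolding G_def by simp
    have G_diff: "(\<integral>\<^sup>+\<xi>. ennreal (cmod (G m \<xi> - G k \<xi>) powr b) \<partial>lebesgue) \<le> ennreal ((2 * K * (1/4) ^ k) powr b)"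
      if "k \<le> m" for k m
      using HY[OF Bochner_Integration.integrable_diff[OF g_int g_int] _ g_diff[OF that]]
      by (simp add: G_def fourier_diff[OF g_int g_int] mult_ac)
    have "AE \<xi> in lebesgue. convergent (\<lambda>k. G k \<xi>)"
    proof -
      \<comment> \<open>The integrals of these weighted increments have a finite sum, so almost
        everywhere the increments are eventually below (1/2)^k and the telescoping series
        converges.\<close>
      let ?w = "\<lambda>k \<xi>. ennreal ((2 ^ k * cmod (G (Suc k) \<xi> - G k \<xi>)) powr b)"
      have "(\<integral>\<^sup>+\<xi>. (\<Sum>k. ?w k \<xi>) \<partial>lebesgue) = (\<Sum>k. \<integral>\<^sup>+\<xi>. ?w k \<xi> \<partial>lebesgue)"
        by (rule nn_integral_suminf) measurable
      also have "\<dots> \<le> (\<Sum>k. ennreal ((2 * K) powr b * (1/2) ^ k))"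
      proof (intro suminf_le summableI)
        fix k
        have "(\<integral>\<^sup>+\<xi>. ?w k \<xi> \<partial>lebesgue) = ennreal ((2 ^ k) powr b) * (\<integral>\<^sup>+\<xi>. ennreal (cmod (G (Suc k) \<xi> - G k \<xi>) powr b) \<partial>lebesgue)"
          by (subst nn_integral_cmult[symmetric]) (auto simp: powr_mult ennreal_mult)
        also have "\<dots> \<le> ennreal ((2 ^ k) powr b) * ennreal ((2 * K * (1/4) ^ k) powr b)"
          by (intro mult_left_mono G_diff) auto
        also have "\<dots> = ennreal ((2 ^ k * (2 * K * (1/4) ^ k)) powr b)"
          using K by (simp add: ennreal_mult[symmetric] powr_mult)
        also have "2 ^ k * (2 * K * (1/4) ^ k) = 2 * K * ((1/2) ^ k :: real)"
          by (simp add: power_divide power_mult_distrib[symmetric] field_simps)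
        also have "ennreal ((2 * K * ((1/2) ^ k)) powr b) \<le> ennreal ((2 * K) powr b * (1/2) ^ k)"
        proof (rule ennreal_leI)
          have "((1/2) ^ k) powr b \<le> ((1/2) ^ k :: real) powr 1"
            using b2 by (intro powr_mono') (auto simp: power_le_one)
          then show "(2 * K * ((1/2) ^ k)) powr b \<le> (2 * K) powr b * (1/2) ^ k"
            using K by (subst powr_mult) (auto intro!: mult_left_mono)
        qed
        finally show "(\<integral>\<^sup>+\<xi>. ?w k \<xi> \<partial>lebesgue) \<le> ennreal ((2 * K) powr b * (1/2) ^ k)" .
      qed
      also have "\<dots> < \<infinity>"
        by (subst suminf_ennreal2) (auto intro!: summable_mult summable_geometric)
      finally have "AE \<xi> in lebesgue. (\<Sum>k. ?w k \<xi>) \<noteq> \<infinity>"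
        by (intro nn_integral_PInf_AE) auto
      then show ?thesis
      proof eventually_elim
        case (elim \<xi>)
        then have "summable (\<lambda>k. (2 ^ k * cmod (G (Suc k) \<xi> - G k \<xi>)) powr b)"
          by (intro summable_suminf_not_top) auto
        then have "(\<lambda>k. (2 ^ k * cmod (G (Suc k) \<xi> - G k \<xi>)) powr b) \<longlonglongrightarrow> 0"
          by (rule summable_LIMSEQ_zero)
        then have "\<forall>\<^sub>F k in sequentially. (2 ^ k * cmod (G (Suc k) \<xi> - G k \<xi>)) powr b < 1"
          by (rule order_tendstoD) simp
        then have "\<forall>\<^sub>F k in sequentially. norm (G (Suc k) \<xi> - G k \<xi>) \<le> (1/2) ^ k"
        proof eventually_elim
          case (elim k)
          have "2 ^ k * cmod (G (Suc k) \<xi> - G k \<xi>) \<le> 1"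
          proof (rule ccontr)
            assume "\<not> ?thesis"
            then have "1 powr b \<le> (2 ^ k * cmod (G (Suc k) \<xi> - G k \<xi>)) powr b"
              using b2 by (intro powr_mono2) auto
            with elim show False by simp
          qed
          then show ?case by (simp add: field_simps power_divide)
        qed
        then have "summable (\<lambda>k. G (Suc k) \<xi> - G k \<xi>)"
          by (rule summable_comparison_test_ev) (simp add: summable_geometric)
        then have "convergent (\<lambda>n. (\<Sum>k<n. G (Suc k) \<xi> - G k \<xi>) + G 0 \<xi>)"
          unfolding summable_iff_convergent by (intro convergent_add convergent_const)
        moreover have "(\<Sum>k<n. G (Suc k) \<xi> - G k \<xi>) = G n \<xi> - G 0 \<xi>" for n
          by (rule sum_lessThan_telescope)
        ultimately show "convergent (\<lambda>k. G k \<xi>)" by simp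
      qed
    qed
    define h where "h \<xi> = lim (\<lambda>k. G k \<xi>)" for \<xi>
    have h_meas [measurable]: "h \<in> borel_measurable lebesgue"
      unfolding h_def[abs_def] by (rule borel_measurable_lim_metric) simp
    have h_lim: "AE \<xi> in lebesgue. (\<lambda>k. G k \<xi>) \<longlonglongrightarrow> h \<xi>"
      using \<open>AE \<xi> in lebesgue. convergent (\<lambda>k. G k \<xi>)\<close>
      by eventually_elim (simp add: h_def convergent_LIMSEQ_iff)
    \<comment> \<open>One Fatou argument for two purposes: \<open>c\<close> = \<open>G k\<close>
      gives the rate of convergence to \<open>h\<close>, and \<open>c\<close> = 0 the norm bound for
      \<open>h\<close>.\<close>
    have fatou: "(\<integral>\<^sup>+\<xi>. ennreal (cmod (h \<xi> - c \<xi>) powr b) \<partial>lebesgue) \<le> D"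
      if c [measurable]: "c \<in> borel_measurable lebesgue" and
        ev: "\<forall>\<^sub>F m in sequentially. (\<integral>\<^sup>+\<xi>. ennreal (cmod (G m \<xi> - c \<xi>) powr b) \<partial>lebesgue) \<le> D" for c D
    proof -
      have "(\<integral>\<^sup>+\<xi>. ennreal (cmod (h \<xi> - c \<xi>) powr b) \<partial>lebesgue) =
          (\<integral>\<^sup>+\<xi>. liminf (\<lambda>m. ennreal (cmod (G m \<xi> - c \<xi>) powr b)) \<partial>lebesgue)"
      proof (intro nn_integral_cong_AE)
        show "AE \<xi> in lebesgue. ennreal (cmod (h \<xi> - c \<xi>) powr b) = liminf (\<lambda>m. ennreal (cmod (G m \<xi> - c \<xi>) powr b))"
          using h_lim
        proof eventually_elim
          case (elim \<xi>)
          have "(\<lambda>m. ennreal (cmod (G m \<xi> - c \<xi>) powr b)) \<longlonglongrightarrow> ennreal (cmod (h \<xi> - c \<xi>) powr b)"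
            using b2 by (intro tendsto_ennrealI tendsto_powr2 tendsto_intros elim) auto
          then show ?case by (intro lim_imp_Liminf[symmetric]) auto
        qed
      qed
      also have "\<dots> \<le> liminf (\<lambda>m. \<integral>\<^sup>+\<xi>. ennreal (cmod (G m \<xi> - c \<xi>) powr b) \<partial>lebesgue)"
        by (rule nn_integral_liminf) measurable
      also have "\<dots> \<le> limsup (\<lambda>m. \<integral>\<^sup>+\<xi>. ennreal (cmod (G m \<xi> - c \<xi>) powr b) \<partial>lebesgue)"
        by (rule Liminf_le_Limsup) simp
      also have "\<dots> \<le> D" using ev by (rule Limsup_bounded)
      finally show ?thesis .
    qed
    have hG: "(\<integral>\<^sup>+\<xi>. ennreal (cmod (h \<xi> - G k \<xi>) powr b) \<partial>lebesgue) \<le> ennreal ((2 * K * (1/4) ^ k) powr b)" for k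
      by (intro fatou eventually_mono[OF eventually_ge_at_top[of k] G_diff]) simp
    show "\<exists>h\<in>borel_measurable lebesgue. represented_by (fourier_distr (distr_of_fun f)) h \<and>
        (\<forall>N>0. (\<integral>\<^sup>+x. ennreal (cmod (f x) powr a) \<partial>lebesgue) \<le> ennreal (N powr a) \<longrightarrow>
          (\<integral>\<^sup>+\<xi>. ennreal (cmod (h \<xi>) powr b) \<partial>lebesgue) \<le> ennreal ((K * N) powr b))"
    proof (intro bexI[OF _ h_meas] conjI allI impI)
      fix N :: real assume N: "0 < N" and le: "(\<integral>\<^sup>+x. ennreal (cmod (f x) powr a) \<partial>lebesgue) \<le> ennreal (N powr a)"
      have "(\<integral>\<^sup>+x. ennreal (cmod (g m x) powr a) \<partial>lebesgue) \<le> ennreal (N powr a)" for m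
        using a by (intro order_trans[OF nn_integral_mono le] ennreal_leI powr_mono2 g_le) auto
      from HY[OF g_int N this] fatou[of "\<lambda>_. 0" "ennreal ((K * N) powr b)"]
      show "(\<integral>\<^sup>+\<xi>. ennreal (cmod (h \<xi>) powr b) \<partial>lebesgue) \<le> ennreal ((K * N) powr b)"
        by (simp add: G_def)
    next
      show "represented_by (fourier_distr (distr_of_fun f)) h"
        unfolding represented_by_def fourier_distr_def distr_of_fun_def
      proof
        fix \<phi> assume \<phi>: "\<phi> \<in> schwartz"
        note [measurable] = schwartz_measurable(2)[OF \<phi>]
        obtain A where A: "0 < A" "(\<integral>\<^sup>+x. ennreal (cmod (\<phi> x) powr a) \<partial>lebesgue) \<le> ennreal A"
          using schwartz_powr_finite[OF \<phi>, of a] a by auto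
        have "(\<integral>\<^sup>+x. ennreal (cmod (\<phi> x) powr a) \<partial>lebesgue) \<le> ennreal ((A powr (1 / a)) powr a)"
          using A a by (simp add: powr_powr)
        from HY[OF schwartz_integrable[OF \<phi>] _ this] A
        have "(\<integral>\<^sup>+x. ennreal (cmod (fourier \<phi> x) powr b) \<partial>lebesgue) \<le> ennreal ((K * A powr (1 / a)) powr b)"
          by simp
        then have \<phi>b: "(\<integral>\<^sup>+x. ennreal (cmod (fourier \<phi> x) powr b) \<partial>lebesgue) < \<infinity>"
          by (rule le_less_trans) simp
        have "(\<integral>\<^sup>+x. ennreal (cmod (f x * fourier \<phi> x)) \<partial>lebesgue) \<le>
          (\<integral>\<^sup>+x. ennreal (cmod (f x) powr a) + ennreal (cmod (fourier \<phi> x) powr b) \<partial>lebesgue)"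
          using Young_powr[OF norm_ge_zero norm_ge_zero a(1) b]
          by (intro nn_integral_mono) (simp add: norm_mult ennreal_plus[symmetric] del: ennreal_plus)
        also have "\<dots> < \<infinity>" using fin \<phi>b by (subst nn_integral_add) auto
        finally have f\<phi>: "integrable lebesgue (\<lambda>x. f x * fourier \<phi> x)"
          by (intro integrableI_bounded) auto
        have lim1: "(\<lambda>k. LINT x|lebesgue. g k x * fourier \<phi> x) \<longlonglongrightarrow> (LINT x|lebesgue. f x * fourier \<phi> x)"
        proof (rule integral_dominated_convergence[OF _ _ integrable_norm[OF f\<phi>]])
          show "AE x in lebesgue. (\<lambda>k. g k x * fourier \<phi> x) \<longlonglongrightarrow> f x * fourier \<phi> x"
            by (intro AE_I2 tendsto_intros g_lim)
          show "AE x in lebesgue. norm (g k x * fourier \<phi> x) \<le> norm (f x * fourier \<phi> x)" for k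
            by (intro AE_I2) (auto simp: norm_mult intro!: mult_right_mono g_le)
        qed measurable
        have eq: "(LINT x|lebesgue. g k x * fourier \<phi> x) = (LINT x|lebesgue. G k x * \<phi> x)" for k
          unfolding G_def by (rule multiplication_formula[OF g_int schwartz_integrable[OF \<phi>]])
        have lim2: "(\<lambda>k. LINT x|lebesgue. G k x * \<phi> x) \<longlonglongrightarrow> (LINT x|lebesgue. h x * \<phi> x)"
        proof -
          let ?C = "(2 * K) powr b + A"
          have C: "(\<integral>\<^sup>+x. ennreal (cmod (h x * \<phi> x - G k x * \<phi> x)) \<partial>lebesgue) \<le> ennreal (?C * (1/2) ^ k)" for k
          proof -
            have "(\<integral>\<^sup>+x. ennreal (cmod (h x * \<phi> x - G k x * \<phi> x)) \<partial>lebesgue) \<le>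
              (\<integral>\<^sup>+x. ennreal (((1/2) ^ k) powr a) * ennreal (cmod (\<phi> x) powr a) +
                 ennreal ((2 ^ k) powr b) * ennreal (cmod (h x - G k x) powr b) \<partial>lebesgue)"
            proof (rule nn_integral_mono)
              fix x
              \<comment> \<open>The factors (1/2)^k and 2^k cancel in the product but distribute the
                smallness: the rate (1/4)^k of \<open>h - G k\<close> absorbs 2^k, so both terms of
                Young's inequality are of order (1/2)^k.\<close>
              have "cmod (h x * \<phi> x - G k x * \<phi> x) = ((1/2) ^ k * cmod (\<phi> x)) * (2 ^ k * cmod (h x - G k x))"
                by (simp add: left_diff_distrib[symmetric] norm_mult power_divide)
              also have "\<dots> \<le> ((1/2) ^ k * cmod (\<phi> x)) powr a + (2 ^ k * cmod (h x - G k x)) powr b"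
                by (intro Young_powr a b) auto
              finally show "ennreal (cmod (h x * \<phi> x - G k x * \<phi> x)) \<le>
                 ennreal (((1/2) ^ k) powr a) * ennreal (cmod (\<phi> x) powr a) +
                 ennreal ((2 ^ k) powr b) * ennreal (cmod (h x - G k x) powr b)"
                by (simp add: powr_mult ennreal_mult[symmetric] ennreal_plus[symmetric] del: ennreal_plus)
            qed
            also have "\<dots> = ennreal (((1/2) ^ k) powr a) * (\<integral>\<^sup>+x. ennreal (cmod (\<phi> x) powr a) \<partial>lebesgue) +
                 ennreal ((2 ^ k) powr b) * (\<integral>\<^sup>+x. ennreal (cmod (h x - G k x) powr b) \<partial>lebesgue)"
              by (simp add: nn_integral_add nn_integral_cmult)
            also have "\<dots> \<le> ennreal (((1/2) ^ k) powr a) * ennreal A + ennreal ((2 ^ k) powr b) * ennreal ((2 * K * (1/4) ^ k) powr b)"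
              by (intro add_mono mult_left_mono A hG) auto
            also have "\<dots> = ennreal (((1/2) ^ k) powr a * A + (2 ^ k * (2 * K * (1/4) ^ k)) powr b)"
              using A K by (simp add: ennreal_mult[symmetric] ennreal_plus[symmetric] powr_mult del: ennreal_plus)
            also have "2 ^ k * (2 * K * (1/4) ^ k) = 2 * K * ((1/2) ^ k :: real)"
              by (simp add: power_divide power_mult_distrib[symmetric] field_simps)
            also have "ennreal (((1/2) ^ k) powr a * A + (2 * K * ((1/2) ^ k)) powr b) \<le> ennreal (?C * (1/2) ^ k)"
            proof (rule ennreal_leI)
              have le: "((1/2) ^ k) powr c \<le> ((1/2) ^ k :: real)" if "1 \<le> c" for c
                using powr_mono'[OF that, of "(1/2) ^ k"] by (auto simp: power_le_one)
              have "((1/2) ^ k) powr a * A \<le> (1/2) ^ k * A"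
                using A a by (intro mult_right_mono le) auto
              moreover have "(2 * K * ((1/2) ^ k)) powr b \<le> (2 * K) powr b * (1/2) ^ k"
                using K b2 by (subst powr_mult) (auto intro!: mult_left_mono le)
              ultimately show "((1/2) ^ k) powr a * A + (2 * K * ((1/2) ^ k)) powr b \<le> ?C * (1/2) ^ k"
                by (simp add: algebra_simps)
            qed
            finally show ?thesis .
          qed
          have d_int: "integrable lebesgue (\<lambda>x. h x * \<phi> x - G k x * \<phi> x)" for k
            by (intro integrableI_bounded le_less_trans[OF C[of k]]) auto
          have G\<phi>_int: "integrable lebesgue (\<lambda>x. G k x * \<phi> x)" for k
            by (rule Bochner_Integration.integrable_bound[OF integrable_mult_right[OF integrable_norm[OF schwartz_integrable[OF \<phi>]], of "LINT x|lebesgue. cmod (g k x)"]])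
              (auto simp: G_def norm_mult intro!: mult_right_mono norm_fourier_le AE_I2)
          have h\<phi>_int: "integrable lebesgue (\<lambda>x. h x * \<phi> x)"
            using Bochner_Integration.integrable_add[OF d_int[of 0] G\<phi>_int[of 0]] by simp
          have "cmod ((LINT x|lebesgue. G k x * \<phi> x) - (LINT x|lebesgue. h x * \<phi> x)) \<le> ?C * (1/2) ^ k" for k
          proof -
            have "ennreal (cmod (LINT x|lebesgue. h x * \<phi> x - G k x * \<phi> x)) \<le> ennreal (?C * (1/2) ^ k)"
              by (rule order_trans[OF integral_norm_bound_ennreal[OF d_int] C])
            then have "cmod (LINT x|lebesgue. h x * \<phi> x - G k x * \<phi> x) \<le> ?C * (1/2) ^ k"
              using A by (simp add: ennreal_le_iff)
            then show ?thesis
              using h\<phi>_int G\<phi>_int by (simp add: norm_minus_commute)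
          qed
          then have "\<forall>\<^sub>F k in sequentially. norm ((LINT x|lebesgue. G k x * \<phi> x) - (LINT x|lebesgue. h x * \<phi> x)) \<le> ?C * (1/2) ^ k"
            by (intro always_eventually allI)
          moreover have "(\<lambda>k. ?C * (1/2) ^ k) \<longlonglongrightarrow> 0"
            by (intro tendsto_mult_right_zero LIMSEQ_realpow_zero) auto
          ultimately show ?thesis
            by (rule LIM_zero_cancel[OF Lim_null_comparison])
        qed
        from lim1[unfolded eq] lim2 show "(LINT x|lebesgue. f x * fourier \<phi> x) = (LINT x|lebesgue. h x * \<phi> x)"
          by (rule LIMSEQ_unique)
      qed
    qed
  qed
qed


section \<open>Modulars and embeddings of variable Lebesgue spaces\<close>

text \<open>A supremum in \<open>ennreal\<close> is reached along a sequence of lower bounds, so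
  that only countably many null sets have to be united.\<close>

lemma essinf_AE: "AE x in M. essinf M f \<le> f x"
proof -
  let ?A = "{z. AE x in M. z \<le> f x}"
  have "?A \<noteq> {}" by (auto intro: exI[of _ 0])
  then obtain z :: "nat \<Rightarrow> ennreal" where z: "range z \<subseteq> ?A" "Sup ?A = (SUP n. z n)"
    using ennreal_Sup_countable_SUP[of ?A] by auto
  have "AE x in M. \<forall>n. z n \<le> f x"
    using z(1) by (subst AE_all_countable) auto
  then show ?thesis
    unfolding essinf_eq_AE z(2) by eventually_elim (auto intro: SUP_least)
qed

lemma le_essinfI: "AE x in M. z \<le> f x \<Longrightarrow> z \<le> essinf M f"
  unfolding essinf_eq_AE by (auto intro: Sup_upper)

lemma exponents_measurable: "p \<in> exponents \<Longrightarrow> p \<in> borel_measurable lebesgue"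
  by (simp add: exponents_def)

lemma exponents_ge_1: "p \<in> exponents \<Longrightarrow> 1 \<le> p x"
  by (simp add: exponents_def)

lemma sets_level:
  assumes "p \<in> borel_measurable lebesgue"
  shows "{x. p x = c} \<in> sets lebesgue" "{x. p x \<noteq> (c::ennreal)} \<in> sets lebesgue"
proof -
  note [measurable] = assms
  show "{x. p x = c} \<in> sets lebesgue" "{x. p x \<noteq> c} \<in> sets lebesgue"
    by (intro sets_lebesgue_Collect; measurable)+
qed

lemma AE_lebesgue_on_iff:
  assumes "S \<in> sets lebesgue"
  shows "(AE x in lebesgue_on S. P x) \<longleftrightarrow> (AE x in lebesgue. x \<in> S \<longrightarrow> P x)"
  using assms by (subst AE_restrict_space_iff) auto

text \<open>Together with \<open>modular_upper\<close> this replaces the essential supremum over the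
  set of infinite exponents by almost everywhere statements on the whole line.\<close>

lemma modular_lower:
  assumes "p \<in> borel_measurable lebesgue" "f \<in> borel_measurable lebesgue"
  shows "(\<integral>\<^sup>+x\<in>{x. p x \<noteq> \<infinity>}. ennreal (cmod (f x) powr enn2real (p x)) \<partial>lebesgue) \<le> modular p f"
    and "AE x in lebesgue. p x = \<infinity> \<longrightarrow> ennreal (cmod (f x)) \<le> modular p f"
proof -
  show "(\<integral>\<^sup>+x\<in>{x. p x \<noteq> \<infinity>}. ennreal (cmod (f x) powr enn2real (p x)) \<partial>lebesgue) \<le> modular p f"
    unfolding modular_def by simp
  have "AE x in lebesgue_on {x. p x = \<infinity>}. ennreal (cmod (f x)) \<le> modular p f"
    using esssup_AE[where M = "lebesgue_on {x. p x = \<infinity>}" and f = "\<lambda>x. ennreal (cmod (f x))"]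
    unfolding modular_def by eventually_elim (simp add: add_increasing)
  then show "AE x in lebesgue. p x = \<infinity> \<longrightarrow> ennreal (cmod (f x)) \<le> modular p f"
    using AE_lebesgue_on_iff[OF sets_level(1)[OF assms(1)]] by simp
qed

lemma modular_upper:
  assumes "p \<in> borel_measurable lebesgue" "f \<in> borel_measurable lebesgue"
    and "(\<integral>\<^sup>+x\<in>{x. p x \<noteq> \<infinity>}. ennreal (cmod (f x) powr enn2real (p x)) \<partial>lebesgue) \<le> A"
    and "AE x in lebesgue. p x = \<infinity> \<longrightarrow> ennreal (cmod (f x)) \<le> B"
  shows "modular p f \<le> A + B"
proof -
  note [measurable] = assms(2)
  have "esssup (lebesgue_on {x. p x = \<infinity>}) (\<lambda>x. ennreal (cmod (f x))) \<le> B"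
  proof (rule esssup_I)
    show "(\<lambda>x. ennreal (cmod (f x))) \<in> borel_measurable (lebesgue_on {x. p x = \<infinity>})"
      by (intro measurable_restrict_space1) measurable
    show "AE x in lebesgue_on {x. p x = \<infinity>}. ennreal (cmod (f x)) \<le> B"
      using AE_lebesgue_on_iff[OF sets_level(1)[OF assms(1)]] assms(4) by simp
  qed
  with assms(3) show ?thesis unfolding modular_def by (rule add_mono)
qed

text \<open>As c and p are at least 1, (1 / c)^p <= 1 / c. This consequence of convexity makes the
  modular monotone in the scaling and brings a finite modular below 1.\<close>

lemma modular_scale:
  assumes p: "p \<in> borel_measurable lebesgue" "\<And>x. 1 \<le> p x" and f: "f \<in> borel_measurable lebesgue" and c: "1 \<le> c"
  shows "modular p (\<lambda>x. f x / of_real c) \<le> ennreal (1 / c) * modular p f"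
proof -
  note [measurable] = f p(1)
  let ?I = "\<lambda>f. \<integral>\<^sup>+x\<in>{x. p x \<noteq> \<infinity>}. ennreal (cmod (f x) powr enn2real (p x)) \<partial>lebesgue"
  let ?E = "esssup (lebesgue_on {x. p x = \<infinity>}) (\<lambda>x. ennreal (cmod (f x)))"
  have "modular p (\<lambda>x. f x / of_real c) \<le> ennreal (1 / c) * ?I f + ennreal (1 / c) * ?E"
  proof (rule modular_upper)
    have "?I (\<lambda>x. f x / of_real c) \<le> (\<integral>\<^sup>+x. ennreal (1 / c) * (ennreal (cmod (f x) powr enn2real (p x)) * indicator {x. p x \<noteq> \<infinity>} x) \<partial>lebesgue)"
    proof (intro nn_integral_mono)
      fix x
      show "ennreal (cmod (f x / of_real c) powr enn2real (p x)) * indicator {x. p x \<noteq> \<infinity>} x \<le>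
        ennreal (1 / c) * (ennreal (cmod (f x) powr enn2real (p x)) * indicator {x. p x \<noteq> \<infinity>} x)"
      proof (cases "p x = \<infinity>")
        case False
        then have "1 \<le> enn2real (p x)"
          using p(2)[of x] by (cases "p x") auto
        then have "(1 / c) powr enn2real (p x) \<le> (1 / c) powr 1"
          using c by (intro powr_mono') auto
        moreover have "cmod (f x / of_real c) powr enn2real (p x) = (1 / c) powr enn2real (p x) * cmod (f x) powr enn2real (p x)"
          using c by (subst powr_mult[symmetric]) (auto simp: norm_divide)
        ultimately have "cmod (f x / of_real c) powr enn2real (p x) \<le> 1 / c * cmod (f x) powr enn2real (p x)"
          using c by (simp only: powr_one) (intro mult_right_mono, auto)
        then show ?thesis using c False
          by (auto simp: ennreal_mult[symmetric] intro!: ennreal_leI)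
      qed simp
    qed
    also have "\<dots> = ennreal (1 / c) * ?I f"
      by (rule nn_integral_cmult) measurable
    finally show "?I (\<lambda>x. f x / of_real c) \<le> ennreal (1 / c) * ?I f" .
    have "AE x in lebesgue_on {x. p x = \<infinity>}. ennreal (cmod (f x / of_real c)) \<le> ennreal (1 / c) * ?E"
      using esssup_AE[where M = "lebesgue_on {x. p x = \<infinity>}" and f = "\<lambda>x. ennreal (cmod (f x))"]
    proof eventually_elim
      case (elim x)
      then have "ennreal (1 / c) * ennreal (cmod (f x)) \<le> ennreal (1 / c) * ?E"
        by (rule mult_left_mono) simp
      then show ?case using c by (simp add: ennreal_mult[symmetric] norm_divide)
    qed
    then show "AE x in lebesgue. p x = \<infinity> \<longrightarrow> ennreal (cmod (f x / of_real c)) \<le> ennreal (1 / c) * ?E"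
      using AE_lebesgue_on_iff[OF sets_level(1)[OF p(1)]] by simp
  qed measurable
  then show ?thesis by (simp add: modular_def distrib_left)
qed

lemma modular_scale_le:
  assumes "p \<in> exponents" "f \<in> borel_measurable lebesgue" "0 < l" "l \<le> m"
  shows "modular p (\<lambda>x. f x / of_real m) \<le> modular p (\<lambda>x. f x / of_real l)"
proof -
  note [measurable] = assms(2)
  have "modular p (\<lambda>x. f x / of_real l / of_real (m / l)) \<le> ennreal (1 / (m / l)) * modular p (\<lambda>x. f x / of_real l)"
    using assms by (intro modular_scale exponents_measurable exponents_ge_1) auto
  also have "\<dots> \<le> ennreal 1 * modular p (\<lambda>x. f x / of_real l)"
    using assms by (intro mult_right_mono ennreal_leI) auto
  finally show ?thesis using assms by simp
qed

lemma var_Lebesgue_measurable: "f \<in> var_Lebesgue p \<Longrightarrow> f \<in> borel_measurable lebesgue"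
  by (simp add: var_Lebesgue_def)

text \<open>Membership in the space asks only for a finite modular; dividing by a further factor max
  1 N brings it down to 1. Thus the infimum in \<open>var_norm\<close> is over a nonempty
  set.\<close>

lemma var_norm_set_nonempty:
  assumes p: "p \<in> exponents" and f: "f \<in> var_Lebesgue p"
  obtains l where "0 < l" "modular p (\<lambda>x. f x / of_real l) \<le> 1"
proof -
  note [measurable] = var_Lebesgue_measurable[OF f]
  obtain l where l: "0 < l" "modular p (\<lambda>x. f x / of_real l) < \<infinity>"
    using f by (auto simp: var_Lebesgue_def)
  then obtain N where N: "modular p (\<lambda>x. f x / of_real l) = ennreal N" "0 \<le> N"
    by (cases "modular p (\<lambda>x. f x / of_real l)") auto
  define c where "c = max 1 N"
  have c: "1 \<le> c" "N \<le> c" by (auto simp: c_def)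
  have "modular p (\<lambda>x. f x / of_real l / of_real c) \<le> ennreal (1 / c) * modular p (\<lambda>x. f x / of_real l)"
    using p c by (intro modular_scale exponents_measurable exponents_ge_1) auto
  also have "\<dots> = ennreal (N / c)" using N c by (simp add: ennreal_mult[symmetric])
  also have "\<dots> \<le> 1" using c by (simp add: ennreal_le_1)
  finally show ?thesis using l c by (intro that[of "l * c"]) auto
qed

lemma var_norm_le:
  "0 < l \<Longrightarrow> modular p (\<lambda>x. f x / of_real l) \<le> 1 \<Longrightarrow> var_norm p f \<le> l"
  unfolding var_norm_def by (rule cInf_lower) (auto intro: bdd_belowI[of _ 0])

lemma var_norm_nonneg:
  assumes "p \<in> exponents" "f \<in> var_Lebesgue p"
  shows "0 \<le> var_norm p f"
  unfolding var_norm_def using var_norm_set_nonempty[OF assms] by (intro cInf_greatest) auto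

text \<open>The strict inequality avoids the question whether the infimum is attained; in
  applications \<open>l\<close> decreases to the norm or a factor 2 is given away.\<close>

lemma modular_le_1:
  assumes p: "p \<in> exponents" and f: "f \<in> var_Lebesgue p" and l: "var_norm p f < l"
  shows "modular p (\<lambda>x. f x / of_real l) \<le> 1"
proof -
  let ?S = "{l::real. 0 < l \<and> modular p (\<lambda>x. f x / of_real l) \<le> 1}"
  have "?S \<noteq> {}" using var_norm_set_nonempty[OF p f] by blast
  from cInf_lessD[OF this l[unfolded var_norm_def]]
  obtain k where "0 < k" "modular p (\<lambda>x. f x / of_real k) \<le> 1" "k < l" by auto
  then show ?thesis
    using modular_scale_le[OF p var_Lebesgue_measurable[OF f], of k l] by auto
qed

section \<open>Embeddings governed by defect exponents\<close>

lemma inverse_ennreal_diff: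
  assumes "1 \<le> a" "a \<le> b"
  shows "inverse (ennreal a) - inverse (ennreal b) = ennreal (1 / a - 1 / b)"
  using assms by (simp add: inverse_ennreal ennreal_minus divide_inverse)

text \<open>Young's inequality with the conjugate exponents s / Q and P / Q, applied to k^Q and u^Q.
  Two degenerate cases remain: P infinite, where s = Q and u <= 1 suffices, and P = Q, where s is
  infinite and k <= 1 suffices. The conditional factors mirror the domain of the integral in the
  modular.\<close>

lemma defect_exponent_Young:
  assumes k: "0 < k" "k \<le> 1" and u: "0 \<le> u" and Q: "1 \<le> Q" "Q \<noteq> \<infinity>" and P: "Q \<le> P" and uP: "P = \<infinity> \<Longrightarrow> u \<le> 1"
  defines "s \<equiv> defect_exponent Q P"
  shows "ennreal ((k * u) powr enn2real Q) \<le>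
    ennreal (k powr enn2real s) * (if s \<noteq> \<infinity> then 1 else 0) + ennreal (u powr enn2real P) * (if P \<noteq> \<infinity> then 1 else 0)"
proof -
  obtain a where a: "Q = ennreal a" "1 \<le> a"
    using Q by (cases Q) (auto simp: ennreal_ge_1)
  show ?thesis
  proof (cases P)
    case top
    then have "s = Q" using a by (simp add: s_def defect_exponent_def inverse_ennreal)
    moreover have "(k * u) powr a \<le> (k * 1) powr a"
      using k u uP top a by (intro powr_mono2 mult_left_mono) auto
    ultimately show ?thesis using top a by (simp add: ennreal_leI)
  next
    case (real b)
    then have ab: "a \<le> b" using P a by simp
    show ?thesis
    proof (cases "a = b")
      case True
      have "(k * u) powr a \<le> u powr a"
        using k u a by (intro powr_mono2 mult_left_le_one_le) auto
      then show ?thesis using True real a by (simp add: add_increasing ennreal_leI)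
    next
      case False
      with ab have ab: "a < b" by simp
      define r where "r = a * b / (b - a)"
      have r: "0 < r" "1 / a - 1 / b = 1 / r"
        using ab a by (auto simp: r_def field_simps)
      then have s: "s = ennreal r"
        unfolding s_def defect_exponent_def a real(2)
        using ab a r by (subst inverse_ennreal_diff) (auto simp only: r(2), auto simp: inverse_ennreal)
      have A: "1 < r / a" "b / a = (r / a) / (r / a - 1)"
        using ab a by (auto simp: r_def field_simps)
      have "(k * u) powr a = k powr a * u powr a" using k u by (simp add: powr_mult)
      also have "\<dots> \<le> (k powr a) powr (r / a) + (u powr a) powr (b / a)"
        by (rule Young_powr[OF _ _ A]) auto
      also have "\<dots> = k powr r + u powr b"
        using a by (simp add: powr_powr)
      finally show ?thesis
        using a real s r by (simp add: ennreal_plus[symmetric] ennreal_leI del: ennreal_plus)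
    qed
  qed
qed

text \<open>The pointwise inequality \<open>defect_exponent_Young\<close>, integrated; its first
  term has a finite integral precisely because the constant 1 lies in the defect space. It serves
  both for passing from p to the constant p_- and for passing from its conjugate to q.\<close>

lemma var_Lebesgue_embedding:
  assumes P: "P \<in> exponents" and Q: "Q \<in> exponents" and le: "AE x in lebesgue. Q x \<le> P x"
    and one: "(\<lambda>_. 1) \<in> var_Lebesgue (\<lambda>x. defect_exponent (Q x) (P x))"
  obtains D where "0 < D" "\<And>g. g \<in> borel_measurable lebesgue \<Longrightarrow> modular P g \<le> 1 \<Longrightarrow> modular Q (\<lambda>x. g x / of_real D) \<le> 1"
proof -
  define s where "s x = defect_exponent (Q x) (P x)" for x
  note [measurable] = exponents_measurable[OF P] exponents_measurable[OF Q]
  have s_meas [measurable]: "s \<in> borel_measurable lebesgue"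
    unfolding s_def[abs_def] defect_exponent_def by measurable
  obtain l where l: "0 < l" "modular s (\<lambda>x. 1 / of_real l) < \<infinity>"
    using one by (auto simp: var_Lebesgue_def s_def[abs_def])
  \<comment> \<open>At most 1 / l, for a finite modular with respect to the defect exponent, and at
    most 1, as \<open>defect_exponent_Young\<close> demands.\<close>
  define k where "k = min 1 (1 / l)"
  have k: "0 < k" "k \<le> 1" "k \<le> 1 / l" using l by (auto simp: k_def)
  have "(\<integral>\<^sup>+x\<in>{x. s x \<noteq> \<infinity>}. ennreal (k powr enn2real (s x)) \<partial>lebesgue) \<le>
      (\<integral>\<^sup>+x\<in>{x. s x \<noteq> \<infinity>}. ennreal (cmod (1 / of_real l) powr enn2real (s x)) \<partial>lebesgue)"
    using k l by (intro nn_integral_mono mult_right_mono ennreal_leI powr_mono2) (auto simp: norm_divide)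
  also have "\<dots> \<le> modular s (\<lambda>x. 1 / of_real l)"
    by (rule modular_lower) measurable
  finally have "(\<integral>\<^sup>+x\<in>{x. s x \<noteq> \<infinity>}. ennreal (k powr enn2real (s x)) \<partial>lebesgue) < \<infinity>"
    using l by (auto intro: le_less_trans)
  then obtain M where M: "0 \<le> M" "(\<integral>\<^sup>+x\<in>{x. s x \<noteq> \<infinity>}. ennreal (k powr enn2real (s x)) \<partial>lebesgue) = ennreal M"
    by (cases "\<integral>\<^sup>+x\<in>{x. s x \<noteq> \<infinity>}. ennreal (k powr enn2real (s x)) \<partial>lebesgue") auto
  \<comment> \<open>Where \<open>Q\<close> is finite the integral is at most M + 1: M from the
    defect exponent, 1 from the modular of \<open>g\<close>. Where \<open>Q\<close> is infinite the
    supremum adds another 1.\<close>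
  let ?C = "M + 2"
  show ?thesis
  proof
    show "0 < ?C / k" using M k by simp
    fix g assume g [measurable]: "g \<in> borel_measurable lebesgue" and g1: "modular P g \<le> 1"
    have sup: "AE x in lebesgue. P x = \<infinity> \<longrightarrow> cmod (g x) \<le> 1"
      using modular_lower(2)[OF exponents_measurable[OF P] g]
      by eventually_elim (use g1 in \<open>auto simp: ennreal_le_1 dest: order_trans[OF _ g1]\<close>)
    have "modular Q (\<lambda>x. of_real k * g x) \<le> ennreal (M + 1) + 1"
    proof (rule modular_upper)
      have "(\<integral>\<^sup>+x\<in>{x. Q x \<noteq> \<infinity>}. ennreal (cmod (of_real k * g x) powr enn2real (Q x)) \<partial>lebesgue) \<le>
        (\<integral>\<^sup>+x. ennreal (k powr enn2real (s x)) * indicator {x. s x \<noteq> \<infinity>} x +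
          ennreal (cmod (g x) powr enn2real (P x)) * indicator {x. P x \<noteq> \<infinity>} x \<partial>lebesgue)"
      proof (rule nn_integral_mono_AE)
        show "AE x in lebesgue. ennreal (cmod (of_real k * g x) powr enn2real (Q x)) * indicator {x. Q x \<noteq> \<infinity>} x \<le>
          ennreal (k powr enn2real (s x)) * indicator {x. s x \<noteq> \<infinity>} x +
          ennreal (cmod (g x) powr enn2real (P x)) * indicator {x. P x \<noteq> \<infinity>} x"
          using sup le
        proof eventually_elim
          case (elim x)
          show ?case
          proof (cases "Q x = \<infinity>")
            case False
            from defect_exponent_Young[OF k(1,2) norm_ge_zero exponents_ge_1[OF Q] False elim(2), of "g x"] elim(1)
            show ?thesis using False k by (simp add: norm_mult s_def indicator_def of_bool_def)
          qed simp
        qed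
      qed
      also have "\<dots> = (\<integral>\<^sup>+x\<in>{x. s x \<noteq> \<infinity>}. ennreal (k powr enn2real (s x)) \<partial>lebesgue) +
          (\<integral>\<^sup>+x\<in>{x. P x \<noteq> \<infinity>}. ennreal (cmod (g x) powr enn2real (P x)) \<partial>lebesgue)"
        by (rule nn_integral_add) measurable
      also have "\<dots> \<le> ennreal M + 1"
        unfolding M by (intro add_mono order_refl order_trans[OF modular_lower(1) g1]) auto
      also have "\<dots> = ennreal (M + 1)" using M by simp
      finally show "(\<integral>\<^sup>+x\<in>{x. Q x \<noteq> \<infinity>}. ennreal (cmod (of_real k * g x) powr enn2real (Q x)) \<partial>lebesgue) \<le> ennreal (M + 1)" .
      show "AE x in lebesgue. Q x = \<infinity> \<longrightarrow> ennreal (cmod (of_real k * g x)) \<le> 1"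
        using sup le
      proof eventually_elim
        case (elim x)
        show ?case
        proof
          assume "Q x = \<infinity>"
          \<comment> \<open>Here only the supremum part of the modular of \<open>g\<close> can help,
            and Q <= P puts such points under its control.\<close>
          then have "P x = \<infinity>" using elim(2) by (simp add: top.extremum_unique)
          then have "k * cmod (g x) \<le> 1 * 1" using elim(1) k by (intro mult_mono) auto
          then show "ennreal (cmod (of_real k * g x)) \<le> 1" using k by (simp add: norm_mult ennreal_le_1)
        qed
      qed
    qed measurable
    also have "ennreal (M + 1) + 1 = ennreal ?C"
      using M ennreal_plus[of "M + 1" 1] by (simp add: add.commute del: ennreal_plus)
    finally have le: "modular Q (\<lambda>x. of_real k * g x) \<le> ennreal ?C" .
    have "modular Q (\<lambda>x. of_real k * g x / of_real ?C) \<le> ennreal (1 / ?C) * modular Q (\<lambda>x. of_real k * g x)"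
      using Q M by (intro modular_scale exponents_measurable exponents_ge_1) auto
    also have "\<dots> \<le> ennreal (1 / ?C) * ennreal ?C"
      by (intro mult_left_mono le) simp
    also have "\<dots> = 1" using M by (subst ennreal_mult[symmetric]) auto
    finally show "modular Q (\<lambda>x. g x / of_real (?C / k)) \<le> 1"
      by (simp add: mult.commute)
  qed
qed


section \<open>Sufficiency\<close>

lemma conj_exponent_ennreal:
  assumes "1 < a"
  shows "conj_exponent (ennreal a) = ennreal (a / (a - 1))"
proof -
  have "1 - inverse (ennreal a) = ennreal (1 - 1 / a)"
    using assms ennreal_minus[of "1 / a" 1] by (simp add: inverse_ennreal divide_inverse)
  moreover have "0 < 1 - 1 / a" using assms by simp
  ultimately have "conj_exponent (ennreal a) = ennreal (inverse (1 - 1 / a))"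
    by (simp add: conj_exponent_def inverse_ennreal)
  also have "inverse (1 - 1 / a) = a / (a - 1)"
    using assms by (simp add: field_simps)
  finally show ?thesis .
qed

lemma conj_exponent_1: "conj_exponent 1 = \<infinity>"
  by (simp add: conj_exponent_def)

lemma conj_exponent_ge_1: "1 \<le> a \<Longrightarrow> 1 \<le> conj_exponent a"
proof (cases "a")
  case (real r)
  assume "1 \<le> a"
  with real have "1 \<le> r" by (simp add: ennreal_ge_1)
  then show ?thesis
  proof (cases "r = 1")
    case False
    with \<open>1 \<le> r\<close> have "1 < r" "1 \<le> r / (r - 1)" by (auto simp: field_simps)
    then show ?thesis using real by (simp add: conj_exponent_ennreal ennreal_ge_1)
  qed (use real in \<open>simp add: conj_exponent_1\<close>)
qed (simp add: conj_exponent_def)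

lemma modular_const_ennreal:
  assumes "0 \<le> a" "f \<in> borel_measurable lebesgue"
  shows "modular (\<lambda>_. ennreal a) f = (\<integral>\<^sup>+x. ennreal (cmod (f x) powr a) \<partial>lebesgue)"
proof (rule antisym)
  show "modular (\<lambda>_. ennreal a) f \<le> (\<integral>\<^sup>+x. ennreal (cmod (f x) powr a) \<partial>lebesgue)"
    using modular_upper[of "\<lambda>_. ennreal a" f _ 0] assms by simp
  show "(\<integral>\<^sup>+x. ennreal (cmod (f x) powr a) \<partial>lebesgue) \<le> modular (\<lambda>_. ennreal a) f"
    using modular_lower(1)[of "\<lambda>_. ennreal a" f] assms by simp
qed

lemma nn_integral_powr_scale:
  assumes "0 < N" and [measurable]: "f \<in> borel_measurable lebesgue"
  shows "(\<integral>\<^sup>+x. ennreal (cmod (f x / of_real N) powr a) \<partial>lebesgue) \<le> 1 \<longleftrightarrow>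
    (\<integral>\<^sup>+x. ennreal (cmod (f x) powr a) \<partial>lebesgue) \<le> ennreal (N powr a)" (is "?L \<le> 1 \<longleftrightarrow> ?R \<le> _")
proof -
  have "?R = (\<integral>\<^sup>+x. ennreal (N powr a) * ennreal (cmod (f x / of_real N) powr a) \<partial>lebesgue)"
    using assms by (intro nn_integral_cong) (auto simp: norm_divide powr_divide ennreal_mult[symmetric])
  also have "\<dots> = ennreal (N powr a) * ?L"
    by (rule nn_integral_cmult) measurable
  finally have "?R \<le> ennreal (N powr a) \<longleftrightarrow> ennreal (N powr a) * ?L \<le> ennreal (N powr a) * 1" by simp
  also have "\<dots> \<longleftrightarrow> ?L \<le> 1"
    using assms by (intro ennreal_mult_le_mult_iff) (auto simp: less_imp_neq)
  finally show ?thesis ..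
qed

text \<open>Puts the endpoint 1, whose conjugate is infinite, and the other exponents into one
  modular form. The outer \<open>N\<close> only certifies that \<open>f\<close> lies in the space;
  the inner quantifier lets every admissible bound use the same \<open>h\<close>.\<close>

lemma hausdorff_young_modular:
  assumes a: "1 \<le> \<alpha>" "\<alpha> \<le> 2"
  obtains K where "0 < K"
    "\<And>f N. f \<in> borel_measurable lebesgue \<Longrightarrow> 0 < N \<Longrightarrow> modular (\<lambda>_. \<alpha>) (\<lambda>x. f x / of_real N) \<le> 1 \<Longrightarrow>
      \<exists>h\<in>borel_measurable lebesgue. represented_by (fourier_distr (distr_of_fun f)) h \<and>
        (\<forall>N>0. modular (\<lambda>_. \<alpha>) (\<lambda>x. f x / of_real N) \<le> 1 \<longrightarrow>
          modular (\<lambda>_. conj_exponent \<alpha>) (\<lambda>x. h x / of_real (K * N)) \<le> 1)"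
proof -
  have "\<alpha> \<noteq> \<infinity>" using a by (auto simp: top_unique)
  then obtain r where r: "\<alpha> = ennreal r" "0 \<le> r" by (cases \<alpha>) auto
  then have r12: "1 \<le> r" "r \<le> 2"
    using a by (auto simp: ennreal_ge_1 ennreal_le_iff[of 2 r, simplified])
  show ?thesis
  proof (cases "r = 1")
    case True
    show ?thesis
    proof (rule that[of 1])
      fix f :: "real \<Rightarrow> complex" and N :: real
      assume f: "f \<in> borel_measurable lebesgue" and N: "0 < N" and m: "modular (\<lambda>_. \<alpha>) (\<lambda>x. f x / of_real N) \<le> 1"
      note [measurable] = f
      have eq: "modular (\<lambda>_. \<alpha>) (\<lambda>x. f x / of_real N) \<le> 1 \<longleftrightarrow> (\<integral>\<^sup>+x. ennreal (cmod (f x)) \<partial>lebesgue) \<le> ennreal N"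
        if "0 < N" for N
        using nn_integral_powr_scale[OF that f, of 1] that unfolding r True
        by (subst modular_const_ennreal) auto
      have "represented_by (fourier_distr (distr_of_fun f)) (fourier f)"
        using f m N by (intro hausdorff_young_1) (auto simp: eq intro: le_less_trans)
      moreover have "modular (\<lambda>_. conj_exponent \<alpha>) (\<lambda>x. fourier f x / of_real (1 * N)) \<le> 1"
        if "0 < N" "modular (\<lambda>_. \<alpha>) (\<lambda>x. f x / of_real N) \<le> 1" for N
      proof -
        have "cmod (fourier f x) \<le> N" for x
          using order_trans[OF ennreal_norm_fourier_le[OF f] that(2)[unfolded eq[OF that(1)]], of x] that(1)
          by simp
        then have "modular (\<lambda>_. \<infinity>) (\<lambda>x. fourier f x / of_real N) \<le> 0 + 1"
          using that(1) by (intro modular_upper) (auto simp: norm_divide ennreal_le_1)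
        then show ?thesis by (simp add: r True conj_exponent_1)
      qed
      ultimately show "\<exists>h\<in>borel_measurable lebesgue. represented_by (fourier_distr (distr_of_fun f)) h \<and>
        (\<forall>N>0. modular (\<lambda>_. \<alpha>) (\<lambda>x. f x / of_real N) \<le> 1 \<longrightarrow>
          modular (\<lambda>_. conj_exponent \<alpha>) (\<lambda>x. h x / of_real (1 * N)) \<le> 1)"
        by (intro bexI[of _ "fourier f"]) auto
    qed simp
  next
    case False
    then have r1: "1 < r" using r12 by simp
    define b where "b = r / (r - 1)"
    have b: "0 < b" "conj_exponent \<alpha> = ennreal b"
      using r1 by (auto simp: b_def r conj_exponent_ennreal)
    obtain K where K: "0 < K" and HY: "\<And>f :: real \<Rightarrow> complex. f \<in> borel_measurable lebesgue \<Longrightarrow> (\<integral>\<^sup>+x. ennreal (cmod (f x) powr r) \<partial>lebesgue) < \<infinity> \<Longrightarrow>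
      \<exists>h\<in>borel_measurable lebesgue. represented_by (fourier_distr (distr_of_fun f)) h \<and>
        (\<forall>N>0. (\<integral>\<^sup>+x. ennreal (cmod (f x) powr r) \<partial>lebesgue) \<le> ennreal (N powr r) \<longrightarrow>
          (\<integral>\<^sup>+\<xi>. ennreal (cmod (h \<xi>) powr b) \<partial>lebesgue) \<le> ennreal ((K * N) powr b))"
      by (rule hausdorff_young[OF r1 r12(2) b_def]) (rule that)
    show ?thesis
    proof (rule that[OF K])
      fix f :: "real \<Rightarrow> complex" and N :: real
      assume f: "f \<in> borel_measurable lebesgue" and N: "0 < N" and m: "modular (\<lambda>_. \<alpha>) (\<lambda>x. f x / of_real N) \<le> 1"
      have eq: "modular (\<lambda>_. ennreal c) (\<lambda>x. g x / of_real N) \<le> 1 \<longleftrightarrow> (\<integral>\<^sup>+x. ennreal (cmod (g x) powr c) \<partial>lebesgue) \<le> ennreal (N powr c)"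
        if "0 < N" "g \<in> borel_measurable lebesgue" "0 < c" for N g c
        using that nn_integral_powr_scale[OF that(1,2), of c]
        by (subst modular_const_ennreal) auto
      from m eq[OF N f, of r] r1 have "(\<integral>\<^sup>+x. ennreal (cmod (f x) powr r) \<partial>lebesgue) < \<infinity>"
        by (auto simp: r intro: le_less_trans)
      from HY[OF f this] obtain h where h: "h \<in> borel_measurable lebesgue"
        "represented_by (fourier_distr (distr_of_fun f)) h"
        "\<And>N. 0 < N \<Longrightarrow> (\<integral>\<^sup>+x. ennreal (cmod (f x) powr r) \<partial>lebesgue) \<le> ennreal (N powr r) \<Longrightarrow>
          (\<integral>\<^sup>+\<xi>. ennreal (cmod (h \<xi>) powr b) \<partial>lebesgue) \<le> ennreal ((K * N) powr b)" by auto
      have "modular (\<lambda>_. conj_exponent \<alpha>) (\<lambda>x. h x / of_real (K * N)) \<le> 1"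
        if N: "0 < N" and le: "modular (\<lambda>_. \<alpha>) (\<lambda>x. f x / of_real N) \<le> 1" for N
      proof -
        have "(\<integral>\<^sup>+x. ennreal (cmod (f x) powr r) \<partial>lebesgue) \<le> ennreal (N powr r)"
          using le eq[OF N f, of r] r1 by (simp add: r(1))
        from h(3)[OF N this] show ?thesis
          unfolding b(2) using eq[OF mult_pos_pos[OF K N] h(1) b(1)] by simp
      qed
      with h(1,2) show "\<exists>h\<in>borel_measurable lebesgue. represented_by (fourier_distr (distr_of_fun f)) h \<and>
        (\<forall>N>0. modular (\<lambda>_. \<alpha>) (\<lambda>x. f x / of_real N) \<le> 1 \<longrightarrow>
          modular (\<lambda>_. conj_exponent \<alpha>) (\<lambda>x. h x / of_real (K * N)) \<le> 1)"
        by blast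
    qed
  qed
qed

text \<open>The constants of the two embeddings, D and E, and of Hausdorff--Young, K, multiply along
  the chain from p to p_-, to its conjugate, to q.\<close>

theorem fourier_bounded_sufficient:
  assumes p: "p \<in> exponents" and q: "q \<in> exponents"
    and p2: "essinf lebesgue p \<le> 2" and qp: "esssup lebesgue q \<le> conj_exponent (essinf lebesgue p)"
    and r: "(\<lambda>_. 1) \<in> var_Lebesgue (\<lambda>x. defect_exponent (essinf lebesgue p) (p x))"
    and s: "(\<lambda>_. 1) \<in> var_Lebesgue (\<lambda>x. defect_exponent (q x) (conj_exponent (essinf lebesgue p)))"
  shows "fourier_bounded p q"
proof -
  define \<alpha> where "\<alpha> = essinf lebesgue p"
  have \<alpha>: "1 \<le> \<alpha>" "\<alpha> \<le> 2"
    using p2 exponents_ge_1[OF p] by (simp_all add: \<alpha>_def le_essinfI)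
  have A: "(\<lambda>_. \<alpha>) \<in> exponents" "(\<lambda>_. conj_exponent \<alpha>) \<in> exponents"
    using \<alpha> conj_exponent_ge_1 by (auto simp: exponents_def)
  obtain D where D: "0 < D" "\<And>g. g \<in> borel_measurable lebesgue \<Longrightarrow> modular p g \<le> 1 \<Longrightarrow>
      modular (\<lambda>_. \<alpha>) (\<lambda>x. g x / of_real D) \<le> 1"
    by (rule var_Lebesgue_embedding[OF p A(1) essinf_AE[of lebesgue p, folded \<alpha>_def] r[folded \<alpha>_def]]) (rule that)
  have "AE x in lebesgue. q x \<le> conj_exponent \<alpha>"
    using esssup_AE[of q lebesgue] by eventually_elim (rule order_trans[OF _ qp[folded \<alpha>_def]])
  note emb = var_Lebesgue_embedding[OF A(2) q this s[folded \<alpha>_def]]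
  obtain E where E: "0 < E" "\<And>g. g \<in> borel_measurable lebesgue \<Longrightarrow> modular (\<lambda>_. conj_exponent \<alpha>) g \<le> 1 \<Longrightarrow>
      modular q (\<lambda>x. g x / of_real E) \<le> 1"
    by (rule emb) (rule that)
  obtain K where K: "0 < K" and HY: "\<And>f N. f \<in> borel_measurable lebesgue \<Longrightarrow> 0 < N \<Longrightarrow>
      modular (\<lambda>_. \<alpha>) (\<lambda>x. f x / of_real N) \<le> 1 \<Longrightarrow>
      \<exists>h\<in>borel_measurable lebesgue. represented_by (fourier_distr (distr_of_fun f)) h \<and>
        (\<forall>N>0. modular (\<lambda>_. \<alpha>) (\<lambda>x. f x / of_real N) \<le> 1 \<longrightarrow>
          modular (\<lambda>_. conj_exponent \<alpha>) (\<lambda>x. h x / of_real (K * N)) \<le> 1)"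
    by (rule hausdorff_young_modular[OF \<alpha>]) (rule that)
  show ?thesis
    unfolding fourier_bounded_def
  proof (intro exI[of _ "D * K * E"] conjI ballI)
    show "0 < D * K * E" using D(1) E(1) K by simp
    fix f assume f: "f \<in> var_Lebesgue p"
    note [measurable] = var_Lebesgue_measurable[OF f]
    have 1: "modular (\<lambda>_. \<alpha>) (\<lambda>x. f x / of_real (l * D)) \<le> 1" if "modular p (\<lambda>x. f x / of_real l) \<le> 1" for l
      using D(2)[OF _ that] by simp
    obtain l where l: "0 < l" "modular p (\<lambda>x. f x / of_real l) \<le> 1"
      using var_norm_set_nonempty[OF p f] .
    then obtain h where h [measurable]: "h \<in> borel_measurable lebesgue"
      and rep: "represented_by (fourier_distr (distr_of_fun f)) h"
      and hN: "\<And>N. 0 < N \<Longrightarrow> modular (\<lambda>_. \<alpha>) (\<lambda>x. f x / of_real N) \<le> 1 \<Longrightarrow>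
          modular (\<lambda>_. conj_exponent \<alpha>) (\<lambda>x. h x / of_real (K * N)) \<le> 1"
      using HY[OF var_Lebesgue_measurable[OF f] mult_pos_pos[OF l(1) D(1)] 1[OF l(2)]] by blast
    have 2: "modular q (\<lambda>x. h x / of_real (D * K * E * l)) \<le> 1"
      if "0 < l" "modular p (\<lambda>x. f x / of_real l) \<le> 1" for l
    proof -
      have "modular q (\<lambda>x. h x / of_real (K * (l * D)) / of_real E) \<le> 1"
        by (intro E(2) hN 1 that mult_pos_pos D(1)) measurable
      then show ?thesis by (simp add: mult_ac)
    qed
    have hq: "h \<in> var_Lebesgue q"
      unfolding var_Lebesgue_def
    proof (intro CollectI conjI exI)
      show "0 < D * K * E * l" using l D(1) E(1) K by simp
      show "modular q (\<lambda>x. h x / of_real (D * K * E * l)) < \<infinity>"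
        using 2[OF l] by (rule le_less_trans) simp
    qed (rule h)
    have "var_norm q h / (D * K * E) \<le> l" if "var_norm p f < l" for l
    proof -
      have "0 < l" using var_norm_nonneg[OF p f] that by simp
      with 2[OF this modular_le_1[OF p f that]] have "var_norm q h \<le> D * K * E * l"
        using D(1) E(1) K by (intro var_norm_le) auto
      then show ?thesis using D(1) E(1) K by (simp add: field_simps)
    qed
    \<comment> \<open>Every \<open>l\<close> above the norm of \<open>f\<close> is admissible with
      the same \<open>h\<close>, so the bound passes to the norm itself.\<close>
    then have "var_norm q h / (D * K * E) \<le> var_norm p f" by (rule dense_ge)
    then have "var_norm q h \<le> D * K * E * var_norm p f"
      using D(1) E(1) K by (simp add: field_simps)
    with hq rep show "\<exists>h\<in>var_Lebesgue q. represented_by (fourier_distr (distr_of_fun f)) h \<and>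
        var_norm q h \<le> D * K * E * var_norm p f" by blast
  qed
qed


section \<open>Testing boundedness on modulated indicators\<close>

lemma modular_cong_AE:
  assumes [measurable]: "f \<in> borel_measurable lebesgue" "g \<in> borel_measurable lebesgue"
    and p: "p \<in> borel_measurable lebesgue" and eq: "AE x in lebesgue. f x = g x"
  shows "modular p f = modular p g"
proof -
  have "(\<integral>\<^sup>+x\<in>{x. p x \<noteq> \<infinity>}. ennreal (cmod (f x) powr enn2real (p x)) \<partial>lebesgue) =
      (\<integral>\<^sup>+x\<in>{x. p x \<noteq> \<infinity>}. ennreal (cmod (g x) powr enn2real (p x)) \<partial>lebesgue)"
    using eq by (intro nn_integral_cong_AE) (auto elim!: eventually_mono)
  moreover have "esssup (lebesgue_on {x. p x = \<infinity>}) (\<lambda>x. ennreal (cmod (f x))) =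
      esssup (lebesgue_on {x. p x = \<infinity>}) (\<lambda>x. ennreal (cmod (g x)))"
  proof (rule esssup_AE_cong)
    show "AE x in lebesgue_on {x. p x = \<infinity>}. ennreal (cmod (f x)) = ennreal (cmod (g x))"
      unfolding AE_lebesgue_on_iff[OF sets_level(1)[OF p]]
      using eq by eventually_elim auto
  qed (intro measurable_restrict_space1, measurable)+
  ultimately show ?thesis by (simp add: modular_def)
qed

text \<open>For finite q, either |g| <= 1, and the Gaussian dominates, or |g| <= |g|^q because q >=
  1; for infinite q, |g| <= 1 almost everywhere. Here g is \<open>h\<close> divided by a scale of
  modular at most 1.\<close>

lemma var_Lebesgue_integrable_gauss:
  assumes q: "q \<in> exponents" and h: "h \<in> var_Lebesgue q"
  shows "integrable lebesgue (\<lambda>x. h x * of_real (exp (- x\<^sup>2)))"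
proof -
  note [measurable] = var_Lebesgue_measurable[OF h] exponents_measurable[OF q]
  obtain l where l: "0 < l" "modular q (\<lambda>x. h x / of_real l) \<le> 1"
    using var_norm_set_nonempty[OF q h] .
  let ?g = "\<lambda>x. h x / of_real l"
  let ?w = "\<lambda>x. ennreal (cmod (?g x) powr enn2real (q x)) * indicator {x. q x \<noteq> \<infinity>} x"
  have g: "?g \<in> borel_measurable lebesgue" by measurable
  note low = modular_lower[OF exponents_measurable[OF q] g]
  have bound: "AE x in lebesgue. ennreal (cmod (h x * of_real (exp (- x\<^sup>2)))) \<le>
      ennreal l * (ennreal (exp (- (1 * x\<^sup>2))) + ?w x)"
    using low(2)
  proof eventually_elim
    case (elim x)
    have e: "exp (- x\<^sup>2) \<le> 1" by simp
    show ?case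
    proof (cases "q x = \<infinity>")
      case True
      then have "ennreal (cmod (?g x)) \<le> 1" using order_trans[OF elim[rule_format] l(2)] by blast
      then have "cmod (h x) \<le> l" using l(1) by (simp add: ennreal_le_1 norm_divide)
      then have "cmod (h x) * exp (- x\<^sup>2) \<le> l * exp (- x\<^sup>2)" by (intro mult_right_mono) auto
      then show ?thesis using True l(1)
        by (simp add: norm_mult ennreal_mult[symmetric] ennreal_leI)
    next
      case False
      define Q where "Q = enn2real (q x)"
      have Q: "1 \<le> Q" using exponents_ge_1[OF q, of x] False unfolding Q_def by (cases "q x") auto
      have "cmod (?g x) * exp (- x\<^sup>2) \<le> exp (- x\<^sup>2) + cmod (?g x) powr Q"
      proof (cases "cmod (?g x) \<le> 1")
        case True
        then have "cmod (?g x) * exp (- x\<^sup>2) \<le> 1 * exp (- x\<^sup>2)" by (intro mult_right_mono) auto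
        then show ?thesis by (simp add: add_increasing2)
      next
        case False
        then have "cmod (?g x) powr 1 \<le> cmod (?g x) powr Q" using Q by (intro powr_mono) auto
        moreover have "cmod (?g x) * exp (- x\<^sup>2) \<le> cmod (?g x) * 1" by (intro mult_left_mono e) auto
        ultimately show ?thesis by (intro add_increasing) auto
      qed
      then have "l * (cmod (?g x) * exp (- x\<^sup>2)) \<le> l * (exp (- x\<^sup>2) + cmod (?g x) powr Q)"
        using l(1) by (intro mult_left_mono) auto
      moreover have "l * (cmod (?g x) * exp (- x\<^sup>2)) = cmod (h x * of_real (exp (- x\<^sup>2)))"
        using l(1) by (simp add: norm_mult norm_divide)
      ultimately show ?thesis using False l(1)
        by (simp add: Q_def ennreal_mult[symmetric] ennreal_plus[symmetric] ennreal_leI del: ennreal_plus)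
    qed
  qed
  have "(\<integral>\<^sup>+x. ennreal (cmod (h x * of_real (exp (- x\<^sup>2)))) \<partial>lebesgue) \<le>
      (\<integral>\<^sup>+x. ennreal l * (ennreal (exp (- (1 * x\<^sup>2))) + ?w x) \<partial>lebesgue)"
    using bound by (rule nn_integral_mono_AE)
  also have "\<dots> = ennreal l * ((\<integral>\<^sup>+x. ennreal (exp (- (1 * x\<^sup>2))) \<partial>lebesgue) + (\<integral>\<^sup>+x. ?w x \<partial>lebesgue))"
    by (simp add: nn_integral_cmult nn_integral_add)
  also have "\<dots> < \<infinity>"
  proof -
    have "(\<integral>\<^sup>+x. ?w x \<partial>lebesgue) < \<infinity>"
      using order_trans[OF low(1) l(2)] by (rule le_less_trans) simp
    moreover have "(\<integral>\<^sup>+x. ennreal (exp (- (1 * x\<^sup>2))) \<partial>lebesgue) < \<infinity>"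
      using integrable_lebesgue_gauss[of 1] by (subst nn_integral_eq_integral) auto
    ultimately show ?thesis by (simp add: ennreal_mult_less_top)
  qed
  finally show ?thesis by (intro integrableI_bounded) measurable
qed

text \<open>The bridge from distributions to functions. Testing with modulated Gaussians says that
  the difference of \<open>h\<close> and the Fourier integral, times a Gaussian, has vanishing
  Fourier transform.\<close>

lemma represented_by_fourier_AE:
  assumes f: "integrable lebesgue f" and q: "q \<in> exponents" and h: "h \<in> var_Lebesgue q"
    and rep: "represented_by (fourier_distr (distr_of_fun f)) h"
  shows "AE x in lebesgue. h x = fourier f x"
proof -
  note [measurable] = var_Lebesgue_measurable[OF h] borel_measurable_integrable[OF f]
  let ?g = "\<lambda>t x. complex_of_real (exp (- x\<^sup>2)) * iexp (t * x)"
  have hi: "integrable lebesgue (\<lambda>x. h x * ?g t x)" for t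
    by (rule Bochner_Integration.integrable_bound[OF var_Lebesgue_integrable_gauss[OF q h]])
      (auto simp: norm_mult)
  have fi: "integrable lebesgue (\<lambda>x. fourier f x * ?g t x)" for t
    by (rule Bochner_Integration.integrable_bound[OF integrable_mult_right[OF integrable_lebesgue_gauss[of 1], of "LINT x|lebesgue. cmod (f x)"]])
      (auto simp: norm_mult intro!: mult_right_mono norm_fourier_le AE_I2)
  have "AE x in lebesgue. (h x - fourier f x) * of_real (exp (- x\<^sup>2)) = 0"
  proof (rule fourier_uniqueness)
    show "integrable lebesgue (\<lambda>x. (h x - fourier f x) * of_real (exp (- x\<^sup>2)))"
      using Bochner_Integration.integrable_diff[OF hi[of 0] fi[of 0]] by (simp add: left_diff_distrib)
    fix t
    have "(LINT x|lebesgue. h x * ?g t x) = (LINT x|lebesgue. f x * fourier (?g t) x)"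
      using rep schwartz_gauss[of t]
      by (simp add: represented_by_def fourier_distr_def distr_of_fun_def)
    also have "\<dots> = (LINT x|lebesgue. fourier f x * ?g t x)"
      by (rule multiplication_formula[OF f schwartz_integrable[OF schwartz_gauss]])
    finally have "(LINT x|lebesgue. h x * ?g t x - fourier f x * ?g t x) = 0"
      using hi fi by simp
    then show "(LINT x|lebesgue. (h x - fourier f x) * of_real (exp (- x\<^sup>2)) * iexp (t * x)) = 0"
      by (simp add: left_diff_distrib mult.assoc)
  qed
  then show ?thesis by eventually_elim simp
qed

text \<open>The only form in which the necessity arguments use boundedness: honest Fourier
  integrals, and modulars in place of norms.\<close>

lemma fourier_bounded_modular:
  assumes p: "p \<in> exponents" and q: "q \<in> exponents" and bd: "fourier_bounded p q"
  obtains C where "0 < C" "\<And>f l. integrable lebesgue f \<Longrightarrow> 0 < l \<Longrightarrow> modular p (\<lambda>x. f x / of_real l) \<le> 1 \<Longrightarrow>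
      modular q (\<lambda>\<xi>. fourier f \<xi> / of_real (C * l)) \<le> 1"
proof -
  obtain C where C: "0 < C" "\<And>f. f \<in> var_Lebesgue p \<Longrightarrow> \<exists>h\<in>var_Lebesgue q.
        represented_by (fourier_distr (distr_of_fun f)) h \<and> var_norm q h \<le> C * var_norm p f"
    using bd unfolding fourier_bounded_def by blast
  show ?thesis
  \<comment> \<open>Doubling the constant makes the norm strictly smaller than the scale, as
    \<open>modular_le_1\<close> requires.\<close>
  proof (rule that[of "2 * C"])
    fix f l assume f: "integrable lebesgue f" and l: "0 < l" and m: "modular p (\<lambda>x. f x / of_real l) \<le> 1"
    note [measurable] = borel_measurable_integrable[OF f]
    have "modular p (\<lambda>x. f x / of_real l) < \<infinity>"
      using m by (rule le_less_trans) simp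
    with l have "f \<in> var_Lebesgue p" by (auto simp: var_Lebesgue_def)
    from C(2)[OF this] obtain h where h: "h \<in> var_Lebesgue q" "represented_by (fourier_distr (distr_of_fun f)) h"
      "var_norm q h \<le> C * var_norm p f" by blast
    note [measurable] = var_Lebesgue_measurable[OF h(1)]
    have "C * var_norm p f \<le> C * l"
      using C(1) var_norm_le[OF l m] by (intro mult_left_mono) auto
    moreover have "C * l < 2 * C * l" using C(1) l by simp
    ultimately have "var_norm q h < 2 * C * l" using h(3) by linarith
    from modular_le_1[OF q h(1) this] have "modular q (\<lambda>x. h x / of_real (2 * C * l)) \<le> 1" .
    also have "modular q (\<lambda>x. h x / of_real (2 * C * l)) = modular q (\<lambda>x. fourier f x / of_real (2 * C * l))"
    proof (rule modular_cong_AE[OF _ _ exponents_measurable[OF q]])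
      show "AE x in lebesgue. h x / of_real (2 * C * l) = fourier f x / of_real (2 * C * l)"
        using represented_by_fourier_AE[OF f q h(1,2)] by eventually_elim simp
    qed measurable
    finally show "modular q (\<lambda>x. fourier f x / of_real (2 * C * l)) \<le> 1" .
  qed (use C in simp)
qed

lemma modulated_indicator_integrable:
  assumes "S \<in> sets lebesgue" "S \<subseteq> {y - R..y + R}"
  shows "integrable lebesgue (\<lambda>x. of_real (indicator S x) * iexp (2 * pi * \<eta> * x))"
proof -
  have "emeasure lebesgue S \<le> emeasure lebesgue {y - R..y + R}"
    using assms by (intro emeasure_mono) auto
  also have "\<dots> < \<infinity>" by (simp add: emeasure_lborel_Icc_eq)
  finally have "integrable lebesgue (indicator S :: real \<Rightarrow> real)"
    using assms by (intro integrable_real_indicator) auto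
  then show ?thesis
    by (rule Bochner_Integration.integrable_bound) (use assms in \<open>auto simp: norm_mult\<close>)
qed

text \<open>After multiplication by a unimodular constant that moves the centre \<open>y\<close> to
  the origin, the phase on S is at most 2 pi R / (6 R) = pi / 3 in modulus, so the real part of the
  integrand is at least 1/2 there.\<close>

lemma fourier_modulated_indicator_ge:
  assumes S: "S \<in> sets lebesgue" "S \<subseteq> {y - R..y + R}" and R: "0 < R" and \<xi>: "\<bar>\<xi> - \<eta>\<bar> \<le> 1 / (6 * R)"
  shows "measure lebesgue S / 2 \<le> cmod (fourier (\<lambda>x. of_real (indicator S x) * iexp (2 * pi * \<eta> * x)) \<xi>)"
proof -
  let ?d = "\<xi> - \<eta>"
  let ?f = "\<lambda>x. complex_of_real (indicator S x) * iexp (2 * pi * \<eta> * x)"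
  have int: "integrable lebesgue (\<lambda>x. ?f x * exp (- (2 * of_real pi * \<i> * of_real x * of_real \<xi>)))"
    by (intro integrable_fourier_kernel modulated_indicator_integrable[OF S])
  have m: "emeasure lebesgue S < \<infinity>"
    by (rule le_less_trans[OF emeasure_mono[OF S(2)]]) (auto simp: emeasure_lborel_Icc_eq)
  have "measure lebesgue S / 2 = (LINT x|lebesgue. indicator S x * (1/2))"
    using S m by simp
  also have "\<dots> \<le> (LINT x|lebesgue. Re (iexp (2 * pi * ?d * y) * (?f x * exp (- (2 * of_real pi * \<i> * of_real x * of_real \<xi>)))))"
  proof (rule integral_mono)
    show "integrable lebesgue (\<lambda>x. indicator S x * (1/2) :: real)"
      using S m by (intro integrable_mult_left integrable_real_indicator) auto
    show "integrable lebesgue (\<lambda>x. Re (iexp (2 * pi * ?d * y) * (?f x * exp (- (2 * of_real pi * \<i> * of_real x * of_real \<xi>)))))"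
      by (intro integrable_Re integrable_mult_right int)
    fix x
    show "indicator S x * (1/2) \<le> Re (iexp (2 * pi * ?d * y) * (?f x * exp (- (2 * of_real pi * \<i> * of_real x * of_real \<xi>))))"
    proof (cases "x \<in> S")
      case True
      let ?\<theta> = "2 * pi * ?d * (x - y)"
      have "x \<in> {y - R..y + R}" using True S(2) by blast
      then have "\<bar>x - y\<bar> \<le> R" by (auto simp: abs_le_iff)
      then have "\<bar>?d\<bar> * \<bar>x - y\<bar> \<le> 1 / (6 * R) * R" using \<xi> R by (intro mult_mono) auto
      then have "2 * pi * (\<bar>?d\<bar> * \<bar>x - y\<bar>) \<le> 2 * pi * (1 / 6)" using R by (intro mult_left_mono) auto
      then have "\<bar>?\<theta>\<bar> \<le> pi / 3" by (simp add: abs_mult mult.assoc)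
      then have "cos (pi / 3) \<le> cos \<bar>?\<theta>\<bar>" by (intro cos_monotone_0_pi_le) auto
      then have c: "1 / 2 \<le> cos ?\<theta>" by (simp add: cos_60)
      have "iexp (2 * pi * ?d * y) * (?f x * exp (- (2 * of_real pi * \<i> * of_real x * of_real \<xi>))) = iexp (- ?\<theta>)"
        using True by (simp add: mult_exp_exp algebra_simps)
      also have "Re \<dots> = cos ?\<theta>" by (subst Re_exp) simp
      finally show ?thesis using c True by simp
    qed simp
  qed
  also have "\<dots> = Re (LINT x|lebesgue. iexp (2 * pi * ?d * y) * (?f x * exp (- (2 * of_real pi * \<i> * of_real x * of_real \<xi>))))"
    by (rule integral_Re[OF integrable_mult_right[OF int]])
  also have "(LINT x|lebesgue. iexp (2 * pi * ?d * y) * (?f x * exp (- (2 * of_real pi * \<i> * of_real x * of_real \<xi>)))) =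
      iexp (2 * pi * ?d * y) * fourier ?f \<xi>"
    unfolding fourier_def by (rule integral_mult_right_zero)
  also have "Re \<dots> \<le> cmod \<dots>" by (rule complex_Re_le_cmod)
  also have "\<dots> = cmod (fourier ?f \<xi>)" by (simp add: norm_mult)
  finally show ?thesis .
qed

text \<open>This replaces the Lebesgue density theorem: the centre \<open>z\<close> may depend on the radius, which
  makes a compact set inside an open set of less than twice its measure sufficient.\<close>

lemma half_density_intervals:
  assumes E: "E \<in> sets lebesgue" and pos: "emeasure lebesgue E \<noteq> 0"
  obtains e where "0 < e" "\<And>d. 0 < d \<Longrightarrow> d < e \<Longrightarrow> \<exists>z::real. ennreal d \<le> emeasure lebesgue (E \<inter> {z - d..z + d})"
proof -
  have "\<exists>n. emeasure lebesgue (E \<inter> {- real n..real n}) \<noteq> 0"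
  proof (rule ccontr)
    assume "\<not> ?thesis"
    then have "emeasure lebesgue (\<Union>n. E \<inter> {- real n..real n}) = 0"
      using E by (subst emeasure_UN_eq_0) auto
    moreover have "(\<Union>n. E \<inter> {- real n..real n}) = E"
    proof safe
      fix x assume "x \<in> E"
      moreover obtain n where "\<bar>x\<bar> \<le> real n" using real_arch_simple by blast
      ultimately show "x \<in> (\<Union>n. E \<inter> {- real n..real n})"
        by (intro UN_I[of n]) auto
    qed
    ultimately show False using pos by simp
  qed
  then obtain n where n: "emeasure lebesgue (E \<inter> {- real n..real n}) \<noteq> 0" by blast
  define F where "F = E \<inter> {- real n..real n}"
  have F: "F \<in> sets lebesgue" using E by (auto simp: F_def)
  have Ffin: "emeasure lebesgue F < \<infinity>"
    by (rule le_less_trans[OF emeasure_mono[of _ "{- real n..real n}"]]) (auto simp: F_def)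
  then have mF: "0 < measure lebesgue F" using n
    by (simp add: F_def[symmetric] measure_def enn2real_positive_iff zero_less_iff_neq_zero)
  \<comment> \<open>Removing less than the whole measure of \<open>F\<close> leaves a compact set of
    positive measure.\<close>
  obtain K where K: "closed K" "K \<subseteq> F" "F - K \<in> lmeasurable" "emeasure lebesgue (F - K) < ennreal (measure lebesgue F)"
    using sets_lebesgue_inner_closed[OF F mF] by blast
  have Ks: "K \<in> sets lebesgue" using K(1) by auto
  have Kcomp: "compact K"
    using K(1,2) by (auto simp: compact_eq_bounded_closed F_def intro: bounded_subset[of "{- real n..real n}"])
  have Kfin: "emeasure lebesgue K < \<infinity>"
    using emeasure_mono[OF K(2) F] Ffin by (rule le_less_trans)
  have "emeasure lebesgue K \<noteq> 0"
  proof
    assume "emeasure lebesgue K = 0"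
    then have "emeasure lebesgue F = emeasure lebesgue (F - K)"
      using Ks F by (subst emeasure_Diff_null_set) auto
    moreover have "emeasure lebesgue F = ennreal (measure lebesgue F)"
      using Ffin by (intro emeasure_eq_ennreal_measure) auto
    ultimately show False using K(4) by simp
  qed
  then have mK: "0 < measure lebesgue K" using Kfin
    by (simp add: measure_def enn2real_positive_iff zero_less_iff_neq_zero)
  obtain U where U: "open U" "K \<subseteq> U" "U - K \<in> lmeasurable" "emeasure lebesgue (U - K) < ennreal (measure lebesgue K)"
    using sets_lebesgue_outer_open[OF Ks mK] by blast
  have Us: "U \<in> sets lebesgue" using U(1) by auto
  have Kmes: "emeasure lebesgue K = ennreal (measure lebesgue K)"
    using Kfin by (intro emeasure_eq_ennreal_measure) auto
  have "emeasure lebesgue U = emeasure lebesgue K + emeasure lebesgue (U - K)"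
    using U(2) Us Ks by (subst plus_emeasure) (auto simp: Un_absorb1)
  also have "\<dots> < ennreal (measure lebesgue K) + ennreal (measure lebesgue K)"
    unfolding Kmes using U(4) by (simp add: ennreal_add_left_cancel_less)
  finally have Um: "emeasure lebesgue U < ennreal (2 * measure lebesgue K)"
    by (simp add: ennreal_plus[symmetric] del: ennreal_plus)
  have "closed (- U)" using U(1) by (simp add: closed_def)
  from separate_compact_closed[OF Kcomp this] U(2)
  obtain e where e: "0 < e" "\<And>x y. x \<in> K \<Longrightarrow> y \<notin> U \<Longrightarrow> e \<le> dist x y"
    by blast
  show ?thesis
  proof (rule that[of "e / 2"])
    show "0 < e / 2" using e by simp
    fix d :: real assume d: "0 < d" "d < e / 2"
    show "\<exists>z. ennreal d \<le> emeasure lebesgue (E \<inter> {z - d..z + d})"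
    proof (rule ccontr)
      assume "\<not> ?thesis"
      then have small: "emeasure lebesgue (E \<inter> {z - d..z + d}) \<le> ennreal d" for z
        by (auto simp: not_le intro: less_imp_le)
      \<comment> \<open>Tiles of length 2d; those that meet \<open>K\<close> are indexed by
        \<open>J\<close>. As 2d < e, each of them lies in \<open>U\<close>. If every interval of
        length 2d met \<open>E\<close> in measure at most d, then |K| <= card J * d, while the
        disjoint tiles give 2 d * card J <= |U| < 2 |K|, a contradiction.\<close>
      define c where "c j = {2 * d * of_int j..<2 * d * of_int j + 2 * d}" for j :: int
      define J where "J = (\<lambda>x. \<lfloor>x / (2 * d)\<rfloor>) ` K"
      have in_c: "x \<in> c j \<longleftrightarrow> \<lfloor>x / (2 * d)\<rfloor> = j" for x j
        using d by (auto simp: c_def floor_eq_iff field_simps)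
      have "finite J"
      proof (rule finite_subset)
        show "J \<subseteq> {\<lfloor>- real n / (2 * d)\<rfloor>..\<lfloor>real n / (2 * d)\<rfloor>}"
        proof
          fix j assume "j \<in> J"
          then obtain x where x: "x \<in> K" "j = \<lfloor>x / (2 * d)\<rfloor>" by (auto simp: J_def)
          then have "- real n \<le> x" "x \<le> real n" using K(2) by (auto simp: F_def)
          then show "j \<in> {\<lfloor>- real n / (2 * d)\<rfloor>..\<lfloor>real n / (2 * d)\<rfloor>}"
            unfolding x(2) atLeastAtMost_iff using d by (intro conjI floor_mono divide_right_mono) auto
        qed
      qed simp
      have disj: "disjoint_family_on c J"
        by (auto simp: disjoint_family_on_def in_c)
      have "K \<subseteq> (\<Union>j\<in>J. E \<inter> c j)"
        using K(2) by (auto simp: J_def F_def in_c)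
      then have "emeasure lebesgue K \<le> emeasure lebesgue (\<Union>j\<in>J. E \<inter> c j)"
        using E \<open>finite J\<close> by (intro emeasure_mono) (auto simp: c_def)
      also have "\<dots> \<le> (\<Sum>j\<in>J. emeasure lebesgue (E \<inter> c j))"
        using E \<open>finite J\<close> by (intro emeasure_subadditive_finite) (auto simp: c_def)
      also have "\<dots> \<le> (\<Sum>j\<in>J. ennreal d)"
      proof (rule sum_mono)
        fix j
        have "emeasure lebesgue (E \<inter> c j) \<le> emeasure lebesgue (E \<inter> {(2 * d * of_int j + d) - d..(2 * d * of_int j + d) + d})"
          using E by (intro emeasure_mono) (auto simp: c_def)
        also have "\<dots> \<le> ennreal d" by (rule small)
        finally show "emeasure lebesgue (E \<inter> c j) \<le> ennreal d" .
      qed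
      also have "\<dots> = ennreal (real (card J) * d)"
        using d by (simp add: ennreal_mult ennreal_of_nat_eq_real_of_nat)
      finally have 1: "measure lebesgue K \<le> real (card J) * d"
        using d by (simp add: Kmes)
      have "c j \<subseteq> U" if j: "j \<in> J" for j
      proof
        fix y assume y: "y \<in> c j"
        obtain x where x: "x \<in> K" "x \<in> c j" using j by (auto simp: J_def in_c)
        have "dist x y < e" using x(2) y d by (auto simp: c_def dist_real_def)
        then show "y \<in> U" using e(2)[OF x(1), of y] by force
      qed
      then have "emeasure lebesgue (\<Union>j\<in>J. c j) \<le> emeasure lebesgue U"
        using Us by (intro emeasure_mono) auto
      moreover have "emeasure lebesgue (\<Union>j\<in>J. c j) = (\<Sum>j\<in>J. emeasure lebesgue (c j))"
        by (intro sum_emeasure[symmetric] disj \<open>finite J\<close>) (auto simp: c_def)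
      moreover have "(\<Sum>j\<in>J. emeasure lebesgue (c j)) = (\<Sum>j\<in>J. ennreal (2 * d))"
        using d by (intro sum.cong) (auto simp: c_def)
      moreover have "(\<Sum>j\<in>J. ennreal (2 * d)) = ennreal (real (card J) * (2 * d))"
        using d by (simp add: ennreal_mult ennreal_of_nat_eq_real_of_nat)
      ultimately have "ennreal (real (card J) * (2 * d)) < ennreal (2 * measure lebesgue K)"
        using Um by simp
      then have "real (card J) * (2 * d) < 2 * measure lebesgue K"
        using d by (simp add: ennreal_less_iff)
      with 1 show False by simp
    qed
  qed
qed


section \<open>Exponents forced by boundedness\<close>

text \<open>Markov's inequality for the integral part of the modular; hence the demand that q be
  finite on \<open>E\<close>, up to a null set.\<close>

lemma modular_ge_emeasure:
  assumes q: "q \<in> exponents" and g: "g \<in> borel_measurable lebesgue" and E: "E \<in> sets lebesgue" and c: "0 \<le> c"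
    and AE: "AE x in lebesgue. x \<in> E \<longrightarrow> q x \<noteq> \<infinity> \<and> c \<le> cmod (g x) powr enn2real (q x)"
    and le: "modular q g \<le> 1"
  shows "ennreal c * emeasure lebesgue E \<le> 1"
proof -
  have "ennreal c * emeasure lebesgue E = (\<integral>\<^sup>+x. ennreal c * indicator E x \<partial>lebesgue)"
    using E by (rule nn_integral_cmult_indicator[symmetric])
  also have "\<dots> \<le> (\<integral>\<^sup>+x\<in>{x. q x \<noteq> \<infinity>}. ennreal (cmod (g x) powr enn2real (q x)) \<partial>lebesgue)"
    using AE by (intro nn_integral_mono_AE, eventually_elim) (auto simp: indicator_def ennreal_leI)
  also have "\<dots> \<le> modular q g"
    by (rule modular_lower(1)[OF exponents_measurable[OF q] g])
  finally show ?thesis using le by (rule order_trans)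
qed

text \<open>A modulated interval of length 2R where p >= s has norm at most about R^(1/s). Its
  normalised transform is at least T, of order R^(1 - 1/s), on a window of radius 1 / (6R) around
  \<open>z\<close>, in which {q >= u} has measure at least 1 / (6R). Hence T^u <= 6R, which fails
  for large R if (1 - 1/s) u > 1.\<close>

lemma fourier_bounded_imp_inverse_sum_ge_1:
  assumes bd: "fourier_bounded p q" and p: "p \<in> exponents" and q: "q \<in> exponents"
    and s: "0 < s" and u: "0 < u" and pt: "\<And>L. 0 < L \<Longrightarrow> \<exists>c. AE x in lebesgue. x \<in> {c..c + L} \<longrightarrow> ennreal s \<le> p x"
    and E0: "\<not> (AE x in lebesgue. q x < ennreal u)"
  shows "1 \<le> 1 / s + 1 / u"
proof (rule ccontr)
  assume "\<not> ?thesis"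
  then have su: "1 / s + 1 / u < 1" by simp
  then have s1: "1 / s < 1" using u by (smt (verit) divide_pos_pos)
  define e where "e = 1 - 1 / s"
  have e: "0 < e" using s1 by (simp add: e_def)
  have eu: "1 < e * u"
  proof -
    have "1 / u < e" using su by (simp add: e_def)
    then show ?thesis using u by (simp add: field_simps)
  qed
  note [measurable] = exponents_measurable[OF q] exponents_measurable[OF p]
  obtain C where C: "0 < C" "\<And>f l. integrable lebesgue f \<Longrightarrow> 0 < l \<Longrightarrow> modular p (\<lambda>x. f x / of_real l) \<le> 1 \<Longrightarrow>
      modular q (\<lambda>\<xi>. fourier f \<xi> / of_real (C * l)) \<le> 1"
    by (rule fourier_bounded_modular[OF p q bd]) (rule that)
  define E where "E = {x. ennreal u \<le> q x}"
  have E: "E \<in> sets lebesgue" unfolding E_def by (intro sets_lebesgue_Collect) measurable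
  have E_pos: "emeasure lebesgue E \<noteq> 0"
  proof
    assume "emeasure lebesgue E = 0"
    then have "AE x in lebesgue. x \<notin> E" using E by (intro AE_not_in) auto
    then show False using E0 by (auto simp: E_def not_le)
  qed
  obtain d0 where d0: "0 < d0" "\<And>d. 0 < d \<Longrightarrow> d < d0 \<Longrightarrow> \<exists>z::real. ennreal d \<le> emeasure lebesgue (E \<inter> {z - d..z + d})"
    by (rule half_density_intervals[OF E E_pos]) (rule that)
  \<comment> \<open>Collects the constants so that R / (C * l) = k * R^e for the scale l =
    (4R)^(1/s) below.\<close>
  define k where "k = 1 / (C * 4 powr (1 / s))"
  have k: "0 < k" using C by (simp add: k_def)
  have k2: "0 < k powr u" using k by simp
  \<comment> \<open>In this order: the window is short enough for the density lemma; the scale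
    \<open>l\<close> is at least 2, which handles the points with p infinite; T exceeds 1; and T^u
    exceeds 6R, the contradiction aimed at.\<close>
  have "\<forall>\<^sub>F R in at_top. 0 < R \<and> 1 / (6 * R) < d0 \<and> 2 \<le> (4 * R) powr (1 / s) \<and> 1 < k * R powr e \<and>
      6 * R < k powr u * R powr (e * u)"
  proof (intro eventually_conj eventually_gt_at_top)
    show "\<forall>\<^sub>F R in at_top. 1 / (6 * R) < d0" using d0(1) by real_asymp
    show "\<forall>\<^sub>F R in at_top. 2 \<le> (4 * R) powr (1 / s)" using s by real_asymp
    show "\<forall>\<^sub>F R in at_top. 1 < k * R powr e" using k e by real_asymp
    define K w where "K = k powr u" and "w = e * u"
    have "0 < K" "1 < w" using k2 eu by (auto simp: K_def w_def)
    then have "\<forall>\<^sub>F R in at_top. 6 * R < K * R powr w" by real_asymp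
    then show "\<forall>\<^sub>F R in at_top. 6 * R < k powr u * R powr (e * u)" by (simp add: K_def w_def)
  qed
  from eventually_happens'[OF _ this] obtain R where R: "0 < R" "1 / (6 * R) < d0" "2 \<le> (4 * R) powr (1 / s)" "1 < k * R powr e"
      "6 * R < k powr u * R powr (e * u)"
    by auto
  obtain z where z: "ennreal (1 / (6 * R)) \<le> emeasure lebesgue (E \<inter> {z - 1 / (6 * R)..z + 1 / (6 * R)})"
    using d0(2)[OF _ R(2)] R(1) by auto
  obtain c where c: "AE x in lebesgue. x \<in> {c..c + 2 * R} \<longrightarrow> ennreal s \<le> p x"
    using pt[of "2 * R"] R(1) by auto
  define S where "S = {c..c + 2 * R}"
  have S: "S \<in> sets lebesgue" "S \<subseteq> {(c + R) - R..(c + R) + R}" by (auto simp: S_def)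
  define f where "f x = complex_of_real (indicator S x) * iexp (2 * pi * z * x)" for x
  have f_int: "integrable lebesgue f" unfolding f_def[abs_def] by (rule modulated_indicator_integrable[OF S])
  note [measurable] = borel_measurable_integrable[OF f_int]
  \<comment> \<open>With l^s = 4R the integral over an interval of length 2R is at most 1/2, which
    leaves the other 1/2 for the supremum part.\<close>
  define l where "l = (4 * R) powr (1 / s)"
  have l: "2 \<le> l" "l powr s = 4 * R" using R s by (auto simp: l_def powr_powr)
  have "modular p (\<lambda>x. f x / of_real l) \<le> ennreal (1/2) + ennreal (1/2)"
  proof (rule modular_upper)
    have "(\<integral>\<^sup>+x\<in>{x. p x \<noteq> \<infinity>}. ennreal (cmod (f x / of_real l) powr enn2real (p x)) \<partial>lebesgue) \<le>
      (\<integral>\<^sup>+x. ennreal (1 / (4 * R)) * indicator S x \<partial>lebesgue)"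
    proof (rule nn_integral_mono_AE)
      show "AE x in lebesgue. ennreal (cmod (f x / of_real l) powr enn2real (p x)) * indicator {x. p x \<noteq> \<infinity>} x \<le>
        ennreal (1 / (4 * R)) * indicator S x"
        using c
      proof eventually_elim
        case (elim x)
        show ?case
        proof (cases "x \<in> S \<and> p x \<noteq> \<infinity>")
          case True
          then have "ennreal s \<le> p x" using elim by (simp add: S_def)
          then have "s \<le> enn2real (p x)" using True s by (cases "p x") auto
          then have "(1 / l) powr enn2real (p x) \<le> (1 / l) powr s"
            using l by (intro powr_mono') auto
          also have "\<dots> = 1 / (4 * R)" using l by (simp add: powr_divide)
          finally show ?thesis using True l by (simp add: f_def norm_divide norm_mult ennreal_leI)
        qed (auto simp: f_def)
      qed
    qed
    also have "\<dots> = ennreal (1 / (4 * R)) * emeasure lebesgue S"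
      using S by (intro nn_integral_cmult_indicator)
    also have "\<dots> = ennreal (1/2)" using R(1) by (simp add: S_def ennreal_mult[symmetric])
    finally show "(\<integral>\<^sup>+x\<in>{x. p x \<noteq> \<infinity>}. ennreal (cmod (f x / of_real l) powr enn2real (p x)) \<partial>lebesgue) \<le> ennreal (1/2)" .
    show "AE x in lebesgue. p x = \<infinity> \<longrightarrow> ennreal (cmod (f x / of_real l)) \<le> ennreal (1/2)"
      using l by (intro AE_I2 impI ennreal_leI) (auto simp: f_def norm_divide norm_mult indicator_def field_simps)
  qed measurable
  also have "\<dots> = 1" by (subst ennreal_plus[symmetric]) auto
  finally have "modular p (\<lambda>x. f x / of_real l) \<le> 1" .
  from C(2)[OF f_int _ this] l(1) have m: "modular q (\<lambda>\<xi>. fourier f \<xi> / of_real (C * l)) \<le> 1" by simp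
  define T where "T = k * R powr e"
  have T: "R / (C * l) = T"
    using R(1) by (simp add: T_def k_def l_def e_def powr_mult powr_diff)
  have T1: "1 < T" using R(4) by (simp add: T_def)
  define B where "B = E \<inter> {z - 1 / (6 * R)..z + 1 / (6 * R)}"
  have B: "B \<in> sets lebesgue" using E by (simp add: B_def)
  have gT: "T \<le> cmod (fourier f \<xi> / of_real (C * l))" if "\<xi> \<in> B" for \<xi>
  proof -
    have "\<bar>\<xi> - z\<bar> \<le> 1 / (6 * R)" using that by (auto simp: B_def abs_le_iff)
    from fourier_modulated_indicator_ge[OF S R(1) this]
    have "R \<le> cmod (fourier f \<xi>)" using R(1) by (simp add: S_def f_def[abs_def])
    then have "R / (C * l) \<le> cmod (fourier f \<xi>) / (C * l)" using C(1) l by (intro divide_right_mono) auto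
    then show ?thesis using C(1) l by (simp add: T norm_divide norm_mult)
  qed
  have g_meas: "(\<lambda>\<xi>. fourier f \<xi> / of_real (C * l)) \<in> borel_measurable lebesgue" by measurable
  have "ennreal (T powr u) * emeasure lebesgue B \<le> 1"
  proof (rule modular_ge_emeasure[OF q g_meas B _ _ m])
    have "AE x in lebesgue. q x = \<infinity> \<longrightarrow> ennreal (cmod (fourier f x / of_real (C * l))) \<le> modular q (\<lambda>\<xi>. fourier f \<xi> / of_real (C * l))"
      by (rule modular_lower(2)) measurable
    then show "AE x in lebesgue. x \<in> B \<longrightarrow> q x \<noteq> \<infinity> \<and> T powr u \<le> cmod (fourier f x / of_real (C * l)) powr enn2real (q x)"
    proof eventually_elim
      case (elim x)
      show ?case
      proof
        assume x: "x \<in> B"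
        \<comment> \<open>At a point with q infinite the supremum part would exceed 1, since T >
          1.\<close>
        have fin: "q x \<noteq> \<infinity>"
        proof
          assume "q x = \<infinity>"
          from order_trans[OF elim[rule_format, OF this] m] gT[OF x] T1 show False by (simp add: ennreal_le_1)
        qed
        have "ennreal u \<le> q x" using x by (simp add: B_def E_def)
        then have "u \<le> enn2real (q x)" using fin u by (cases "q x") auto
        then have "T powr u \<le> T powr enn2real (q x)" using T1 by (intro powr_mono) auto
        also have "\<dots> \<le> cmod (fourier f x / of_real (C * l)) powr enn2real (q x)"
          using T1 gT[OF x] by (intro powr_mono2) auto
        finally show "q x \<noteq> \<infinity> \<and> T powr u \<le> cmod (fourier f x / of_real (C * l)) powr enn2real (q x)"
          using fin by simp
      qed
    qed
  qed simp
  then have "ennreal (T powr u) * ennreal (1 / (6 * R)) \<le> 1"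
    by (rule order_trans[OF mult_left_mono[OF z[folded B_def]], rotated]) simp
  then have "T powr u \<le> 6 * R" using R(1) by (simp add: ennreal_mult[symmetric] ennreal_le_1 field_simps)
  moreover have "T powr u = k powr u * R powr (e * u)"
    using k R(1) by (simp add: T_def powr_mult powr_powr)
  ultimately show False using R(5) by simp
qed


text \<open>The opposite regime: S lies in {p <= s}, has measure between d and 2d and fits in an
  interval of radius d. Its transform is at least d / 2 on a window of length 1 / (3d), which
  modulation moves to a place where q <= u. With T of order d^(1 - 1/s), capped at 1, the bound T^u
  <= 3d fails for small d if (1 - 1/s) u < 1.\<close>

lemma fourier_bounded_imp_inverse_sum_le_1:
  assumes bd: "fourier_bounded p q" and p: "p \<in> exponents" and q: "q \<in> exponents"
    and s: "1 < s" and u: "0 < u" and qt: "\<And>L. 0 < L \<Longrightarrow> \<exists>c. AE x in lebesgue. x \<in> {c..c + L} \<longrightarrow> q x \<le> ennreal u"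
    and E0: "\<not> (AE x in lebesgue. ennreal s < p x)"
  shows "1 / s + 1 / u \<le> 1"
proof (rule ccontr)
  assume "\<not> ?thesis"
  then have su: "1 < 1 / s + 1 / u" by simp
  define e where "e = 1 - 1 / s"
  have e: "0 < e" using s by (simp add: e_def)
  have eu: "e * u < 1"
  proof -
    have "e < 1 / u" using su by (simp add: e_def)
    then show ?thesis using u by (simp add: field_simps)
  qed
  note [measurable] = exponents_measurable[OF q] exponents_measurable[OF p]
  obtain C where C: "0 < C" "\<And>f l. integrable lebesgue f \<Longrightarrow> 0 < l \<Longrightarrow> modular p (\<lambda>x. f x / of_real l) \<le> 1 \<Longrightarrow>
      modular q (\<lambda>\<xi>. fourier f \<xi> / of_real (C * l)) \<le> 1"
    by (rule fourier_bounded_modular[OF p q bd]) (rule that)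
  define E where "E = {x. p x \<le> ennreal s}"
  have E: "E \<in> sets lebesgue" unfolding E_def by (intro sets_lebesgue_Collect) measurable
  have E_pos: "emeasure lebesgue E \<noteq> 0"
  proof
    assume "emeasure lebesgue E = 0"
    then have "AE x in lebesgue. x \<notin> E" using E by (intro AE_not_in) auto
    then show False using E0 by (auto simp: E_def not_le)
  qed
  obtain d0 where d0: "0 < d0" "\<And>d. 0 < d \<Longrightarrow> d < d0 \<Longrightarrow> \<exists>z::real. ennreal d \<le> emeasure lebesgue (E \<inter> {z - d..z + d})"
    by (rule half_density_intervals[OF E E_pos]) (rule that)
  define k where "k = 1 / (2 * C * 2 powr (1 / s))"
  have k: "0 < k" using C by (simp add: k_def)
  \<comment> \<open>\<open>R\<close> is the reciprocal of the radius d, so that smallness becomes an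
    asymptotic condition at infinity. The bound 3 < R means 3d < 1 and settles the case in which T
    is capped at 1.\<close>
  have "\<forall>\<^sub>F R in at_top. 0 < R \<and> 1 / R < d0 \<and> 2 < R \<and> 3 < R \<and>
      3 < k powr u * R powr (1 - e * u)"
  proof (intro eventually_conj eventually_gt_at_top)
    show "\<forall>\<^sub>F R in at_top. 1 / R < d0" using d0(1) by real_asymp
    define K w where "K = k powr u" and "w = 1 - e * u"
    have "0 < K" "0 < w" using k eu by (auto simp: K_def w_def)
    then have "\<forall>\<^sub>F R in at_top. 3 < K * R powr w" by real_asymp
    then show "\<forall>\<^sub>F R in at_top. 3 < k powr u * R powr (1 - e * u)" by (simp add: K_def w_def)
  qed
  from eventually_happens'[OF _ this] obtain R where R: "0 < R" "1 / R < d0" "2 < R" "3 < R"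
      "3 < k powr u * R powr (1 - e * u)"
    by auto
  define d where "d = 1 / R"
  have d: "0 < d" "d < d0" "d < 1 / 2" "3 * d < 1" using R by (auto simp: d_def field_simps)
  have kd: "3 * d < (k * d powr e) powr u"
  proof -
    have "(k * d powr e) powr u = k powr u * d powr (e * u)"
      using k d by (simp add: powr_mult powr_powr)
    also have "d powr (e * u) = R powr (1 - e * u) * d"
      using R(1) by (simp add: d_def powr_divide powr_diff)
    finally show ?thesis using R(5) d(1) by simp
  qed
  obtain z where z: "ennreal d \<le> emeasure lebesgue (E \<inter> {z - d..z + d})"
    using d0(2)[OF d(1,2)] by auto
  obtain c where c: "AE x in lebesgue. x \<in> {c..c + 1 / (3 * d)} \<longrightarrow> q x \<le> ennreal u"
    using qt[of "1 / (3 * d)"] d(1) by auto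
  define S where "S = E \<inter> {z - d..z + d}"
  have S: "S \<in> sets lebesgue" "S \<subseteq> {z - d..z + d}" using E by (auto simp: S_def)
  have S_le: "emeasure lebesgue S \<le> ennreal (2 * d)"
    using emeasure_mono[OF S(2), of lebesgue] d(1) by simp
  then have S_ge: "d \<le> measure lebesgue S"
  proof -
    have "emeasure lebesgue S = ennreal (measure lebesgue S)"
      using S_le by (intro emeasure_eq_ennreal_measure) (auto simp: top_unique)
    then show ?thesis using z d(1) unfolding S_def[symmetric] by simp
  qed
  \<comment> \<open>The midpoint of the window, whose half-length 1 / (6d) is exactly the radius
    allowed by \<open>fourier_modulated_indicator_ge\<close>.\<close>
  define n where "n = c + 1 / (6 * d)"
  define f where "f x = complex_of_real (indicator S x) * iexp (2 * pi * n * x)" for x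
  have f_int: "integrable lebesgue f" unfolding f_def[abs_def] by (rule modulated_indicator_integrable[OF S])
  note [measurable] = borel_measurable_integrable[OF f_int]
  \<comment> \<open>l^s = 2d matches the largest possible measure of S. Since l <= 1 and p <= s on
    S, the scaled p-th power is at most 1 / (2d) there.\<close>
  define l where "l = (2 * d) powr (1 / s)"
  have l: "0 < l" "l \<le> 1" "l powr s = 2 * d"
    using d s by (auto simp: l_def powr_powr powr_le1)
  have "modular p (\<lambda>x. f x / of_real l) \<le> 1 + 0"
  proof (rule modular_upper)
    have "(\<integral>\<^sup>+x\<in>{x. p x \<noteq> \<infinity>}. ennreal (cmod (f x / of_real l) powr enn2real (p x)) \<partial>lebesgue) \<le>
      (\<integral>\<^sup>+x. ennreal (1 / (2 * d)) * indicator S x \<partial>lebesgue)"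
    proof (rule nn_integral_mono)
      fix x
      show "ennreal (cmod (f x / of_real l) powr enn2real (p x)) * indicator {x. p x \<noteq> \<infinity>} x \<le>
        ennreal (1 / (2 * d)) * indicator S x"
      proof (cases "x \<in> S")
        case True
        then have "p x \<le> ennreal s" by (simp add: S_def E_def)
        then have "enn2real (p x) \<le> s" using s by (cases "p x") (auto simp: top_unique)
        then have "(1 / l) powr enn2real (p x) \<le> (1 / l) powr s"
          using l by (intro powr_mono) auto
        also have "\<dots> = 1 / (2 * d)" using l by (simp add: powr_divide)
        finally show ?thesis using True l
          by (auto simp: f_def norm_divide norm_mult ennreal_leI indicator_def)
      qed (auto simp: f_def)
    qed
    also have "\<dots> = ennreal (1 / (2 * d)) * emeasure lebesgue S"
      using S by (intro nn_integral_cmult_indicator)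
    also have "\<dots> \<le> ennreal (1 / (2 * d)) * ennreal (2 * d)"
      by (intro mult_left_mono S_le) simp
    also have "\<dots> = 1" using d(1) by (simp add: ennreal_mult[symmetric])
    finally show "(\<integral>\<^sup>+x\<in>{x. p x \<noteq> \<infinity>}. ennreal (cmod (f x / of_real l) powr enn2real (p x)) \<partial>lebesgue) \<le> 1" .
    show "AE x in lebesgue. p x = \<infinity> \<longrightarrow> ennreal (cmod (f x / of_real l)) \<le> 0"
      by (intro AE_I2 impI) (auto simp: f_def S_def E_def indicator_def top_unique)
  qed measurable
  then have "modular p (\<lambda>x. f x / of_real l) \<le> 1" by simp
  from C(2)[OF f_int l(1) this] have m: "modular q (\<lambda>\<xi>. fourier f \<xi> / of_real (C * l)) \<le> 1" .
  \<comment> \<open>The cap at 1 is what allows T^u <= T^q from q <= u.\<close>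
  define T where "T = min 1 (k * d powr e)"
  have T: "0 < T" "T \<le> 1" using k d by (auto simp: T_def)
  have T_eq: "d / 2 / (C * l) = k * d powr e"
    using d(1) by (simp add: k_def l_def e_def powr_mult powr_diff)
  have T_gt: "3 * d < T powr u"
    using kd d(4) by (auto simp: T_def min_def)
  define B where "B = {c..c + 1 / (3 * d)}"
  have B: "B \<in> sets lebesgue" by (simp add: B_def)
  have gT: "T \<le> cmod (fourier f \<xi> / of_real (C * l))" if "\<xi> \<in> B" for \<xi>
  proof -
    have "1 / (3 * d) = 1 / (6 * d) + 1 / (6 * d)" using d(1) by (simp add: field_simps)
    then have "\<bar>\<xi> - n\<bar> \<le> 1 / (6 * d)" using that by (auto simp: B_def n_def abs_le_iff)
    from fourier_modulated_indicator_ge[OF S d(1) this]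
    have "d / 2 \<le> cmod (fourier f \<xi>)" using S_ge by (simp add: f_def[abs_def])
    then have "d / 2 / (C * l) \<le> cmod (fourier f \<xi>) / (C * l)" using C(1) l by (intro divide_right_mono) auto
    then have "T \<le> cmod (fourier f \<xi>) / (C * l)" unfolding T_eq by (simp add: T_def)
    then show ?thesis using C(1) l by (simp add: norm_divide norm_mult)
  qed
  have g_meas: "(\<lambda>\<xi>. fourier f \<xi> / of_real (C * l)) \<in> borel_measurable lebesgue" by measurable
  have "ennreal (T powr u) * emeasure lebesgue B \<le> 1"
  proof (rule modular_ge_emeasure[OF q g_meas B _ _ m])
    show "AE x in lebesgue. x \<in> B \<longrightarrow> q x \<noteq> \<infinity> \<and> T powr u \<le> cmod (fourier f x / of_real (C * l)) powr enn2real (q x)"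
      using c
    proof eventually_elim
      case (elim x)
      show ?case
      proof
        assume x: "x \<in> B"
        then have le: "q x \<le> ennreal u" using elim by (simp add: B_def)
        then have fin: "q x \<noteq> \<infinity>" by (auto simp: top_unique)
        have "enn2real (q x) \<le> u" using le u by (cases "q x") (auto simp: top_unique)
        then have "T powr u \<le> T powr enn2real (q x)" using T by (intro powr_mono') auto
        also have "\<dots> \<le> cmod (fourier f x / of_real (C * l)) powr enn2real (q x)"
          using T gT[OF x] by (intro powr_mono2) auto
        finally show "q x \<noteq> \<infinity> \<and> T powr u \<le> cmod (fourier f x / of_real (C * l)) powr enn2real (q x)"
          using fin by simp
      qed
    qed
  qed simp
  then have "T powr u * (1 / (3 * d)) \<le> 1"
    using d(1) by (simp add: B_def ennreal_mult[symmetric] ennreal_le_1)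
  then have "T powr u \<le> 3 * d" using d(1) by (simp add: field_simps)
  then show False using T_gt by simp
qed


section \<open>Chirps\<close>

text \<open>Computing the squared modulus instead of the transform avoids Gaussian integrals with a
  complex parameter: it is the integral of the autocorrelation of g, which involves only real
  Gaussians times characters.\<close>

lemma fourier_chirp:
  fixes t \<xi> :: real
  defines "f \<equiv> \<lambda>x. complex_of_real (exp (- (pi * x\<^sup>2))) * iexp (- (pi * t * x\<^sup>2))"
  shows "integrable lebesgue f"
    and "(cmod (fourier f \<xi>))\<^sup>2 = 1 / sqrt (1 + t\<^sup>2) * exp (- (2 * pi * \<xi>\<^sup>2 / (1 + t\<^sup>2)))"
proof -
  have [measurable]: "f \<in> borel_measurable borel" unfolding f_def by measurable
  have fint: "integrable lborel f"
    by (rule Bochner_Integration.integrable_bound[OF integrable_gauss[of pi]]) (auto simp: f_def norm_mult)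
  then show "integrable lebesgue f"
    by (subst integrable_completion) auto
  define g where "g x = f x * iexp (- (2 * pi * \<xi>) * x)" for x
  have [measurable]: "g \<in> borel_measurable borel" unfolding g_def[abs_def] by measurable
  have gint: "integrable lborel g"
    by (rule Bochner_Integration.integrable_bound[OF fint]) (auto simp: g_def norm_mult)
  have fg: "fourier f \<xi> = (CLINT x|lborel. g x)"
    unfolding fourier_def fourier_kernel_iexp g_def by (subst integral_completion) auto
  have shift: "integrable lborel (\<lambda>u. g (y + u))" for y
    using lborel_integrable_real_affine[OF gint, of 1 y] by simp
  have H: "integrable (lborel \<Otimes>\<^sub>M lborel) (\<lambda>(y, u). cnj (g y) * g (y + u))"
  proof (rule lborel_pair.Fubini_integrable)
    have "(LINT u|lborel. norm (cnj (g y) * g (y + u))) = cmod (g y) * (LINT u|lborel. cmod (g u))" for y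
    proof -
      have "(LINT u|lborel. cmod (g u)) = (LINT u|lborel. cmod (g (y + u)))"
        by (subst lborel_integral_real_affine[of 1 _ y]) auto
      then show ?thesis by (simp add: norm_mult)
    qed
    then show "integrable lborel (\<lambda>y. LINT u|lborel. norm (case (y, u) of (y, u) \<Rightarrow> cnj (g y) * g (y + u)))"
      using gint by simp
    show "AE y in lborel. integrable lborel (\<lambda>u. case (y, u) of (y, u) \<Rightarrow> cnj (g y) * g (y + u))"
      using shift by simp
  qed measurable
  \<comment> \<open>Centred at the midpoint, the two arguments are w - u/2 and w + u/2. Their
    squares differ by 2uw, linear in w, so the quadratic phase turns into a character in w.\<close>
  have gg: "cnj (g (- (u / 2) + w)) * g (- (u / 2) + w + u) =
      (of_real (exp (- (pi / 2 * u\<^sup>2))) * iexp (- (2 * pi * \<xi>) * u)) *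
      (of_real (exp (- (2 * pi * w\<^sup>2))) * iexp (- (2 * pi * t * u) * w))" for u w
  proof -
    define a where "a = - (u / 2) + w"
    define b where "b = - (u / 2) + w + u"
    have g_eq: "g x = exp (of_real (- (pi * x\<^sup>2)) + \<i> * of_real (- (pi * t * x\<^sup>2) - 2 * pi * \<xi> * x))" for x
      by (simp add: g_def f_def exp_of_real[symmetric] mult_exp_exp algebra_simps)
    have "cnj (g a) * g b = exp (of_real (- (pi * (a\<^sup>2 + b\<^sup>2))) + \<i> * of_real (- (pi * t * (b\<^sup>2 - a\<^sup>2)) - 2 * pi * \<xi> * (b - a)))"
      unfolding g_eq exp_cnj by (simp add: mult_exp_exp algebra_simps)
    also have "a\<^sup>2 + b\<^sup>2 = u\<^sup>2 / 2 + 2 * w\<^sup>2"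
      by (simp add: a_def b_def power2_eq_square field_simps)
    also have "b\<^sup>2 - a\<^sup>2 = 2 * u * w"
      by (simp add: a_def b_def power2_eq_square field_simps)
    also have "b - a = u" by (simp add: a_def b_def)
    finally show ?thesis
      by (simp add: a_def b_def exp_of_real[symmetric] mult_exp_exp algebra_simps)
  qed
  have sq: "(- (2 * pi * \<xi>))\<^sup>2 / (4 * (pi * w / 2)) = 2 * pi * \<xi>\<^sup>2 / w" for w
    by (cases "w = 0") (auto simp: field_simps power2_eq_square)
  have t: "0 < 1 + t\<^sup>2" by (simp add: add_pos_nonneg)
  have "complex_of_real ((cmod (fourier f \<xi>))\<^sup>2) = cnj (fourier f \<xi>) * fourier f \<xi>"
    by (subst complex_norm_square) (rule mult.commute)
  also have "\<dots> = (CLINT y|lborel. cnj (g y) * (CLINT x|lborel. g x))"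
    unfolding fg by simp
  also have "\<dots> = (CLINT y|lborel. CLINT u|lborel. cnj (g y) * g (y + u))"
  proof (intro Bochner_Integration.integral_cong refl)
    fix y
    have "(CLINT x|lborel. g x) = (CLINT u|lborel. g (y + u))"
      by (subst lborel_integral_real_affine[of 1 _ y]) auto
    then show "cnj (g y) * (CLINT x|lborel. g x) = (CLINT u|lborel. cnj (g y) * g (y + u))" by simp
  qed
  also have "\<dots> = (CLINT u|lborel. CLINT y|lborel. cnj (g y) * g (y + u))"
    by (rule lborel_pair.Fubini_integral[OF H, symmetric])
  also have "\<dots> = (CLINT u|lborel. of_real (sqrt (1 / 2)) * (of_real (exp (- (pi * (1 + t\<^sup>2) / 2 * u\<^sup>2))) * iexp (- (2 * pi * \<xi>) * u)))"
  proof (intro Bochner_Integration.integral_cong refl)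
    fix u
    have "(CLINT y|lborel. cnj (g y) * g (y + u)) = (CLINT w|lborel. cnj (g (- (u / 2) + w)) * g (- (u / 2) + w + u))"
      by (subst lborel_integral_real_affine[of 1 _ "- (u / 2)"]) auto
    also have "\<dots> = (of_real (exp (- (pi / 2 * u\<^sup>2))) * iexp (- (2 * pi * \<xi>) * u)) *
      (CLINT w|lborel. of_real (exp (- (2 * pi * w\<^sup>2))) * iexp (- (2 * pi * t * u) * w))"
      unfolding gg by (rule integral_mult_right_zero)
    also have "(CLINT w|lborel. of_real (exp (- (2 * pi * w\<^sup>2))) * iexp (- (2 * pi * t * u) * w)) =
      of_real (sqrt (pi / (2 * pi)) * exp (- ((- (2 * pi * t * u))\<^sup>2 / (4 * (2 * pi)))))"
      by (rule integral_gauss_iexp) simp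
    also have "(- (2 * pi * t * u))\<^sup>2 / (4 * (2 * pi)) = pi / 2 * t\<^sup>2 * u\<^sup>2"
      by (simp add: power2_eq_square)
    finally show "(CLINT y|lborel. cnj (g y) * g (y + u)) =
      of_real (sqrt (1 / 2)) * (of_real (exp (- (pi * (1 + t\<^sup>2) / 2 * u\<^sup>2))) * iexp (- (2 * pi * \<xi>) * u))"
      by (simp add: exp_of_real[symmetric] mult_exp_exp algebra_simps add_divide_distrib)
  qed
  also have "\<dots> = of_real (sqrt (1 / 2)) * (CLINT u|lborel. of_real (exp (- (pi * (1 + t\<^sup>2) / 2 * u\<^sup>2))) * iexp (- (2 * pi * \<xi>) * u))"
    by (rule integral_mult_right_zero)
  also have "(CLINT u|lborel. of_real (exp (- (pi * (1 + t\<^sup>2) / 2 * u\<^sup>2))) * iexp (- (2 * pi * \<xi>) * u)) =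
      of_real (sqrt (pi / (pi * (1 + t\<^sup>2) / 2)) * exp (- ((- (2 * pi * \<xi>))\<^sup>2 / (4 * (pi * (1 + t\<^sup>2) / 2)))))"
    using t by (intro integral_gauss_iexp) simp
  also have "(- (2 * pi * \<xi>))\<^sup>2 / (4 * (pi * (1 + t\<^sup>2) / 2)) = 2 * pi * \<xi>\<^sup>2 / (1 + t\<^sup>2)"
    by (rule sq)
  also have "pi / (pi * (1 + t\<^sup>2) / 2) = 2 / (1 + t\<^sup>2)" by simp
  finally have "complex_of_real ((cmod (fourier f \<xi>))\<^sup>2) =
    of_real (sqrt (1 / 2) * (sqrt (2 / (1 + t\<^sup>2)) * exp (- (2 * pi * \<xi>\<^sup>2 / (1 + t\<^sup>2)))))" by simp
  then have "(cmod (fourier f \<xi>))\<^sup>2 = sqrt (1 / 2) * (sqrt (2 / (1 + t\<^sup>2)) * exp (- (2 * pi * \<xi>\<^sup>2 / (1 + t\<^sup>2))))"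
    by (simp only: of_real_eq_iff)
  then show "(cmod (fourier f \<xi>))\<^sup>2 = 1 / sqrt (1 + t\<^sup>2) * exp (- (2 * pi * \<xi>\<^sup>2 / (1 + t\<^sup>2)))"
    by (simp add: real_sqrt_divide)
qed

text \<open>With W^2 = 1 + t^2, the chirp has modular at most 2 whatever p and t are: its modulus is
  a Gaussian bounded by 1 with integral 1. On [-W, W] its transform is of order W^(-1/2), so the
  modular on the other side is at least of order W^(1 - u/2), which is unbounded if u < 2.\<close>

lemma fourier_bounded_imp_ge_2:
  assumes bd: "fourier_bounded p q" and p: "p \<in> exponents" and q: "q \<in> exponents"
    and qu: "AE x in lebesgue. q x \<le> ennreal u" and u: "0 < u"
  shows "2 \<le> u"
proof (rule ccontr)
  assume "\<not> ?thesis"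
  then have u2: "u < 2" by simp
  note [measurable] = exponents_measurable[OF q] exponents_measurable[OF p]
  obtain C where C: "0 < C" "\<And>f l. integrable lebesgue f \<Longrightarrow> 0 < l \<Longrightarrow> modular p (\<lambda>x. f x / of_real l) \<le> 1 \<Longrightarrow>
      modular q (\<lambda>\<xi>. fourier f \<xi> / of_real (C * l)) \<le> 1"
    by (rule fourier_bounded_modular[OF p q bd]) (rule that)
  \<comment> \<open>exp (- pi) is the square root of the Gaussian factor at the ends of [-W, W]; the
    2 is the scale that brings the modular of the chirp below 1.\<close>
  define k where "k = exp (- pi) / (C * 2)"
  have k: "0 < k" using C by (simp add: k_def)
  \<comment> \<open>The second condition says that the height T is at most 1, for comparing T^u with
    T^q; the third contradicts the bound on the modular.\<close>
  have "\<forall>\<^sub>F W in at_top. 1 < W \<and> k * W powr (- 1 / 2) \<le> 1 \<and> 1 < 2 * k powr u * W powr (1 - u / 2)"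
  proof (intro eventually_conj eventually_gt_at_top)
    show "\<forall>\<^sub>F W in at_top. k * W powr (- 1 / 2) \<le> 1" by real_asymp
    define K w where "K = k powr u" and "w = 1 - u / 2"
    have "0 < K" "0 < w" using k u2 by (auto simp: K_def w_def)
    then have "\<forall>\<^sub>F W in at_top. 1 < 2 * K * W powr w" by real_asymp
    then show "\<forall>\<^sub>F W in at_top. 1 < 2 * k powr u * W powr (1 - u / 2)" by (simp add: K_def w_def)
  qed
  from eventually_happens'[OF _ this] obtain W where W: "1 < W" "k * W powr (- 1 / 2) \<le> 1"
    "1 < 2 * k powr u * W powr (1 - u / 2)" by auto
  define t where "t = sqrt (W\<^sup>2 - 1)"
  have t: "1 + t\<^sup>2 = W\<^sup>2" using W(1) by (simp add: t_def one_le_power)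
  define f where "f x = complex_of_real (exp (- (pi * x\<^sup>2))) * iexp (- (pi * t * x\<^sup>2))" for x
  note f_int = fourier_chirp(1)[of t, folded f_def]
  have f_norm: "(cmod (fourier f \<xi>))\<^sup>2 = 1 / W * exp (- (2 * pi * \<xi>\<^sup>2 / W\<^sup>2))" for \<xi>
    using fourier_chirp(2)[of t \<xi>, folded f_def] W(1) by (simp add: t)
  note f_meas [measurable] = borel_measurable_integrable[OF f_int]
  have "modular p f \<le> 1 + 1"
  proof (rule modular_upper[OF exponents_measurable[OF p] f_meas])
    have "(\<integral>\<^sup>+x\<in>{x. p x \<noteq> \<infinity>}. ennreal (cmod (f x) powr enn2real (p x)) \<partial>lebesgue) \<le>
      (\<integral>\<^sup>+x. ennreal (exp (- (pi * x\<^sup>2))) \<partial>lebesgue)"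
    proof (rule nn_integral_mono)
      fix x
      show "ennreal (cmod (f x) powr enn2real (p x)) * indicator {x. p x \<noteq> \<infinity>} x \<le> ennreal (exp (- (pi * x\<^sup>2)))"
      proof (cases "p x = \<infinity>")
        case False
        then have "1 \<le> enn2real (p x)" using exponents_ge_1[OF p, of x] by (cases "p x") auto
        then have "exp (- (pi * x\<^sup>2)) powr enn2real (p x) \<le> exp (- (pi * x\<^sup>2)) powr 1"
          by (intro powr_mono') auto
        then show ?thesis using False by (simp add: f_def norm_mult ennreal_leI)
      qed simp
    qed
    also have "\<dots> = ennreal (LINT x|lebesgue. exp (- (pi * x\<^sup>2)))"
      using integrable_lebesgue_gauss[of pi] by (intro nn_integral_eq_integral) auto
    also have "(LINT x|lebesgue. exp (- (pi * x\<^sup>2))) = 1"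
      using integral_gauss[of pi] by (subst integral_completion) auto
    finally show "(\<integral>\<^sup>+x\<in>{x. p x \<noteq> \<infinity>}. ennreal (cmod (f x) powr enn2real (p x)) \<partial>lebesgue) \<le> 1" by simp
    show "AE x in lebesgue. p x = \<infinity> \<longrightarrow> ennreal (cmod (f x)) \<le> 1"
      by (intro AE_I2) (simp add: f_def norm_mult ennreal_le_1)
  qed
  then have "ennreal (1 / 2) * modular p f \<le> ennreal (1 / 2) * 2"
    by (intro mult_left_mono) auto
  also have "\<dots> = ennreal (1 / 2 * 2)" by (subst ennreal_mult) auto
  finally have "ennreal (1 / 2) * modular p f \<le> 1" by simp
  with modular_scale[OF exponents_measurable[OF p] exponents_ge_1[OF p] f_meas, of 2]
  have "modular p (\<lambda>x. f x / of_real 2) \<le> 1" by (metis order_trans one_le_numeral)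
  from C(2)[OF f_int _ this] have m: "modular q (\<lambda>\<xi>. fourier f \<xi> / of_real (C * 2)) \<le> 1" by simp
  define T where "T = k * W powr (- 1 / 2)"
  have T: "0 < T" "T \<le> 1" using W k by (auto simp: T_def)
  define B where "B = {- W..W}"
  have B: "B \<in> sets lebesgue" by (simp add: B_def)
  have gT: "T \<le> cmod (fourier f \<xi> / of_real (C * 2))" if "\<xi> \<in> B" for \<xi>
  proof -
    have "\<bar>\<xi>\<bar> \<le> \<bar>W\<bar>" using that W(1) by (auto simp: B_def abs_le_iff)
    then have "\<xi>\<^sup>2 \<le> W\<^sup>2" by (simp add: abs_le_square_iff)
    then have "2 * pi * (\<xi>\<^sup>2 / W\<^sup>2) \<le> 2 * pi * 1" using W(1) by (intro mult_left_mono) (auto simp: field_simps)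
    then have "1 / W * exp (- (2 * pi)) \<le> (cmod (fourier f \<xi>))\<^sup>2"
      unfolding f_norm using W(1) by (intro mult_left_mono) auto
    also have "1 / W * exp (- (2 * pi)) = (W powr (- 1 / 2) * exp (- pi))\<^sup>2"
      using W(1) by (simp add: power_mult_distrib powr_minus_divide powr_half_sqrt power_divide exp_double[symmetric] power2_eq_square mult_exp_exp)
    finally have "W powr (- 1 / 2) * exp (- pi) \<le> cmod (fourier f \<xi>)"
      by (rule power2_le_imp_le) simp
    then have "W powr (- 1 / 2) * exp (- pi) / (C * 2) \<le> cmod (fourier f \<xi>) / (C * 2)"
      using C(1) by (intro divide_right_mono) auto
    then show ?thesis using C(1) by (simp add: T_def k_def norm_divide norm_mult mult.commute)
  qed
  have g_meas: "(\<lambda>\<xi>. fourier f \<xi> / of_real (C * 2)) \<in> borel_measurable lebesgue" by measurable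
  have "ennreal (T powr u) * emeasure lebesgue B \<le> 1"
  proof (rule modular_ge_emeasure[OF q g_meas B _ _ m])
    show "AE x in lebesgue. x \<in> B \<longrightarrow> q x \<noteq> \<infinity> \<and> T powr u \<le> cmod (fourier f x / of_real (C * 2)) powr enn2real (q x)"
      using qu
    proof eventually_elim
      case (elim x)
      show ?case
      proof
        assume x: "x \<in> B"
        have fin: "q x \<noteq> \<infinity>" using elim by (auto simp: top_unique)
        have "enn2real (q x) \<le> u" using elim u by (cases "q x") (auto simp: top_unique)
        then have "T powr u \<le> T powr enn2real (q x)" using T by (intro powr_mono') auto
        also have "\<dots> \<le> cmod (fourier f x / of_real (C * 2)) powr enn2real (q x)"
          using T gT[OF x] by (intro powr_mono2) auto
        finally show "q x \<noteq> \<infinity> \<and> T powr u \<le> cmod (fourier f x / of_real (C * 2)) powr enn2real (q x)"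
          using fin by simp
      qed
    qed
  qed simp
  then have "T powr u * (2 * W) \<le> 1"
    using W(1) by (simp add: B_def ennreal_mult[symmetric] ennreal_le_1)
  moreover have "T powr u * (2 * W) = 2 * k powr u * W powr (1 - u / 2)"
  proof -
    have "T powr u = k powr u * W powr (- u / 2)"
      using k W(1) by (simp add: T_def powr_mult powr_powr)
    moreover have "W powr (1 - u / 2) = W * W powr (- u / 2)"
      using W(1) powr_add[of W 1 "- u / 2"] by simp
    ultimately show ?thesis by simp
  qed
  ultimately show False using W(3) by simp
qed


section \<open>Necessity\<close>

lemma inverse_inverse_ennreal: "inverse (inverse x) = (x :: ennreal)"
  by (cases x; cases "x = 0") (auto simp: inverse_ennreal)

lemma inverse_ennreal_ge_1:
  assumes "1 \<le> (x :: ennreal)"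
  obtains r where "inverse x = ennreal r" "0 \<le> r" "r \<le> 1"
proof (cases x)
  case (real a)
  with assms have "1 \<le> a" by (simp add: ennreal_ge_1)
  with real show ?thesis by (intro that[of "inverse a"]) (auto simp: inverse_ennreal inverse_le_1_iff)
qed (use that[of 0] in auto)

lemma less_inverse_imp:
  assumes "ennreal r < inverse x" "0 < r"
  shows "x < ennreal (1 / r)"
proof (cases x)
  case (real a)
  show ?thesis
  proof (cases "a = 0")
    case False
    with real assms have "r < inverse a" by (simp add: inverse_ennreal ennreal_less_iff)
    with real False assms(2) show ?thesis by (simp add: ennreal_less_iff field_simps)
  qed (use real assms in simp)
qed (use assms in simp)

lemma inverse_less_imp:
  assumes "inverse x < ennreal r"
  shows "ennreal (1 / r) < x"
proof -
  have r: "0 < r" using assms by (metis ennreal_neg not_less not_less_zero)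
  show ?thesis
  proof (cases x)
    case (real a)
    show ?thesis
    proof (cases "a = 0")
      case False
      with real assms have "inverse a < r" by (simp add: inverse_ennreal ennreal_less_iff)
      with real False r show ?thesis by (simp add: ennreal_less_iff field_simps)
    qed (use real assms in simp)
  qed simp
qed

text \<open>\<open>P\<close> and \<open>Q\<close> stand for the limit exponents at one end. In
  reciprocals the scaling inequalities read iP + iq >= 1 and ip + iQ <= 1, while iP <= ip and iq <=
  iQ; together these force equality throughout. Reciprocals are real numbers in [0, 1], so infinite
  exponents fit in uniformly.\<close>

lemma fourier_bounded_limit_exponents:
  assumes bd: "fourier_bounded p q" and p: "p \<in> exponents" and q: "q \<in> exponents"
    and pP: "essinf lebesgue p \<le> P" and Qq: "Q \<le> esssup lebesgue q"
    and pt: "\<And>s L. ennreal s < P \<Longrightarrow> 0 < L \<Longrightarrow> \<exists>c. AE x in lebesgue. x \<in> {c..c + L} \<longrightarrow> ennreal s \<le> p x"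
    and qt: "\<And>u L. Q < ennreal u \<Longrightarrow> 0 < L \<Longrightarrow> \<exists>c. AE x in lebesgue. x \<in> {c..c + L} \<longrightarrow> q x \<le> ennreal u"
  shows "P = essinf lebesgue p" "Q = esssup lebesgue q" "conj_exponent (essinf lebesgue p) = esssup lebesgue q"
proof -
  define pm where "pm = essinf lebesgue p"
  define qp where "qp = esssup lebesgue q"
  have pm1: "1 \<le> pm" using exponents_ge_1[OF p] by (simp add: pm_def le_essinfI)
  \<comment> \<open>Otherwise q would be below 1 almost everywhere on an interval of length 1, which
    is not a null set.\<close>
  have Q1: "1 \<le> Q"
  proof (rule ccontr)
    assume "\<not> 1 \<le> Q"
    then obtain r where r: "Q < r" "r < 1" using dense[of Q 1] by (auto simp: not_le)
    then obtain u where "r = ennreal u" by (cases r) auto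
    with r(1) qt[of u 1] obtain c where c: "AE x in lebesgue. x \<in> {c..c + 1} \<longrightarrow> q x \<le> r" by auto
    then have "AE x in lebesgue. x \<notin> {c..c + 1}"
    proof eventually_elim
      case (elim x)
      have "\<not> q x \<le> r" using less_le_trans[OF r(2) exponents_ge_1[OF q, of x]] by simp
      then show ?case using elim by blast
    qed
    then have "emeasure lebesgue {c..c + 1} = 0"
      by (subst (asm) AE_iff_measurable[of "{c..c + 1}"]) auto
    then show False by simp
  qed
  have qp1: "1 \<le> qp" using Q1 Qq by (simp add: qp_def)
  have P1: "1 \<le> P" using pm1 pP by (simp add: pm_def)
  obtain iP where iP: "inverse P = ennreal iP" "0 \<le> iP" "iP \<le> 1" using inverse_ennreal_ge_1[OF P1] .
  obtain ip where ip: "inverse pm = ennreal ip" "0 \<le> ip" "ip \<le> 1" using inverse_ennreal_ge_1[OF pm1] .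
  obtain iQ where iQ: "inverse Q = ennreal iQ" "0 \<le> iQ" "iQ \<le> 1" using inverse_ennreal_ge_1[OF Q1] .
  obtain iq where iq: "inverse qp = ennreal iq" "0 \<le> iq" "iq \<le> 1" using inverse_ennreal_ge_1[OF qp1] .
  have anti: "inverse y \<le> inverse x" if "x \<le> y" for x y :: ennreal
    using that by (cases x; cases y; cases "x = 0"; cases "y = 0") (auto simp: inverse_ennreal top_unique)
  have "iP \<le> ip" using anti[OF pP] iP ip by (simp add: pm_def)
  have "iq \<le> iQ" using anti[OF Qq] iq iQ by (simp add: qp_def)
  have ge: "1 \<le> iP + iq"
  proof (rule ccontr)
    assume "\<not> ?thesis"
    \<comment> \<open>Moving both reciprocals up by a quarter of the gap gives finite exponents
      strictly below \<open>P\<close> and \<open>qp\<close> whose reciprocals still add up to less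
      than 1.\<close>
    define d where "d = (1 - iP - iq) / 4"
    have d: "0 < d" "iP + iq + 4 * d = 1" using \<open>\<not> 1 \<le> iP + iq\<close> by (auto simp: d_def field_simps)
    have "inverse P < ennreal (iP + d)" "inverse qp < ennreal (iq + d)"
      using iP iq d by (auto simp: ennreal_less_iff)
    then have s: "ennreal (1 / (iP + d)) < P" and u: "ennreal (1 / (iq + d)) < qp"
      by (auto intro: inverse_less_imp)
    have "1 \<le> 1 / (1 / (iP + d)) + 1 / (1 / (iq + d))"
    proof (rule fourier_bounded_imp_inverse_sum_ge_1[OF bd p q])
      show "\<exists>c. AE x in lebesgue. x \<in> {c..c + L} \<longrightarrow> ennreal (1 / (iP + d)) \<le> p x" if "0 < L" for L
        by (rule pt[OF s that])
      show "\<not> (AE x in lebesgue. q x < ennreal (1 / (iq + d)))"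
      proof
        assume "AE x in lebesgue. q x < ennreal (1 / (iq + d))"
        then have "qp \<le> ennreal (1 / (iq + d))"
          unfolding qp_def by (intro esssup_I exponents_measurable[OF q]) (auto elim: eventually_mono)
        with u show False by simp
      qed
    qed (use iP iq d in auto)
    then show False using d by simp
  qed
  have le: "ip + iQ \<le> 1"
  proof (rule ccontr)
    assume "\<not> ?thesis"
    define d where "d = (ip + iQ - 1) / 4"
    have d: "0 < d" "ip + iQ = 1 + 4 * d" using \<open>\<not> ip + iQ \<le> 1\<close> by (auto simp: d_def field_simps)
    \<comment> \<open>As iQ <= 1, ip is at least 4d, and symmetrically; so the shifted reciprocals
      stay positive. ip - d < 1 gives the exponent above 1 that the lemma asks for.\<close>
    have pos: "0 < ip - d" "0 < iQ - d" "ip - d < 1" using d ip iQ by auto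
    have "ennreal (ip - d) < inverse pm" "ennreal (iQ - d) < inverse Q"
      using ip iQ d pos by (auto simp: ennreal_less_iff)
    then have s: "pm < ennreal (1 / (ip - d))" and u: "Q < ennreal (1 / (iQ - d))"
      using pos by (auto intro: less_inverse_imp)
    have "1 / (1 / (ip - d)) + 1 / (1 / (iQ - d)) \<le> 1"
    proof (rule fourier_bounded_imp_inverse_sum_le_1[OF bd p q])
      show "\<exists>c. AE x in lebesgue. x \<in> {c..c + L} \<longrightarrow> q x \<le> ennreal (1 / (iQ - d))" if "0 < L" for L
        by (rule qt[OF u that])
      show "\<not> (AE x in lebesgue. ennreal (1 / (ip - d)) < p x)"
      proof
        assume "AE x in lebesgue. ennreal (1 / (ip - d)) < p x"
        then have "ennreal (1 / (ip - d)) \<le> pm"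
          unfolding pm_def by (intro le_essinfI) (auto elim: eventually_mono)
        with s show False by simp
      qed
    qed (use pos in auto)
    then show False using d by simp
  qed
  have eqs: "iP = ip" "iQ = iq" "iq = 1 - ip"
    using ge le \<open>iP \<le> ip\<close> \<open>iq \<le> iQ\<close> by linarith+
  show "P = essinf lebesgue p"
    using iP ip eqs inverse_inverse_ennreal[of P] inverse_inverse_ennreal[of pm] by (simp add: pm_def)
  show "Q = esssup lebesgue q"
    using iQ iq eqs inverse_inverse_ennreal[of Q] inverse_inverse_ennreal[of qp] by (simp add: qp_def)
  have "conj_exponent pm = inverse (ennreal iq)"
    unfolding conj_exponent_def ip(1) eqs(3) using ip(2,3) ennreal_minus[of ip 1] by simp
  also have "\<dots> = qp" using iq inverse_inverse_ennreal[of qp] by simp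
  finally show "conj_exponent (essinf lebesgue p) = esssup lebesgue q"
    by (simp add: pm_def qp_def)
qed

section \<open>The limits at the two ends of the line\<close>

lemma tendsto_SUP_at_top:
  fixes f :: "real \<Rightarrow> ennreal"
  assumes "mono f" shows "(f \<longlongrightarrow> (SUP x. f x)) at_top"
proof (rule order_tendstoI)
  fix a assume "a < (SUP x. f x)"
  then obtain x where x: "a < f x" by (auto simp: less_SUP_iff)
  show "\<forall>\<^sub>F y in at_top. a < f y"
    by (rule eventually_mono[OF eventually_ge_at_top[of x]]) (rule less_le_trans[OF x monoD[OF assms]])
next
  fix a assume "(SUP x. f x) < a"
  then show "\<forall>\<^sub>F x in at_top. f x < a"
    by (intro always_eventually allI le_less_trans[OF SUP_upper[OF UNIV_I, of f]])
qed

lemma tendsto_INF_at_top: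
  fixes f :: "real \<Rightarrow> ennreal"
  assumes "antimono f" shows "(f \<longlongrightarrow> (INF x. f x)) at_top"
proof (rule order_tendstoI)
  fix a assume "(INF x. f x) < a"
  then obtain x where x: "f x < a" by (auto simp: INF_less_iff)
  show "\<forall>\<^sub>F y in at_top. f y < a"
    by (rule eventually_mono[OF eventually_ge_at_top[of x]]) (rule le_less_trans[OF antimonoD[OF assms] x])
next
  fix a assume "a < (INF x. f x)"
  then show "\<forall>\<^sub>F x in at_top. a < f x"
    by (intro always_eventually allI less_le_trans[OF _ INF_lower[OF UNIV_I, of f]])
qed

lemma essinf_lebesgue_on_mono:
  assumes "S \<subseteq> T" "S \<in> sets lebesgue" "T \<in> sets lebesgue"
  shows "essinf (lebesgue_on T) p \<le> essinf (lebesgue_on S) p"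
proof (rule le_essinfI)
  show "AE x in lebesgue_on S. essinf (lebesgue_on T) p \<le> p x"
    using essinf_AE[of "lebesgue_on T" p] assms(1)
    unfolding AE_lebesgue_on_iff[OF assms(2)] AE_lebesgue_on_iff[OF assms(3)]
    by (auto elim: eventually_mono)
qed

lemma esssup_lebesgue_on_mono:
  assumes "S \<subseteq> T" "S \<in> sets lebesgue" "T \<in> sets lebesgue" "q \<in> borel_measurable lebesgue"
  shows "esssup (lebesgue_on S) q \<le> esssup (lebesgue_on T) q"
proof (rule esssup_I)
  show "AE x in lebesgue_on S. q x \<le> esssup (lebesgue_on T) q"
    using esssup_AE[of q "lebesgue_on T"] assms(1)
    unfolding AE_lebesgue_on_iff[OF assms(2)] AE_lebesgue_on_iff[OF assms(3)]
    by (auto elim: eventually_mono)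
qed (intro measurable_restrict_space1 assms)

lemma lebesgue_on_UNIV: "lebesgue_on UNIV = lebesgue"
  by (intro measure_eqI) (auto simp: emeasure_restrict_space sets_restrict_space)

text \<open>Both ends of the line are handled at once: \<open>S M\<close> is a half-line.\<close>

lemma fourier_bounded_tails:
  fixes S :: "real \<Rightarrow> real set"
  assumes bd: "fourier_bounded p q" and p: "p \<in> exponents" and q: "q \<in> exponents"
    and S: "\<And>M. S M \<in> sets lebesgue" and long: "\<And>M L. \<exists>c. {c..c + L} \<subseteq> S M"
    and P: "P = (SUP M. essinf (lebesgue_on (S M)) p)" and Q: "Q = (INF M. esssup (lebesgue_on (S M)) q)"
  shows "P = essinf lebesgue p \<and> Q = esssup lebesgue q \<and> conj_exponent (essinf lebesgue p) = esssup lebesgue q"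
proof -
  have pP: "essinf lebesgue p \<le> P"
    unfolding P using essinf_lebesgue_on_mono[of "S 0" UNIV p] S
    by (intro SUP_upper2[of 0]) (simp_all add: lebesgue_on_UNIV)
  have Qq: "Q \<le> esssup lebesgue q"
    unfolding Q using esssup_lebesgue_on_mono[of "S 0" UNIV q] S exponents_measurable[OF q]
    by (intro INF_lower2[of 0]) (simp_all add: lebesgue_on_UNIV)
  have pt: "\<exists>c. AE x in lebesgue. x \<in> {c..c + L} \<longrightarrow> ennreal s \<le> p x" if sP: "ennreal s < P" for s L
  proof -
    obtain M where M: "ennreal s < essinf (lebesgue_on (S M)) p"
      using sP by (auto simp: P less_SUP_iff)
    obtain c where c: "{c..c + L} \<subseteq> S M" using long by blast
    have "AE x in lebesgue. x \<in> S M \<longrightarrow> essinf (lebesgue_on (S M)) p \<le> p x"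
      using essinf_AE[of "lebesgue_on (S M)" p] unfolding AE_lebesgue_on_iff[OF S] .
    then have "AE x in lebesgue. x \<in> {c..c + L} \<longrightarrow> ennreal s \<le> p x"
      by eventually_elim (use M c in \<open>blast intro: order_trans[OF less_imp_le]\<close>)
    then show ?thesis by blast
  qed
  have qt: "\<exists>c. AE x in lebesgue. x \<in> {c..c + L} \<longrightarrow> q x \<le> ennreal u" if uQ: "Q < ennreal u" for u L
  proof -
    obtain M where M: "esssup (lebesgue_on (S M)) q < ennreal u"
      using uQ by (auto simp: Q INF_less_iff)
    obtain c where c: "{c..c + L} \<subseteq> S M" using long by blast
    have "AE x in lebesgue. x \<in> S M \<longrightarrow> q x \<le> esssup (lebesgue_on (S M)) q"
      using esssup_AE[of q "lebesgue_on (S M)"] unfolding AE_lebesgue_on_iff[OF S] .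
    then have "AE x in lebesgue. x \<in> {c..c + L} \<longrightarrow> q x \<le> ennreal u"
      by eventually_elim (use M c in \<open>blast intro: order_trans[OF _ less_imp_le]\<close>)
    then show ?thesis by blast
  qed
  show ?thesis
    by (intro conjI fourier_bounded_limit_exponents[OF bd p q pP Qq pt qt])
qed

theorem fourier_bounded_necessary:
  assumes bd: "fourier_bounded p q" and p: "p \<in> exponents" and q: "q \<in> exponents"
  shows "ess_inf_at_right p = essinf lebesgue p" "ess_inf_at_left p = essinf lebesgue p"
    "essinf lebesgue p \<le> 2"
    "ess_sup_at_right q = esssup lebesgue q" "ess_sup_at_left q = esssup lebesgue q"
    "conj_exponent (essinf lebesgue p) = esssup lebesgue q"
proof -
  \<comment> \<open>The left end is reparametrised by - M, so that monotone limits at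
    \<open>at_top\<close> serve both ends.\<close>
  have mono: "mono (\<lambda>M. essinf (lebesgue_on {M..}) p)" "mono (\<lambda>M. essinf (lebesgue_on {..- M}) p)"
    by (auto intro!: monoI essinf_lebesgue_on_mono)
  have anti: "antimono (\<lambda>M. esssup (lebesgue_on {M..}) q)" "antimono (\<lambda>M. esssup (lebesgue_on {..- M}) q)"
    by (auto intro!: antimonoI esssup_lebesgue_on_mono exponents_measurable[OF q])
  have lim: "ess_inf_at_right p = (SUP M. essinf (lebesgue_on {M..}) p)"
    "ess_sup_at_right q = (INF M. esssup (lebesgue_on {M..}) q)"
    "ess_inf_at_left p = (SUP M. essinf (lebesgue_on {..- M}) p)"
    "ess_sup_at_left q = (INF M. esssup (lebesgue_on {..- M}) q)"
    unfolding ess_inf_at_right_def ess_sup_at_right_def ess_inf_at_left_def ess_sup_at_left_def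
    using tendsto_SUP_at_top[OF mono(1)] tendsto_SUP_at_top[OF mono(2)]
      tendsto_INF_at_top[OF anti(1)] tendsto_INF_at_top[OF anti(2)]
    by (auto intro!: tendsto_Lim simp: filterlim_at_bot_mirror)
  have R: "ess_inf_at_right p = essinf lebesgue p \<and> ess_sup_at_right q = esssup lebesgue q \<and>
      conj_exponent (essinf lebesgue p) = esssup lebesgue q"
  proof (rule fourier_bounded_tails[OF bd p q _ _ lim(1,2)])
    show "\<exists>c. {c..c + L} \<subseteq> {M..}" for M L :: real by (rule exI[of _ M]) auto
  qed auto
  have L: "ess_inf_at_left p = essinf lebesgue p \<and> ess_sup_at_left q = esssup lebesgue q \<and>
      conj_exponent (essinf lebesgue p) = esssup lebesgue q"
  proof (rule fourier_bounded_tails[OF bd p q _ _ lim(3,4)])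
    show "\<exists>c. {c..c + L} \<subseteq> {..- M}" for M L :: real by (rule exI[of _ "- M - L"]) auto
  qed auto
  show "ess_inf_at_right p = essinf lebesgue p" "ess_inf_at_left p = essinf lebesgue p"
    "ess_sup_at_right q = esssup lebesgue q" "ess_sup_at_left q = esssup lebesgue q"
    "conj_exponent (essinf lebesgue p) = esssup lebesgue q"
    using R L by auto
  show "essinf lebesgue p \<le> 2"
  proof (rule ccontr)
    assume "\<not> ?thesis"
    then have gt: "2 < essinf lebesgue p" by simp
    have "esssup lebesgue q < 2"
    proof (cases "essinf lebesgue p")
      case (real a)
      have "ennreal 2 < ennreal a" using gt real by simp
      then have "2 < a" by (subst (asm) ennreal_less_iff) auto
      then have "a / (a - 1) < 2" by (simp add: pos_divide_less_eq)
      then have "ennreal (a / (a - 1)) < ennreal 2" by (rule ennreal_lessI[rotated]) simp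
      then have "conj_exponent (ennreal a) < 2"
        using \<open>2 < a\<close> by (simp add: conj_exponent_ennreal)
      then show ?thesis using R real by simp
    next
      \<comment> \<open>The conjugate of an infinite exponent is 1, again below 2.\<close>
      case top
      then have "esssup lebesgue q = conj_exponent top" using R by simp
      also have "\<dots> = ennreal 1" by (simp add: conj_exponent_def)
      also have "\<dots> < ennreal 2" by (rule ennreal_lessI) auto
      also have "\<dots> = 2" by simp
      finally show ?thesis .
    qed
    then obtain r where r: "esssup lebesgue q < r" "r < 2" using dense by blast
    then obtain u where u: "r = ennreal u" "0 \<le> u" by (cases r) auto
    have "AE x in lebesgue. q x \<le> ennreal u"
      using esssup_AE[of q lebesgue] unfolding u(1)[symmetric]
      by eventually_elim (rule order_trans[OF _ less_imp_le[OF r(1)]])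
    moreover have "0 < u" using r(1) u by (cases "u = 0") auto
    ultimately have "2 \<le> u" by (rule fourier_bounded_imp_ge_2[OF bd p q])
    then have "ennreal 2 \<le> ennreal u" by (rule ennreal_leI)
    then show False using r(2) u(1) by simp
  qed
qed

theorem theorem1p1:
  fixes p q :: "real \<Rightarrow> ennreal"
  assumes "p \<in> exponents" and "q \<in> exponents"
  shows "(essinf lebesgue p \<le> 2 \<and>
          esssup lebesgue q \<le> conj_exponent (essinf lebesgue p) \<and>
          (\<lambda>_. 1) \<in> var_Lebesgue (\<lambda>x. defect_exponent (essinf lebesgue p) (p x)) \<inter>
                    var_Lebesgue (\<lambda>x. defect_exponent (q x) (conj_exponent (essinf lebesgue p)))
            \<longrightarrow> fourier_bounded p q) \<and>
         (fourier_bounded p q \<longrightarrow>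
            ess_inf_at_right p = essinf lebesgue p \<and>
            ess_inf_at_left p = essinf lebesgue p \<and>
            essinf lebesgue p \<le> 2 \<and>
            ess_sup_at_right q = esssup lebesgue q \<and>
            ess_sup_at_left q = esssup lebesgue q \<and>
            conj_exponent (essinf lebesgue p) = esssup lebesgue q)"
  by (intro conjI impI; (elim conjE IntE)?)
    (rule fourier_bounded_sufficient fourier_bounded_necessary; (rule assms | assumption))+

end
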